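(* Let $\mathcal C$ be a connected cogroupoid over a field $k$. Then for any $X,Y\in\mathrm{ob}(\mathcal C)$, the functors $$\mathrm{Comod}(\mathcal C(X,X))\to\mathrm{Comod}(\mathcal C(Y,Y)),\quad V\mapsto V\square_{\mathcal C(X,X)}\mathcal C(X,Y)$$ and $$\mathrm{Comod}(\mathcal C(Y,Y))\to\mathrm{Comod}(\mathcal C(X,X)),\quad V\mapsto V\square_{\mathcal C(Y,Y)}\mathcal C(Y,X)$$ are $k$-linear equivalences of monoidal categories that are inverse of each other.
   Context: Algebras are associative unital $k$-algebras, $m$ denotes multiplication. A cocategory $\mathcal C$ consists of a set $\mathrm{ob}(\mathcal C)$; for all $X,Y\in \mathrm{ob}(\mathcal C)$ a $k$-algebra $\mathcal C(X,Y)$; and for all $X,Y,Z$ algebra morphisms $\Delta_{X,Y}^Z:\mathcal C(X,Y)\to\mathcal C(X,Z)\otimes\mathcal C(Z,Y)$ and $\varepsilon_X:\mathcal C(X,X)\to k$ such that $(\Delta_{X,Z}^T\otimes 1)\Delta_{X,Y}^Z=(1\otimes\Delta_{T,Y}^Z)\Delta_{X,Y}^T$ and $(1\otimes\varepsilon_Y)\Delta_{X,Y}^Y=\mathrm{id}=(\varepsilon_X\otimes 1)\Delta_{X,Y}^X$. A cogroupoid is a cocategory together with linear maps $S_{X,Y}:\mathcal C(X,Y)\to\mathcal C(Y,X)$ such that for all $X,Y$ and $a\in\mathcal C(X,X)$: $m(1\otimes S_{Y,X})\Delta_{X,X}^Y(a)=\varepsilon_X(a)1$ in $\mathcal C(X,Y)$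 and $m(S_{X,Y}\otimes 1)\Delta_{X,X}^Y(a)=\varepsilon_X(a)1$ in $\mathcal C(Y,X)$. It is connected if $\mathcal C(X,Y)\neq(0)$ for all $X,Y$. Each $\mathcal C(X,X)$ is a Hopf algebra (structure maps $\Delta_{X,X}^X,\varepsilon_X,S_{X,X}$) and $\mathcal C(X,Y)$ is a $\mathcal C(X,X)$-$\mathcal C(Y,Y)$-bicomodule algebra via $\Delta_{X,Y}^X$ and $\Delta_{X,Y}^Y$. $\mathrm{Comod}(H)$ is the monoidal category of right $H$-comodules. For a right $C$-comodule $V$ and left $C$-comodule $W$ with coactions $\alpha_V,\alpha_W$, the cotensor product is $V\square_C W=\ker(\alpha_V\otimes 1_W-1_V\otimes\alpha_W)\subset V\otimes W$. The right $\mathcal C(Y,Y)$-coaction on $V\square_{\mathcal C(X,X)}\mathcal C(X,Y)$ is the restriction of $1_V\otimes\Delta_{X,Y}^Y$. The monoidal structure of the first functor is given by $k\to k\square_{\mathcal C(X,X)}\mathcal C(X,Y)$, $1\mapsto 1\otimes 1$, and by $(\sum_i v_i\otimes a_i)\otimes(\sum_j w_j\otimes b_j)\mapsto\sum_{i,j}v_i\otimes w_j\otimes a_ib_j$; similarly for the second. *)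

theory Defs
  imports "HOL-Algebra.Module"
begin

section \<open>Linear maps and algebras over a field\<close>

text \<open>Vector spaces are \<open>module\<close>s over a \<open>field\<close> in the sense of HOL-Algebra; the ring
  operations of the \<^typ>\<open>('k, 'v) module\<close> record are used only for algebras. The library's
  locale \<open>algebra\<close> is not used because it requires commutativity.\<close>

definition linear_map ::
  "('k, 'r) ring_scheme \<Rightarrow> ('k, 'v, 's) module_scheme \<Rightarrow> ('k, 'w, 't) module_scheme \<Rightarrow> ('v \<Rightarrow> 'w) \<Rightarrow> bool"
  where
  "linear_map K V W f \<longleftrightarrow>
     f \<in> carrier V \<rightarrow> carrier W \<and>
     (\<forall>x\<in>carrier V. \<forall>y\<in>carrier V. f (x \<oplus>\<^bsub>V\<^esub> y) = f x \<oplus>\<^bsub>W\<^esub> f y) \<and>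
     (\<forall>a\<in>carrier K. \<forall>x\<in>carrier V. f (a \<odot>\<^bsub>V\<^esub> x) = a \<odot>\<^bsub>W\<^esub> f x)"

definition assoc_algebra :: "('k, 'r) ring_scheme \<Rightarrow> ('k, 'v, 's) module_scheme \<Rightarrow> bool" where
  "assoc_algebra K A \<longleftrightarrow>
     module K A \<and> ring A \<and>
     (\<forall>a\<in>carrier K. \<forall>x\<in>carrier A. \<forall>y\<in>carrier A.
        (a \<odot>\<^bsub>A\<^esub> x) \<otimes>\<^bsub>A\<^esub> y = a \<odot>\<^bsub>A\<^esub> (x \<otimes>\<^bsub>A\<^esub> y) \<and>
        x \<otimes>\<^bsub>A\<^esub> (a \<odot>\<^bsub>A\<^esub> y) = a \<odot>\<^bsub>A\<^esub> (x \<otimes>\<^bsub>A\<^esub> y))"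

definition algebra_hom ::
  "('k, 'r) ring_scheme \<Rightarrow> ('k, 'v, 's) module_scheme \<Rightarrow> ('k, 'w, 't) module_scheme \<Rightarrow> ('v \<Rightarrow> 'w) \<Rightarrow> bool"
  where "algebra_hom K A B f \<longleftrightarrow> linear_map K A B f \<and> f \<in> ring_hom A B"

definition ground_algebra :: "('k, 'r) ring_scheme \<Rightarrow> ('k, 'k) module" where
  "ground_algebra K =
     \<lparr>carrier = carrier K, mult = mult K, one = one K, zero = zero K, add = add K, smult = mult K\<rparr>"


section \<open>Tensor products\<close>

text \<open>A category of comodules needs one type that holds the elements of all its objects and is
  closed under tensor products. In the type below, elements of tensor products are formal sums
  of pairs of elements, and \<open>Scal\<close> provides the one-dimensional space \<open>k\<close>. The type \<open>'a\<close> of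
  atoms is arbitrary, so that vector spaces carried by a subset of any given type are covered.\<close>

datatype ('k, 'a) univ =
    Atom 'a
  | Scal (scal: 'k)
  | Tens (summands: "(('k, 'a) univ \<times> ('k, 'a) univ) list")

text \<open>The list \<open>[(v\<^sub>1, w\<^sub>1), \<dots>, (v\<^sub>n, w\<^sub>n)]\<close> stands for \<open>v\<^sub>1 \<otimes> w\<^sub>1 + \<dots> + v\<^sub>n \<otimes> w\<^sub>n\<close>.\<close>

inductive tensor_eq ::
  "('k, 'r) ring_scheme \<Rightarrow> ('k, 'v, 's) module_scheme \<Rightarrow> ('k, 'w, 't) module_scheme \<Rightarrow>
   ('v \<times> 'w) list \<Rightarrow> ('v \<times> 'w) list \<Rightarrow> bool"
  for K V W where
    refl: "l \<in> lists (carrier V \<times> carrier W) \<Longrightarrow> tensor_eq K V W l l"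
  | sym: "tensor_eq K V W l l' \<Longrightarrow> tensor_eq K V W l' l"
  | trans: "tensor_eq K V W l l' \<Longrightarrow> tensor_eq K V W l' l'' \<Longrightarrow> tensor_eq K V W l l''"
  | append: "tensor_eq K V W l\<^sub>1 l\<^sub>1' \<Longrightarrow> tensor_eq K V W l\<^sub>2 l\<^sub>2' \<Longrightarrow>
      tensor_eq K V W (l\<^sub>1 @ l\<^sub>2) (l\<^sub>1' @ l\<^sub>2')"
  | commute: "l\<^sub>1 \<in> lists (carrier V \<times> carrier W) \<Longrightarrow> l\<^sub>2 \<in> lists (carrier V \<times> carrier W) \<Longrightarrow>
      tensor_eq K V W (l\<^sub>1 @ l\<^sub>2) (l\<^sub>2 @ l\<^sub>1)"
  | zero: "w \<in> carrier W \<Longrightarrow> tensor_eq K V W [(\<zero>\<^bsub>V\<^esub>, w)] []"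
  | add_left: "v \<in> carrier V \<Longrightarrow> v' \<in> carrier V \<Longrightarrow> w \<in> carrier W \<Longrightarrow>
      tensor_eq K V W [(v \<oplus>\<^bsub>V\<^esub> v', w)] [(v, w), (v', w)]"
  | add_right: "v \<in> carrier V \<Longrightarrow> w \<in> carrier W \<Longrightarrow> w' \<in> carrier W \<Longrightarrow>
      tensor_eq K V W [(v, w \<oplus>\<^bsub>W\<^esub> w')] [(v, w), (v, w')]"
  | smult: "a \<in> carrier K \<Longrightarrow> v \<in> carrier V \<Longrightarrow> w \<in> carrier W \<Longrightarrow>
      tensor_eq K V W [(a \<odot>\<^bsub>V\<^esub> v, w)] [(v, a \<odot>\<^bsub>W\<^esub> w)]"

text \<open>Each class of formal sums is represented by a chosen member.\<close>

definition tensor_class ::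
  "('k, 'r) ring_scheme \<Rightarrow> ('k, ('k, 'a) univ, 's) module_scheme \<Rightarrow> ('k, ('k, 'a) univ, 't) module_scheme \<Rightarrow>
   (('k, 'a) univ \<times> ('k, 'a) univ) list \<Rightarrow> ('k, 'a) univ"
  where "tensor_class K V W l = Tens (SOME l'. tensor_eq K V W l l')"

definition tensor ::
  "('k, 'r) ring_scheme \<Rightarrow> ('k, ('k, 'a) univ, 's) module_scheme \<Rightarrow> ('k, ('k, 'a) univ, 't) module_scheme \<Rightarrow>
   ('k, ('k, 'a) univ) module"
  where
  "tensor K V W =
     \<lparr>carrier = tensor_class K V W ` lists (carrier V \<times> carrier W),
      mult = undefined, one = undefined,
      zero = tensor_class K V W [],
      add = (\<lambda>x y. tensor_class K V W (summands x @ summands y)),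
      smult = (\<lambda>a x. tensor_class K V W (map (\<lambda>(v, w). (a \<odot>\<^bsub>V\<^esub> v, w)) (summands x)))\<rparr>"

definition pure ::
  "('k, 'r) ring_scheme \<Rightarrow> ('k, ('k, 'a) univ, 's) module_scheme \<Rightarrow> ('k, ('k, 'a) univ, 't) module_scheme \<Rightarrow>
   ('k, 'a) univ \<Rightarrow> ('k, 'a) univ \<Rightarrow> ('k, 'a) univ"
  where "pure K V W v w = tensor_class K V W [(v, w)]"

text \<open>\<open>lin_ext M f\<close> is the linear map \<open>v \<otimes> w \<mapsto> f v w\<close> into \<open>M\<close> induced by a bilinear \<open>f\<close>.\<close>

definition lin_ext ::
  "('k, 'm, 's) module_scheme \<Rightarrow> (('k, 'a) univ \<Rightarrow> ('k, 'a) univ \<Rightarrow> 'm) \<Rightarrow> ('k, 'a) univ \<Rightarrow> 'm"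
  where "lin_ext M f x = foldr (\<lambda>(v, w) s. f v w \<oplus>\<^bsub>M\<^esub> s) (summands x) \<zero>\<^bsub>M\<^esub>"

text \<open>\<open>tensor_map K V W f g\<close> is \<open>f \<otimes> g\<close> with codomain \<open>V \<otimes> W\<close>.\<close>

definition tensor_map ::
  "('k, 'r) ring_scheme \<Rightarrow> ('k, ('k, 'a) univ, 's) module_scheme \<Rightarrow> ('k, ('k, 'a) univ, 't) module_scheme \<Rightarrow>
   (('k, 'a) univ \<Rightarrow> ('k, 'a) univ) \<Rightarrow> (('k, 'a) univ \<Rightarrow> ('k, 'a) univ) \<Rightarrow> ('k, 'a) univ \<Rightarrow> ('k, 'a) univ"
  where "tensor_map K V W f g = lin_ext (tensor K V W) (\<lambda>v w. pure K V W (f v) (g w))"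

text \<open>\<open>tensor_assoc K U V W\<close> is the canonical map \<open>(U \<otimes> V) \<otimes> W \<rightarrow> U \<otimes> (V \<otimes> W)\<close>.\<close>

definition tensor_assoc ::
  "('k, 'r) ring_scheme \<Rightarrow> ('k, ('k, 'a) univ, 's) module_scheme \<Rightarrow> ('k, ('k, 'a) univ, 't) module_scheme \<Rightarrow>
   ('k, ('k, 'a) univ, 'u) module_scheme \<Rightarrow> ('k, 'a) univ \<Rightarrow> ('k, 'a) univ"
  where
  "tensor_assoc K U V W =
     (let T = tensor K U (tensor K V W)
      in lin_ext T (\<lambda>t w. lin_ext T (\<lambda>u v. pure K U (tensor K V W) u (pure K V W v w)) t))"

definition tensor_algebra ::
  "('k, 'r) ring_scheme \<Rightarrow> ('k, ('k, 'a) univ, 's) module_scheme \<Rightarrow> ('k, ('k, 'a) univ, 't) module_scheme \<Rightarrow>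
   ('k, ('k, 'a) univ) module"
  where
  "tensor_algebra K A B =
     (tensor K A B)
       \<lparr>mult := (\<lambda>x y. lin_ext (tensor K A B)
          (\<lambda>a b. lin_ext (tensor K A B)
             (\<lambda>a' b'. pure K A B (a \<otimes>\<^bsub>A\<^esub> a') (b \<otimes>\<^bsub>B\<^esub> b')) y) x),
        one := pure K A B \<one>\<^bsub>A\<^esub> \<one>\<^bsub>B\<^esub>\<rparr>"


section \<open>Cogroupoids\<close>

text \<open>\<open>Alg C X Y\<close> is \<open>C(X,Y)\<close>, \<open>Delta C X Y Z\<close> is \<open>\<Delta>\<close> with lower indices \<open>X, Y\<close> and upper index
  \<open>Z\<close>, and \<open>Antip C X Y\<close> is \<open>S\<close> with indices \<open>X, Y\<close>.\<close>

record ('k, 'o, 'a) cogroupoid_data =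
  Obs :: "'o set"
  Alg :: "'o \<Rightarrow> 'o \<Rightarrow> ('k, ('k, 'a) univ) module"
  Delta :: "'o \<Rightarrow> 'o \<Rightarrow> 'o \<Rightarrow> ('k, 'a) univ \<Rightarrow> ('k, 'a) univ"
  Counit :: "'o \<Rightarrow> ('k, 'a) univ \<Rightarrow> 'k"
  Antip :: "'o \<Rightarrow> 'o \<Rightarrow> ('k, 'a) univ \<Rightarrow> ('k, 'a) univ"

locale cocategory = field K
  for K :: "('k, 'r) ring_scheme" (structure) +
  fixes C :: "('k, 'o, 'a, 's) cogroupoid_data_scheme"
  assumes Alg: "X \<in> Obs C \<Longrightarrow> Y \<in> Obs C \<Longrightarrow> assoc_algebra K (Alg C X Y)"
    and Delta: "X \<in> Obs C \<Longrightarrow> Y \<in> Obs C \<Longrightarrow> Z \<in> Obs C \<Longrightarrow>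
      algebra_hom K (Alg C X Y) (tensor_algebra K (Alg C X Z) (Alg C Z Y)) (Delta C X Y Z)"
    and Counit: "X \<in> Obs C \<Longrightarrow> algebra_hom K (Alg C X X) (ground_algebra K) (Counit C X)"
    and coassoc: "X \<in> Obs C \<Longrightarrow> Y \<in> Obs C \<Longrightarrow> Z \<in> Obs C \<Longrightarrow> T \<in> Obs C \<Longrightarrow>
      a \<in> carrier (Alg C X Y) \<Longrightarrow>
      tensor_assoc K (Alg C X T) (Alg C T Z) (Alg C Z Y)
        (tensor_map K (tensor K (Alg C X T) (Alg C T Z)) (Alg C Z Y) (Delta C X Z T) (\<lambda>b. b)
          (Delta C X Y Z a)) =
      tensor_map K (Alg C X T) (tensor K (Alg C T Z) (Alg C Z Y)) (\<lambda>b. b) (Delta C T Y Z)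
        (Delta C X Y T a)"
    and counit_right: "X \<in> Obs C \<Longrightarrow> Y \<in> Obs C \<Longrightarrow> a \<in> carrier (Alg C X Y) \<Longrightarrow>
      lin_ext (Alg C X Y) (\<lambda>b c. Counit C Y c \<odot>\<^bsub>Alg C X Y\<^esub> b) (Delta C X Y Y a) = a"
    and counit_left: "X \<in> Obs C \<Longrightarrow> Y \<in> Obs C \<Longrightarrow> a \<in> carrier (Alg C X Y) \<Longrightarrow>
      lin_ext (Alg C X Y) (\<lambda>b c. Counit C X b \<odot>\<^bsub>Alg C X Y\<^esub> c) (Delta C X Y X a) = a"

locale cogroupoid = cocategory +
  assumes Antip: "X \<in> Obs C \<Longrightarrow> Y \<in> Obs C \<Longrightarrow>
      linear_map K (Alg C X Y) (Alg C Y X) (Antip C X Y)"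
    and antip_right: "X \<in> Obs C \<Longrightarrow> Y \<in> Obs C \<Longrightarrow> a \<in> carrier (Alg C X X) \<Longrightarrow>
      lin_ext (Alg C X Y) (\<lambda>b c. b \<otimes>\<^bsub>Alg C X Y\<^esub> Antip C Y X c) (Delta C X X Y a) =
      Counit C X a \<odot>\<^bsub>Alg C X Y\<^esub> \<one>\<^bsub>Alg C X Y\<^esub>"
    and antip_left: "X \<in> Obs C \<Longrightarrow> Y \<in> Obs C \<Longrightarrow> a \<in> carrier (Alg C X X) \<Longrightarrow>
      lin_ext (Alg C Y X) (\<lambda>b c. Antip C X Y b \<otimes>\<^bsub>Alg C Y X\<^esub> c) (Delta C X X Y a) =
      Counit C X a \<odot>\<^bsub>Alg C Y X\<^esub> \<one>\<^bsub>Alg C Y X\<^esub>"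

locale connected_cogroupoid = cogroupoid +
  assumes connected: "X \<in> Obs C \<Longrightarrow> Y \<in> Obs C \<Longrightarrow> carrier (Alg C X Y) \<noteq> {\<zero>\<^bsub>Alg C X Y\<^esub>}"


section \<open>Linear monoidal categories, functors and equivalences\<close>

text \<open>\<open>Hom C X Y\<close> is the vector space of morphisms; \<open>Comp C X Y Z g f\<close> is \<open>g \<circ> f\<close> for
  \<open>f : X \<rightarrow> Y\<close> and \<open>g : Y \<rightarrow> Z\<close>; \<open>TensM C X X' Y Y' f g\<close> is \<open>f \<otimes> g\<close> for \<open>f : X \<rightarrow> X'\<close> and
  \<open>g : Y \<rightarrow> Y'\<close>. Hom spaces of different pairs of objects need not be disjoint.\<close>

record ('k, 'o, 'm) linear_category_data =
  Ob :: "'o set"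
  Hom :: "'o \<Rightarrow> 'o \<Rightarrow> ('k, 'm) module"
  Ident :: "'o \<Rightarrow> 'm"
  Comp :: "'o \<Rightarrow> 'o \<Rightarrow> 'o \<Rightarrow> 'm \<Rightarrow> 'm \<Rightarrow> 'm"

record ('k, 'o, 'm) monoidal_category_data = "('k, 'o, 'm) linear_category_data" +
  TensO :: "'o \<Rightarrow> 'o \<Rightarrow> 'o"
  TensM :: "'o \<Rightarrow> 'o \<Rightarrow> 'o \<Rightarrow> 'o \<Rightarrow> 'm \<Rightarrow> 'm \<Rightarrow> 'm"
  UnitO :: "'o"
  AssocM :: "'o \<Rightarrow> 'o \<Rightarrow> 'o \<Rightarrow> 'm"
  LUnitM :: "'o \<Rightarrow> 'm"
  RUnitM :: "'o \<Rightarrow> 'm"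

abbreviation arrows :: "('k, 'o, 'm, 's) linear_category_data_scheme \<Rightarrow> 'o \<Rightarrow> 'o \<Rightarrow> 'm set" where
  "arrows C X Y \<equiv> carrier (Hom C X Y)"

definition is_iso :: "('k, 'o, 'm, 's) linear_category_data_scheme \<Rightarrow> 'o \<Rightarrow> 'o \<Rightarrow> 'm \<Rightarrow> bool" where
  "is_iso C X Y f \<longleftrightarrow> f \<in> arrows C X Y \<and>
     (\<exists>g\<in>arrows C Y X. Comp C X Y X g f = Ident C X \<and> Comp C Y X Y f g = Ident C Y)"

locale linear_category =
  fixes K :: "('k, 'r) ring_scheme" and C :: "('k, 'o, 'm, 's) linear_category_data_scheme"
  assumes Hom: "X \<in> Ob C \<Longrightarrow> Y \<in> Ob C \<Longrightarrow> module K (Hom C X Y)"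
    and Ident: "X \<in> Ob C \<Longrightarrow> Ident C X \<in> arrows C X X"
    and Comp_linear_left: "X \<in> Ob C \<Longrightarrow> Y \<in> Ob C \<Longrightarrow> Z \<in> Ob C \<Longrightarrow> f \<in> arrows C X Y \<Longrightarrow>
      linear_map K (Hom C Y Z) (Hom C X Z) (\<lambda>g. Comp C X Y Z g f)"
    and Comp_linear_right: "X \<in> Ob C \<Longrightarrow> Y \<in> Ob C \<Longrightarrow> Z \<in> Ob C \<Longrightarrow> g \<in> arrows C Y Z \<Longrightarrow>
      linear_map K (Hom C X Y) (Hom C X Z) (\<lambda>f. Comp C X Y Z g f)"
    and Comp_Ident: "X \<in> Ob C \<Longrightarrow> Y \<in> Ob C \<Longrightarrow> f \<in> arrows C X Y \<Longrightarrow>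
      Comp C X X Y f (Ident C X) = f"
    and Ident_Comp: "X \<in> Ob C \<Longrightarrow> Y \<in> Ob C \<Longrightarrow> f \<in> arrows C X Y \<Longrightarrow>
      Comp C X Y Y (Ident C Y) f = f"
    and Comp_assoc: "W \<in> Ob C \<Longrightarrow> X \<in> Ob C \<Longrightarrow> Y \<in> Ob C \<Longrightarrow> Z \<in> Ob C \<Longrightarrow>
      f \<in> arrows C W X \<Longrightarrow> g \<in> arrows C X Y \<Longrightarrow> h \<in> arrows C Y Z \<Longrightarrow>
      Comp C W Y Z h (Comp C W X Y g f) = Comp C W X Z (Comp C X Y Z h g) f"

locale linear_monoidal_category = linear_category K C
  for K :: "('k, 'r) ring_scheme" and C :: "('k, 'o, 'm, 's) monoidal_category_data_scheme" +
  assumes UnitO: "UnitO C \<in> Ob C"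
    and TensO: "X \<in> Ob C \<Longrightarrow> Y \<in> Ob C \<Longrightarrow> TensO C X Y \<in> Ob C"
    and TensM_linear_left: "X \<in> Ob C \<Longrightarrow> X' \<in> Ob C \<Longrightarrow> Y \<in> Ob C \<Longrightarrow> Y' \<in> Ob C \<Longrightarrow>
      g \<in> arrows C Y Y' \<Longrightarrow>
      linear_map K (Hom C X X') (Hom C (TensO C X Y) (TensO C X' Y')) (\<lambda>f. TensM C X X' Y Y' f g)"
    and TensM_linear_right: "X \<in> Ob C \<Longrightarrow> X' \<in> Ob C \<Longrightarrow> Y \<in> Ob C \<Longrightarrow> Y' \<in> Ob C \<Longrightarrow>
      f \<in> arrows C X X' \<Longrightarrow>
      linear_map K (Hom C Y Y') (Hom C (TensO C X Y) (TensO C X' Y')) (\<lambda>g. TensM C X X' Y Y' f g)"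
    and TensM_Ident: "X \<in> Ob C \<Longrightarrow> Y \<in> Ob C \<Longrightarrow>
      TensM C X X Y Y (Ident C X) (Ident C Y) = Ident C (TensO C X Y)"
    and TensM_Comp: "X \<in> Ob C \<Longrightarrow> X' \<in> Ob C \<Longrightarrow> X'' \<in> Ob C \<Longrightarrow> Y \<in> Ob C \<Longrightarrow> Y' \<in> Ob C \<Longrightarrow> Y'' \<in> Ob C \<Longrightarrow>
      f \<in> arrows C X X' \<Longrightarrow> f' \<in> arrows C X' X'' \<Longrightarrow> g \<in> arrows C Y Y' \<Longrightarrow> g' \<in> arrows C Y' Y'' \<Longrightarrow>
      TensM C X X'' Y Y'' (Comp C X X' X'' f' f) (Comp C Y Y' Y'' g' g) =
      Comp C (TensO C X Y) (TensO C X' Y') (TensO C X'' Y'')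
        (TensM C X' X'' Y' Y'' f' g') (TensM C X X' Y Y' f g)"
    and AssocM_iso: "X \<in> Ob C \<Longrightarrow> Y \<in> Ob C \<Longrightarrow> Z \<in> Ob C \<Longrightarrow>
      is_iso C (TensO C (TensO C X Y) Z) (TensO C X (TensO C Y Z)) (AssocM C X Y Z)"
    and AssocM_natural: "X \<in> Ob C \<Longrightarrow> X' \<in> Ob C \<Longrightarrow> Y \<in> Ob C \<Longrightarrow> Y' \<in> Ob C \<Longrightarrow> Z \<in> Ob C \<Longrightarrow> Z' \<in> Ob C \<Longrightarrow>
      f \<in> arrows C X X' \<Longrightarrow> g \<in> arrows C Y Y' \<Longrightarrow> h \<in> arrows C Z Z' \<Longrightarrow>
      Comp C (TensO C (TensO C X Y) Z) (TensO C (TensO C X' Y') Z') (TensO C X' (TensO C Y' Z'))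
        (AssocM C X' Y' Z')
        (TensM C (TensO C X Y) (TensO C X' Y') Z Z' (TensM C X X' Y Y' f g) h) =
      Comp C (TensO C (TensO C X Y) Z) (TensO C X (TensO C Y Z)) (TensO C X' (TensO C Y' Z'))
        (TensM C X X' (TensO C Y Z) (TensO C Y' Z') f (TensM C Y Y' Z Z' g h))
        (AssocM C X Y Z)"
    and LUnitM_iso: "X \<in> Ob C \<Longrightarrow> is_iso C (TensO C (UnitO C) X) X (LUnitM C X)"
    and LUnitM_natural: "X \<in> Ob C \<Longrightarrow> X' \<in> Ob C \<Longrightarrow> f \<in> arrows C X X' \<Longrightarrow>
      Comp C (TensO C (UnitO C) X) (TensO C (UnitO C) X') X'
        (LUnitM C X') (TensM C (UnitO C) (UnitO C) X X' (Ident C (UnitO C)) f) =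
      Comp C (TensO C (UnitO C) X) X X' f (LUnitM C X)"
    and RUnitM_iso: "X \<in> Ob C \<Longrightarrow> is_iso C (TensO C X (UnitO C)) X (RUnitM C X)"
    and RUnitM_natural: "X \<in> Ob C \<Longrightarrow> X' \<in> Ob C \<Longrightarrow> f \<in> arrows C X X' \<Longrightarrow>
      Comp C (TensO C X (UnitO C)) (TensO C X' (UnitO C)) X'
        (RUnitM C X') (TensM C X X' (UnitO C) (UnitO C) f (Ident C (UnitO C))) =
      Comp C (TensO C X (UnitO C)) X X' f (RUnitM C X)"
    and pentagon: "W \<in> Ob C \<Longrightarrow> X \<in> Ob C \<Longrightarrow> Y \<in> Ob C \<Longrightarrow> Z \<in> Ob C \<Longrightarrow>
      Comp C (TensO C (TensO C (TensO C W X) Y) Z) (TensO C (TensO C W X) (TensO C Y Z))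
          (TensO C W (TensO C X (TensO C Y Z)))
        (AssocM C W X (TensO C Y Z)) (AssocM C (TensO C W X) Y Z) =
      Comp C (TensO C (TensO C (TensO C W X) Y) Z) (TensO C W (TensO C (TensO C X Y) Z))
          (TensO C W (TensO C X (TensO C Y Z)))
        (TensM C W W (TensO C (TensO C X Y) Z) (TensO C X (TensO C Y Z)) (Ident C W) (AssocM C X Y Z))
        (Comp C (TensO C (TensO C (TensO C W X) Y) Z) (TensO C (TensO C W (TensO C X Y)) Z)
            (TensO C W (TensO C (TensO C X Y) Z))
          (AssocM C W (TensO C X Y) Z)
          (TensM C (TensO C (TensO C W X) Y) (TensO C W (TensO C X Y)) Z Z (AssocM C W X Y) (Ident C Z)))"
    and triangle: "X \<in> Ob C \<Longrightarrow> Y \<in> Ob C \<Longrightarrow>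
      Comp C (TensO C (TensO C X (UnitO C)) Y) (TensO C X (TensO C (UnitO C) Y)) (TensO C X Y)
        (TensM C X X (TensO C (UnitO C) Y) Y (Ident C X) (LUnitM C Y)) (AssocM C X (UnitO C) Y) =
      TensM C (TensO C X (UnitO C)) X Y Y (RUnitM C X) (Ident C Y)"

text \<open>\<open>UnitF F : I \<rightarrow> F(I)\<close> and \<open>TensF F X Y : F(X) \<otimes> F(Y) \<rightarrow> F(X \<otimes> Y)\<close> are the structure maps
  of a (strong) monoidal functor \<open>F\<close>.\<close>

record ('o, 'm, 'p, 'n) monoidal_functor_data =
  MapO :: "'o \<Rightarrow> 'p"
  MapM :: "'o \<Rightarrow> 'o \<Rightarrow> 'm \<Rightarrow> 'n"
  UnitF :: "'n"
  TensF :: "'o \<Rightarrow> 'o \<Rightarrow> 'n"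

locale linear_monoidal_functor =
  source: linear_monoidal_category K C + target: linear_monoidal_category K D
  for K :: "('k, 'r) ring_scheme"
    and C :: "('k, 'o, 'm, 's) monoidal_category_data_scheme"
    and D :: "('k, 'p, 'n, 't) monoidal_category_data_scheme" +
  fixes F :: "('o, 'm, 'p, 'n, 'u) monoidal_functor_data_scheme"
  assumes MapO: "X \<in> Ob C \<Longrightarrow> MapO F X \<in> Ob D"
    and MapM_linear: "X \<in> Ob C \<Longrightarrow> Y \<in> Ob C \<Longrightarrow>
      linear_map K (Hom C X Y) (Hom D (MapO F X) (MapO F Y)) (MapM F X Y)"
    and MapM_Ident: "X \<in> Ob C \<Longrightarrow> MapM F X X (Ident C X) = Ident D (MapO F X)"
    and MapM_Comp: "X \<in> Ob C \<Longrightarrow> Y \<in> Ob C \<Longrightarrow> Z \<in> Ob C \<Longrightarrow> f \<in> arrows C X Y \<Longrightarrow> g \<in> arrows C Y Z \<Longrightarrow>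
      MapM F X Z (Comp C X Y Z g f) =
      Comp D (MapO F X) (MapO F Y) (MapO F Z) (MapM F Y Z g) (MapM F X Y f)"
    and UnitF_iso: "is_iso D (UnitO D) (MapO F (UnitO C)) (UnitF F)"
    and TensF_iso: "X \<in> Ob C \<Longrightarrow> Y \<in> Ob C \<Longrightarrow>
      is_iso D (TensO D (MapO F X) (MapO F Y)) (MapO F (TensO C X Y)) (TensF F X Y)"
    and TensF_natural: "X \<in> Ob C \<Longrightarrow> X' \<in> Ob C \<Longrightarrow> Y \<in> Ob C \<Longrightarrow> Y' \<in> Ob C \<Longrightarrow>
      f \<in> arrows C X X' \<Longrightarrow> g \<in> arrows C Y Y' \<Longrightarrow>
      Comp D (TensO D (MapO F X) (MapO F Y)) (TensO D (MapO F X') (MapO F Y')) (MapO F (TensO C X' Y'))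
        (TensF F X' Y')
        (TensM D (MapO F X) (MapO F X') (MapO F Y) (MapO F Y') (MapM F X X' f) (MapM F Y Y' g)) =
      Comp D (TensO D (MapO F X) (MapO F Y)) (MapO F (TensO C X Y)) (MapO F (TensO C X' Y'))
        (MapM F (TensO C X Y) (TensO C X' Y') (TensM C X X' Y Y' f g)) (TensF F X Y)"
    and TensF_assoc: "X \<in> Ob C \<Longrightarrow> Y \<in> Ob C \<Longrightarrow> Z \<in> Ob C \<Longrightarrow>
      Comp D (TensO D (TensO D (MapO F X) (MapO F Y)) (MapO F Z))
          (MapO F (TensO C (TensO C X Y) Z)) (MapO F (TensO C X (TensO C Y Z)))
        (MapM F (TensO C (TensO C X Y) Z) (TensO C X (TensO C Y Z)) (AssocM C X Y Z))
        (Comp D (TensO D (TensO D (MapO F X) (MapO F Y)) (MapO F Z))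
            (TensO D (MapO F (TensO C X Y)) (MapO F Z)) (MapO F (TensO C (TensO C X Y) Z))
          (TensF F (TensO C X Y) Z)
          (TensM D (TensO D (MapO F X) (MapO F Y)) (MapO F (TensO C X Y)) (MapO F Z) (MapO F Z)
            (TensF F X Y) (Ident D (MapO F Z)))) =
      Comp D (TensO D (TensO D (MapO F X) (MapO F Y)) (MapO F Z))
          (TensO D (MapO F X) (MapO F (TensO C Y Z))) (MapO F (TensO C X (TensO C Y Z)))
        (TensF F X (TensO C Y Z))
        (Comp D (TensO D (TensO D (MapO F X) (MapO F Y)) (MapO F Z))
            (TensO D (MapO F X) (TensO D (MapO F Y) (MapO F Z)))
            (TensO D (MapO F X) (MapO F (TensO C Y Z)))
          (TensM D (MapO F X) (MapO F X) (TensO D (MapO F Y) (MapO F Z)) (MapO F (TensO C Y Z))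
            (Ident D (MapO F X)) (TensF F Y Z))
          (AssocM D (MapO F X) (MapO F Y) (MapO F Z)))"
    and TensF_lunit: "X \<in> Ob C \<Longrightarrow>
      Comp D (TensO D (UnitO D) (MapO F X)) (MapO F (TensO C (UnitO C) X)) (MapO F X)
        (MapM F (TensO C (UnitO C) X) X (LUnitM C X))
        (Comp D (TensO D (UnitO D) (MapO F X)) (TensO D (MapO F (UnitO C)) (MapO F X))
            (MapO F (TensO C (UnitO C) X))
          (TensF F (UnitO C) X)
          (TensM D (UnitO D) (MapO F (UnitO C)) (MapO F X) (MapO F X) (UnitF F) (Ident D (MapO F X)))) =
      LUnitM D (MapO F X)"
    and TensF_runit: "X \<in> Ob C \<Longrightarrow>
      Comp D (TensO D (MapO F X) (UnitO D)) (MapO F (TensO C X (UnitO C))) (MapO F X)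
        (MapM F (TensO C X (UnitO C)) X (RUnitM C X))
        (Comp D (TensO D (MapO F X) (UnitO D)) (TensO D (MapO F X) (MapO F (UnitO C)))
            (MapO F (TensO C X (UnitO C)))
          (TensF F X (UnitO C))
          (TensM D (MapO F X) (MapO F X) (UnitO D) (MapO F (UnitO C)) (Ident D (MapO F X)) (UnitF F))) =
      RUnitM D (MapO F X)"

definition identity_functor ::
  "('k, 'o, 'm, 's) monoidal_category_data_scheme \<Rightarrow> ('o, 'm, 'o, 'm) monoidal_functor_data" where
  "identity_functor C =
     \<lparr>MapO = (\<lambda>X. X), MapM = (\<lambda>X Y f. f), UnitF = Ident C (UnitO C),
      TensF = (\<lambda>X Y. Ident C (TensO C X Y))\<rparr>"

text \<open>\<open>compose_functor C D E G F\<close> is \<open>G \<circ> F\<close> for \<open>F : C \<rightarrow> D\<close> and \<open>G : D \<rightarrow> E\<close>.\<close>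

definition compose_functor ::
  "('k, 'o, 'm, 's) monoidal_category_data_scheme \<Rightarrow> ('k, 'p, 'n, 't) monoidal_category_data_scheme \<Rightarrow>
   ('k, 'q, 'l, 'u) monoidal_category_data_scheme \<Rightarrow> ('p, 'n, 'q, 'l) monoidal_functor_data \<Rightarrow>
   ('o, 'm, 'p, 'n) monoidal_functor_data \<Rightarrow> ('o, 'm, 'q, 'l) monoidal_functor_data" where
  "compose_functor C D E G F =
     \<lparr>MapO = (\<lambda>X. MapO G (MapO F X)),
      MapM = (\<lambda>X Y f. MapM G (MapO F X) (MapO F Y) (MapM F X Y f)),
      UnitF = Comp E (UnitO E) (MapO G (UnitO D)) (MapO G (MapO F (UnitO C)))
        (MapM G (UnitO D) (MapO F (UnitO C)) (UnitF F)) (UnitF G),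
      TensF = (\<lambda>X Y. Comp E (TensO E (MapO G (MapO F X)) (MapO G (MapO F Y)))
          (MapO G (TensO D (MapO F X) (MapO F Y))) (MapO G (MapO F (TensO C X Y)))
        (MapM G (TensO D (MapO F X) (MapO F Y)) (MapO F (TensO C X Y)) (TensF F X Y))
        (TensF G (MapO F X) (MapO F Y)))\<rparr>"

definition monoidal_nat_iso ::
  "('k, 'o, 'm, 's) monoidal_category_data_scheme \<Rightarrow> ('k, 'p, 'n, 't) monoidal_category_data_scheme \<Rightarrow>
   ('o, 'm, 'p, 'n) monoidal_functor_data \<Rightarrow> ('o, 'm, 'p, 'n) monoidal_functor_data \<Rightarrow>
   ('o \<Rightarrow> 'n) \<Rightarrow> bool" where
  "monoidal_nat_iso C D F G \<eta> \<longleftrightarrow>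
     (\<forall>X\<in>Ob C. is_iso D (MapO F X) (MapO G X) (\<eta> X)) \<and>
     (\<forall>X\<in>Ob C. \<forall>Y\<in>Ob C. \<forall>f\<in>arrows C X Y.
        Comp D (MapO F X) (MapO F Y) (MapO G Y) (\<eta> Y) (MapM F X Y f) =
        Comp D (MapO F X) (MapO G X) (MapO G Y) (MapM G X Y f) (\<eta> X)) \<and>
     (\<forall>X\<in>Ob C. \<forall>Y\<in>Ob C.
        Comp D (TensO D (MapO F X) (MapO F Y)) (MapO F (TensO C X Y)) (MapO G (TensO C X Y))
          (\<eta> (TensO C X Y)) (TensF F X Y) =
        Comp D (TensO D (MapO F X) (MapO F Y)) (TensO D (MapO G X) (MapO G Y)) (MapO G (TensO C X Y))
          (TensF G X Y) (TensM D (MapO F X) (MapO G X) (MapO F Y) (MapO G Y) (\<eta> X) (\<eta> Y))) \<and>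
     Comp D (UnitO D) (MapO F (UnitO C)) (MapO G (UnitO C)) (\<eta> (UnitO C)) (UnitF F) = UnitF G"

text \<open>Two \<open>k\<close>-linear monoidal functors are inverse of each other, as equivalences of monoidal
  categories, if both composites are monoidally isomorphic to the identity functors.\<close>

definition inverse_monoidal_functors ::
  "('k, 'r) ring_scheme \<Rightarrow> ('k, 'o, 'm, 's) monoidal_category_data_scheme \<Rightarrow>
   ('k, 'p, 'n, 't) monoidal_category_data_scheme \<Rightarrow>
   ('o, 'm, 'p, 'n) monoidal_functor_data \<Rightarrow> ('p, 'n, 'o, 'm) monoidal_functor_data \<Rightarrow> bool" where
  "inverse_monoidal_functors K C D F G \<longleftrightarrow>
     linear_monoidal_functor K C D F \<and> linear_monoidal_functor K D C G \<and>
     (\<exists>\<eta>. monoidal_nat_iso C C (identity_functor C) (compose_functor C D C G F) \<eta>) \<and>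
     (\<exists>\<eta>. monoidal_nat_iso D D (identity_functor D) (compose_functor D C D F G) \<eta>)"

definition linear_monoidal_equivalence ::
  "('k, 'r) ring_scheme \<Rightarrow> ('k, 'o, 'm, 's) monoidal_category_data_scheme \<Rightarrow>
   ('k, 'p, 'n, 't) monoidal_category_data_scheme \<Rightarrow> ('o, 'm, 'p, 'n) monoidal_functor_data \<Rightarrow> bool" where
  "linear_monoidal_equivalence K C D F \<longleftrightarrow> (\<exists>G. inverse_monoidal_functors K C D F G)"


section \<open>Comodules over a bialgebra\<close>

record ('k, 'v) comodule_data = "('k, 'v) module" + coact :: "'v \<Rightarrow> 'v"

type_synonym ('k, 'a) comod = "('k, ('k, 'a) univ) comodule_data"

definition with_coact ::
  "('k, 'v) module \<Rightarrow> ('v \<Rightarrow> 'v) \<Rightarrow> ('k, 'v) comodule_data" where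
  "with_coact M \<alpha> =
     \<lparr>carrier = carrier M, mult = mult M, one = one M, zero = zero M, add = add M,
      smult = smult M, coact = \<alpha>\<rparr>"

text \<open>Below, the bialgebra consists of the algebra \<open>H\<close>, the comultiplication \<open>\<Delta>\<close> and the counit
  \<open>\<epsilon>\<close>.\<close>

definition right_comodule ::
  "('k, 'r) ring_scheme \<Rightarrow> ('k, ('k, 'a) univ) module \<Rightarrow> (('k, 'a) univ \<Rightarrow> ('k, 'a) univ) \<Rightarrow>
   (('k, 'a) univ \<Rightarrow> 'k) \<Rightarrow> ('k, 'a) comod \<Rightarrow> bool" where
  "right_comodule K H \<Delta> \<epsilon> V \<longleftrightarrow>
     module K V \<and> linear_map K V (tensor K V H) (coact V) \<and>
     (\<forall>v\<in>carrier V.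
        tensor_assoc K V H H (tensor_map K (tensor K V H) H (coact V) (\<lambda>h. h) (coact V v)) =
          tensor_map K V (tensor K H H) (\<lambda>u. u) \<Delta> (coact V v) \<and>
        lin_ext V (\<lambda>u h. \<epsilon> h \<odot>\<^bsub>V\<^esub> u) (coact V v) = v)"

text \<open>Colinear maps are taken to be extensional, so that equality of morphisms is equality on the
  carrier.\<close>

definition comodule_Hom ::
  "('k, 'r) ring_scheme \<Rightarrow> ('k, ('k, 'a) univ) module \<Rightarrow> ('k, 'a) comod \<Rightarrow> ('k, 'a) comod \<Rightarrow>
   ('k, ('k, 'a) univ \<Rightarrow> ('k, 'a) univ) module" where
  "comodule_Hom K H V W =
     \<lparr>carrier = {f \<in> carrier V \<rightarrow>\<^sub>E carrier W. linear_map K V W f \<and>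
        (\<forall>v\<in>carrier V. coact W (f v) = tensor_map K W H f (\<lambda>h. h) (coact V v))},
      mult = undefined, one = undefined,
      zero = (\<lambda>v\<in>carrier V. \<zero>\<^bsub>W\<^esub>),
      add = (\<lambda>f g. \<lambda>v\<in>carrier V. f v \<oplus>\<^bsub>W\<^esub> g v),
      smult = (\<lambda>a f. \<lambda>v\<in>carrier V. a \<odot>\<^bsub>W\<^esub> f v)\<rparr>"

text \<open>The codiagonal coaction \<open>v \<otimes> w \<mapsto> v\<^sub>0 \<otimes> w\<^sub>0 \<otimes> v\<^sub>1 w\<^sub>1\<close>.\<close>

definition comodule_tensor ::
  "('k, 'r) ring_scheme \<Rightarrow> ('k, ('k, 'a) univ) module \<Rightarrow> ('k, 'a) comod \<Rightarrow> ('k, 'a) comod \<Rightarrow>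
   ('k, 'a) comod" where
  "comodule_tensor K H V W =
     with_coact (tensor K V W)
       (let T = tensor K (tensor K V W) H
        in lin_ext T (\<lambda>v w.
             lin_ext T (\<lambda>v\<^sub>0 v\<^sub>1.
               lin_ext T (\<lambda>w\<^sub>0 w\<^sub>1. pure K (tensor K V W) H (pure K V W v\<^sub>0 w\<^sub>0) (v\<^sub>1 \<otimes>\<^bsub>H\<^esub> w\<^sub>1))
                 (coact W w))
               (coact V v)))"

definition unit_space :: "('k, 'r) ring_scheme \<Rightarrow> ('k, ('k, 'a) univ) module" where
  "unit_space K =
     \<lparr>carrier = Scal ` carrier K,
      mult = undefined, one = undefined,
      zero = Scal \<zero>\<^bsub>K\<^esub>,
      add = (\<lambda>x y. Scal (scal x \<oplus>\<^bsub>K\<^esub> scal y)),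
      smult = (\<lambda>a x. Scal (a \<otimes>\<^bsub>K\<^esub> scal x))\<rparr>"

definition unit_comodule ::
  "('k, 'r) ring_scheme \<Rightarrow> ('k, ('k, 'a) univ) module \<Rightarrow> ('k, 'a) comod" where
  "unit_comodule K H = with_coact (unit_space K)
     (\<lambda>x. pure K (unit_space K :: ('k, ('k, 'a) univ) module) H x \<one>\<^bsub>H\<^esub>)"

definition Comod ::
  "('k, 'r) ring_scheme \<Rightarrow> ('k, ('k, 'a) univ) module \<Rightarrow> (('k, 'a) univ \<Rightarrow> ('k, 'a) univ) \<Rightarrow>
   (('k, 'a) univ \<Rightarrow> 'k) \<Rightarrow>
   ('k, ('k, 'a) comod, ('k, 'a) univ \<Rightarrow> ('k, 'a) univ) monoidal_category_data" where
  "Comod K H \<Delta> \<epsilon> =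
     \<lparr>Ob = {V. right_comodule K H \<Delta> \<epsilon> V},
      Hom = comodule_Hom K H,
      Ident = (\<lambda>V. \<lambda>v\<in>carrier V. v),
      Comp = (\<lambda>U V W g f. compose (carrier U) g f),
      TensO = comodule_tensor K H,
      TensM = (\<lambda>V V' W W' f g. \<lambda>x\<in>carrier (tensor K V W). tensor_map K V' W' f g x),
      UnitO = unit_comodule K H,
      AssocM = (\<lambda>U V W. \<lambda>x\<in>carrier (tensor K (tensor K U V) W). tensor_assoc K U V W x),
      LUnitM = (\<lambda>V. \<lambda>x\<in>carrier (tensor K (unit_comodule K H) V).
        lin_ext V (\<lambda>c v. scal c \<odot>\<^bsub>V\<^esub> v) x),
      RUnitM = (\<lambda>V. \<lambda>x\<in>carrier (tensor K V (unit_comodule K H)).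
        lin_ext V (\<lambda>v c. scal c \<odot>\<^bsub>V\<^esub> v) x)\<rparr>"


section \<open>The cotensor product functors of a cogroupoid\<close>

text \<open>Cotensor product over \<open>H\<close> of a right comodule \<open>V\<close> and a left comodule \<open>A\<close> with coaction
  \<open>\<beta>\<close>, a subspace of \<open>V \<otimes> A\<close>.\<close>

definition cotensor ::
  "('k, 'r) ring_scheme \<Rightarrow> ('k, ('k, 'a) univ) module \<Rightarrow> ('k, 'a) comod \<Rightarrow>
   ('k, ('k, 'a) univ) module \<Rightarrow> (('k, 'a) univ \<Rightarrow> ('k, 'a) univ) \<Rightarrow> ('k, ('k, 'a) univ) module" where
  "cotensor K H V A \<beta> =
     (tensor K V A)
       \<lparr>carrier := {x \<in> carrier (tensor K V A).
          tensor_assoc K V H A (tensor_map K (tensor K V H) A (coact V) (\<lambda>a. a) x) =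
          tensor_map K V (tensor K H A) (\<lambda>v. v) \<beta> x}\<rparr>"

text \<open>The right coaction on \<open>V \<box> C(X,Y)\<close> is the restriction of \<open>1 \<otimes> \<Delta>\<close>: since a tensor product
  with a subspace \<open>U \<subseteq> V \<otimes> C(X,Y)\<close> is not literally a subset of the tensor product with
  \<open>V \<otimes> C(X,Y)\<close>, the value at \<open>x\<close> is the \<open>y \<in> U \<otimes> C(Y,Y)\<close> whose image under the map induced by
  the inclusion (which is injective over a field) is \<open>(1 \<otimes> \<Delta>) x\<close>.\<close>

definition cotensor_comodule ::
  "('k, 'r) ring_scheme \<Rightarrow> ('k, 'o, 'a) cogroupoid_data \<Rightarrow> 'o \<Rightarrow> 'o \<Rightarrow> ('k, 'a) comod \<Rightarrow> ('k, 'a) comod"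
  where
  "cotensor_comodule K C X Y V =
     (let A = Alg C X Y; H' = Alg C Y Y; U = cotensor K (Alg C X X) V A (Delta C X Y X)
      in with_coact U
           (\<lambda>x. THE y. y \<in> carrier (tensor K U H') \<and>
              tensor_assoc K V A H' (tensor_map K (tensor K V A) H' (\<lambda>u. u) (\<lambda>h. h) y) =
              tensor_map K V (tensor K A H') (\<lambda>v. v) (Delta C X Y Y) x))"

definition cotensor_functor ::
  "('k, 'r) ring_scheme \<Rightarrow> ('k, 'o, 'a) cogroupoid_data \<Rightarrow> 'o \<Rightarrow> 'o \<Rightarrow>
   (('k, 'a) comod, ('k, 'a) univ \<Rightarrow> ('k, 'a) univ,
    ('k, 'a) comod, ('k, 'a) univ \<Rightarrow> ('k, 'a) univ) monoidal_functor_data" where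
  "cotensor_functor K C X Y =
     \<lparr>MapO = cotensor_comodule K C X Y,
      MapM = (\<lambda>V W f. \<lambda>x\<in>carrier (cotensor_comodule K C X Y V).
        tensor_map K W (Alg C X Y) f (\<lambda>a. a) x),
      UnitF = (\<lambda>c\<in>carrier (unit_comodule K (Alg C Y Y)).
        pure K (unit_comodule K (Alg C X X)) (Alg C X Y) c \<one>\<^bsub>Alg C X Y\<^esub>),
      TensF = (\<lambda>V W.
        let T = tensor K (tensor K V W) (Alg C X Y)
        in (\<lambda>z\<in>carrier (tensor K (cotensor_comodule K C X Y V) (cotensor_comodule K C X Y W)).
             lin_ext T (\<lambda>x y.
               lin_ext T (\<lambda>v a.
                 lin_ext T (\<lambda>w b.
                   pure K (tensor K V W) (Alg C X Y) (pure K V W v w) (a \<otimes>\<^bsub>Alg C X Y\<^esub> b))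
                   y)
                 x)
               z))\<rparr>"

abbreviation Comod_at ::
  "('k, 'r) ring_scheme \<Rightarrow> ('k, 'o, 'a) cogroupoid_data \<Rightarrow> 'o \<Rightarrow>
   ('k, ('k, 'a) comod, ('k, 'a) univ \<Rightarrow> ('k, 'a) univ) monoidal_category_data" where
  "Comod_at K C X \<equiv> Comod K (Alg C X X) (Delta C X X X) (Counit C X)"

end

theory Submission
  imports Defs
begin

text \<open>Write \<open>F\<close> and \<open>G\<close> for the functors \<open>- \<box> C(X,Y)\<close> and \<open>- \<box> C(Y,X)\<close>, and let \<open>\<phi>\<close> be a linear functional
  on \<open>C(X,Y)\<close> with \<open>\<phi>(1) = 1\<close>. It exists because connectedness gives \<open>1 \<noteq> 0\<close> in \<open>C(X,Y)\<close>
  (\<open>functional_exists\<close>). Two constructions rest on it.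

  \<^item> \<open>v \<otimes> a \<mapsto> v\<^sub>0 \<otimes> v\<^sub>1 \<phi>(S(v\<^sub>2) a)\<close>, where \<open>v\<^sub>1 \<otimes> v\<^sub>2\<close> is \<open>\<Delta>\<close> of the second leg of \<open>v\<close> in
    \<open>C(X,Y) \<otimes> C(Y,X)\<close>, projects \<open>V \<otimes> C(X,Y)\<close> onto the cotensor product \<open>U = F V\<close>. Hence
    \<open>U \<otimes> N \<rightarrow> V \<otimes> C(X,Y) \<otimes> N\<close> is injective for all \<open>N\<close> (\<open>box_tensor_eqI\<close>), and its image contains
    every element that is balanced over \<open>C(X,X)\<close> (\<open>tsum_box_lift\<close>). This gives the coaction on \<open>U\<close>,
    and it reduces every equation in \<open>U \<otimes> N\<close> to an equation in \<open>V \<otimes> C(X,Y) \<otimes> N\<close>.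

  \<^item> \<open>\<eta>\<^sub>V(v) = v\<^sub>0 \<otimes> v\<^sub>1 \<otimes> v\<^sub>2\<close> defines a natural map \<open>V \<rightarrow> G (F V)\<close>, and \<open>v \<otimes> a \<otimes> b \<mapsto> \<phi>(a S(b)) v\<close> is
    its inverse: one composite is the antipode axiom, the other moves \<open>\<phi>\<close> past both balancing
    conditions of \<open>G (F V)\<close> until the antipode axiom applies (\<open>cotensor_unit_counit\<close>).

  That \<open>\<eta>\<close> respects the monoidal structure says only that \<open>\<Delta>\<close> is multiplicative and unital. The
  structure maps \<open>F V \<otimes> F W \<rightarrow> F (V \<otimes> W)\<close> and \<open>k \<rightarrow> F k\<close> are coherent by direct calculation. Their
  invertibility is formal: if two functors carry natural structure maps and are quasi-inverse by
  monoidal transformations, then each structure map is a split monomorphism whose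
  image under the other, faithful, functor is a split epimorphism (\<open>structure_maps_iso\<close>).

  The calculations are done in Sweedler's notation: \<open>tsum V W M f x\<close> is the sum of \<open>f v w\<close> over
  the terms \<open>v \<otimes> w\<close> of \<open>x\<close>. Rewriting brings iterated sums of multilinear expressions into a
  normal form, so that most identities between maps of tensor products, coherence conditions
  included, are checked by the simplifier. For this purpose linearity is stated for composites
  \<open>\<lambda>u. f (g u)\<close>, and an axiom such as coassociativity, which rewrites two nested sums, also has a
  primed variant for an unrelated sum in between, and a variant for an intermediate sum over
  terms that depend on the outer one.\<close>

section \<open>Linear maps\<close>

lemma (in module) module_rules:
  shows "\<zero>\<^bsub>M\<^esub> \<in> carrier M"
    and "x \<in> carrier M \<Longrightarrow> y \<in> carrier M \<Longrightarrow> x \<oplus>\<^bsub>M\<^esub> y \<in> carrier M"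
    and "a \<in> carrier R \<Longrightarrow> x \<in> carrier M \<Longrightarrow> a \<odot>\<^bsub>M\<^esub> x \<in> carrier M"
    and "x \<in> carrier M \<Longrightarrow> \<zero>\<^bsub>M\<^esub> \<oplus>\<^bsub>M\<^esub> x = x"
    and "x \<in> carrier M \<Longrightarrow> x \<oplus>\<^bsub>M\<^esub> \<zero>\<^bsub>M\<^esub> = x"
    and "x \<in> carrier M \<Longrightarrow> \<one> \<odot>\<^bsub>M\<^esub> x = x"
    and "x \<in> carrier M \<Longrightarrow> \<zero> \<odot>\<^bsub>M\<^esub> x = \<zero>\<^bsub>M\<^esub>"
    and "a \<in> carrier R \<Longrightarrow> a \<odot>\<^bsub>M\<^esub> \<zero>\<^bsub>M\<^esub> = \<zero>\<^bsub>M\<^esub>"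
  by simp_all

lemma (in module) module_add_ac:
  shows "x \<in> carrier M \<Longrightarrow> y \<in> carrier M \<Longrightarrow> z \<in> carrier M \<Longrightarrow> (x \<oplus>\<^bsub>M\<^esub> y) \<oplus>\<^bsub>M\<^esub> z = x \<oplus>\<^bsub>M\<^esub> (y \<oplus>\<^bsub>M\<^esub> z)"
    and "x \<in> carrier M \<Longrightarrow> y \<in> carrier M \<Longrightarrow> x \<oplus>\<^bsub>M\<^esub> y = y \<oplus>\<^bsub>M\<^esub> x"
    and "x \<in> carrier M \<Longrightarrow> y \<in> carrier M \<Longrightarrow> z \<in> carrier M \<Longrightarrow> x \<oplus>\<^bsub>M\<^esub> (y \<oplus>\<^bsub>M\<^esub> z) = y \<oplus>\<^bsub>M\<^esub> (x \<oplus>\<^bsub>M\<^esub> z)"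
  by (simp_all add: M.a_ac)

lemma (in module) module_smult:
  shows "a \<in> carrier R \<Longrightarrow> b \<in> carrier R \<Longrightarrow> x \<in> carrier M \<Longrightarrow> (a \<oplus> b) \<odot>\<^bsub>M\<^esub> x = a \<odot>\<^bsub>M\<^esub> x \<oplus>\<^bsub>M\<^esub> b \<odot>\<^bsub>M\<^esub> x"
    and "a \<in> carrier R \<Longrightarrow> x \<in> carrier M \<Longrightarrow> y \<in> carrier M \<Longrightarrow> a \<odot>\<^bsub>M\<^esub> (x \<oplus>\<^bsub>M\<^esub> y) = a \<odot>\<^bsub>M\<^esub> x \<oplus>\<^bsub>M\<^esub> a \<odot>\<^bsub>M\<^esub> y"
    and "a \<in> carrier R \<Longrightarrow> b \<in> carrier R \<Longrightarrow> x \<in> carrier M \<Longrightarrow> a \<odot>\<^bsub>M\<^esub> (b \<odot>\<^bsub>M\<^esub> x) = (a \<otimes> b) \<odot>\<^bsub>M\<^esub> x"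
  by (simp_all add: smult_l_distr smult_r_distr smult_assoc1)

locale base_field = field K for K :: "('k, 'r) ring_scheme" (structure)
begin

lemmas module_rules [simp] = module.module_rules[of K]
lemmas module_add_ac = module.module_add_ac[of K]
lemmas module_smult = module.module_smult[of K]

text \<open>Additive inverses need not be checked separately: \<open>- x\<close> is \<open>(- 1) x\<close>.\<close>

lemma moduleI':
  assumes "\<zero>\<^bsub>V\<^esub> \<in> carrier V"
    and "\<And>x y. x \<in> carrier V \<Longrightarrow> y \<in> carrier V \<Longrightarrow> x \<oplus>\<^bsub>V\<^esub> y \<in> carrier V"
    and "\<And>a x. a \<in> carrier K \<Longrightarrow> x \<in> carrier V \<Longrightarrow> a \<odot>\<^bsub>V\<^esub> x \<in> carrier V"
    and "\<And>x y z. x \<in> carrier V \<Longrightarrow> y \<in> carrier V \<Longrightarrow> z \<in> carrier V \<Longrightarrow> (x \<oplus>\<^bsub>V\<^esub> y) \<oplus>\<^bsub>V\<^esub> z = x \<oplus>\<^bsub>V\<^esub> (y \<oplus>\<^bsub>V\<^esub> z)"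
    and "\<And>x y. x \<in> carrier V \<Longrightarrow> y \<in> carrier V \<Longrightarrow> x \<oplus>\<^bsub>V\<^esub> y = y \<oplus>\<^bsub>V\<^esub> x"
    and "\<And>x. x \<in> carrier V \<Longrightarrow> \<zero>\<^bsub>V\<^esub> \<oplus>\<^bsub>V\<^esub> x = x"
    and "\<And>x. x \<in> carrier V \<Longrightarrow> \<one> \<odot>\<^bsub>V\<^esub> x = x"
    and zero: "\<And>x. x \<in> carrier V \<Longrightarrow> \<zero> \<odot>\<^bsub>V\<^esub> x = \<zero>\<^bsub>V\<^esub>"
    and "\<And>a b x. a \<in> carrier K \<Longrightarrow> b \<in> carrier K \<Longrightarrow> x \<in> carrier V \<Longrightarrow> (a \<oplus> b) \<odot>\<^bsub>V\<^esub> x = a \<odot>\<^bsub>V\<^esub> x \<oplus>\<^bsub>V\<^esub> b \<odot>\<^bsub>V\<^esub> x"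
    and "\<And>a x y. a \<in> carrier K \<Longrightarrow> x \<in> carrier V \<Longrightarrow> y \<in> carrier V \<Longrightarrow> a \<odot>\<^bsub>V\<^esub> (x \<oplus>\<^bsub>V\<^esub> y) = a \<odot>\<^bsub>V\<^esub> x \<oplus>\<^bsub>V\<^esub> a \<odot>\<^bsub>V\<^esub> y"
    and "\<And>a b x. a \<in> carrier K \<Longrightarrow> b \<in> carrier K \<Longrightarrow> x \<in> carrier V \<Longrightarrow> a \<odot>\<^bsub>V\<^esub> (b \<odot>\<^bsub>V\<^esub> x) = (a \<otimes> b) \<odot>\<^bsub>V\<^esub> x"
  shows "module K V"
proof (rule moduleI)
  have inv: "\<exists>y\<in>carrier V. y \<oplus>\<^bsub>V\<^esub> x = \<zero>\<^bsub>V\<^esub>" if "x \<in> carrier V" for x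
  proof
    have "(\<ominus> \<one>) \<odot>\<^bsub>V\<^esub> x \<oplus>\<^bsub>V\<^esub> x = (\<ominus> \<one>) \<odot>\<^bsub>V\<^esub> x \<oplus>\<^bsub>V\<^esub> \<one> \<odot>\<^bsub>V\<^esub> x"
      using assms that by simp
    also have "\<dots> = (\<ominus> \<one> \<oplus> \<one>) \<odot>\<^bsub>V\<^esub> x"
      using assms(9) that by simp
    finally show "(\<ominus> \<one>) \<odot>\<^bsub>V\<^esub> x \<oplus>\<^bsub>V\<^esub> x = \<zero>\<^bsub>V\<^esub>" using zero that by (simp add: l_neg)
  qed (use assms that in simp)
  show "abelian_group V"
    by (rule abelian_groupI) (use assms inv in auto)
qed (use assms is_cring in auto)

lemma linear_mapI:
  assumes "\<And>x. x \<in> carrier V \<Longrightarrow> f x \<in> carrier W"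
    and "\<And>x y. x \<in> carrier V \<Longrightarrow> y \<in> carrier V \<Longrightarrow> f (x \<oplus>\<^bsub>V\<^esub> y) = f x \<oplus>\<^bsub>W\<^esub> f y"
    and "\<And>a x. a \<in> carrier K \<Longrightarrow> x \<in> carrier V \<Longrightarrow> f (a \<odot>\<^bsub>V\<^esub> x) = a \<odot>\<^bsub>W\<^esub> f x"
  shows "linear_map K V W f"
  using assms by (auto simp: linear_map_def)

lemma linear_map_closed: "linear_map K V W f \<Longrightarrow> x \<in> carrier V \<Longrightarrow> f x \<in> carrier W"
  by (auto simp: linear_map_def)

lemma linear_map_add:
  "linear_map K V W f \<Longrightarrow> x \<in> carrier V \<Longrightarrow> y \<in> carrier V \<Longrightarrow> f (x \<oplus>\<^bsub>V\<^esub> y) = f x \<oplus>\<^bsub>W\<^esub> f y"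
  by (auto simp: linear_map_def)

lemma linear_map_smult:
  "linear_map K V W f \<Longrightarrow> a \<in> carrier K \<Longrightarrow> x \<in> carrier V \<Longrightarrow> f (a \<odot>\<^bsub>V\<^esub> x) = a \<odot>\<^bsub>W\<^esub> f x"
  by (auto simp: linear_map_def)

lemma linear_map_zero:
  assumes "linear_map K V W f" "module K V" "module K W"
  shows "f \<zero>\<^bsub>V\<^esub> = \<zero>\<^bsub>W\<^esub>"
  using linear_map_smult[OF assms(1), of \<zero> "\<zero>\<^bsub>V\<^esub>"] assms linear_map_closed[OF assms(1), of "\<zero>\<^bsub>V\<^esub>"]
  by simp

lemma linear_map_cong':
  assumes "module K V" "\<And>v. v \<in> carrier V \<Longrightarrow> f v = g v"
  shows "linear_map K V W f = linear_map K V W g"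
  using assms by (auto simp: linear_map_def Pi_def)

lemma linear_map_id [simp]: "linear_map K V V (\<lambda>v. v)"
  by (auto simp: linear_map_def)

lemma linear_map_compose:
  "linear_map K V W f \<Longrightarrow> linear_map K U V g \<Longrightarrow> linear_map K U W (\<lambda>u. f (g u))"
  by (auto simp: linear_map_def Pi_def)

definition bilinear_map ::
  "('k, 'v, 's) module_scheme \<Rightarrow> ('k, 'w, 't) module_scheme \<Rightarrow> ('k, 'm, 'u) module_scheme \<Rightarrow> ('v \<Rightarrow> 'w \<Rightarrow> 'm) \<Rightarrow> bool"
  where "bilinear_map V W M f \<longleftrightarrow>
    (\<forall>v\<in>carrier V. linear_map K W M (\<lambda>w. f v w)) \<and> (\<forall>w\<in>carrier W. linear_map K V M (\<lambda>v. f v w))"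

declare bilinear_map_def [simp]

section \<open>Tensor products\<close>

lemma tensor_eq_lists:
  assumes "tensor_eq K V W l l'" "module K V" "module K W"
  shows "l \<in> lists (carrier V \<times> carrier W)" "l' \<in> lists (carrier V \<times> carrier W)"
  using assms(1) by (induction rule: tensor_eq.induct) (use assms(2,3) in auto)

lemma lin_ext_Nil [simp]: "lin_ext M f (Tens []) = \<zero>\<^bsub>M\<^esub>"
  and lin_ext_Cons [simp]: "lin_ext M f (Tens (p # l)) = f (fst p) (snd p) \<oplus>\<^bsub>M\<^esub> lin_ext M f (Tens l)"
  by (simp_all add: lin_ext_def split: prod.split)

lemma lin_ext_Tens_closed:
  assumes "module K M" "\<And>v w. v \<in> carrier V \<Longrightarrow> w \<in> carrier W \<Longrightarrow> f v w \<in> carrier M"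
    "l \<in> lists (carrier V \<times> carrier W)"
  shows "lin_ext M f (Tens l) \<in> carrier M"
  using assms(3) by (induction l) (use assms(1,2) in auto)

lemma lin_ext_append:
  assumes "module K M" "\<And>v w. v \<in> carrier V \<Longrightarrow> w \<in> carrier W \<Longrightarrow> f v w \<in> carrier M"
    "l \<in> lists (carrier V \<times> carrier W)" "l' \<in> lists (carrier V \<times> carrier W)"
  shows "lin_ext M f (Tens (l @ l')) = lin_ext M f (Tens l) \<oplus>\<^bsub>M\<^esub> lin_ext M f (Tens l')"
  using assms(3)
proof (induction l)
  case Nil
  then show ?case using lin_ext_Tens_closed[of M V W f, OF assms(1,2,4)] assms(1) by simp
next
  case (Cons p l)
  then show ?case
    using assms lin_ext_Tens_closed[of M V W f l] lin_ext_Tens_closed[of M V W f l']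
    by (auto simp: module_add_ac)
qed

text \<open>The defining relations of the tensor product are exactly those that a bilinear \<open>f\<close> respects.\<close>

lemma lin_ext_tensor_eq:
  assumes "tensor_eq K V W l l'" "module K V" "module K W" "module K M" "bilinear_map V W M f"
  shows "lin_ext M f (Tens l) = lin_ext M f (Tens l')"
  using assms(1)
proof (induction rule: tensor_eq.induct)
  have cl: "\<And>v w. v \<in> carrier V \<Longrightarrow> w \<in> carrier W \<Longrightarrow> f v w \<in> carrier M"
    using assms(5) by (auto dest: linear_map_closed)
  have app: "lin_ext M f (Tens (l @ l')) = lin_ext M f (Tens l) \<oplus>\<^bsub>M\<^esub> lin_ext M f (Tens l')"
    if "l \<in> lists (carrier V \<times> carrier W)" "l' \<in> lists (carrier V \<times> carrier W)" for l l'
    using lin_ext_append[of M V W f, OF assms(4) cl] that by blast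
  {
    case (append l1 l1' l2 l2')
    have "l1 \<in> lists (carrier V \<times> carrier W)" "l1' \<in> lists (carrier V \<times> carrier W)"
      "l2 \<in> lists (carrier V \<times> carrier W)" "l2' \<in> lists (carrier V \<times> carrier W)"
      using append.hyps assms(2,3) tensor_eq_lists by blast+
    then show ?case using append.IH by (simp only: app)
  next
    case (commute l1 l2)
    then show ?case using lin_ext_Tens_closed[of M V W f, OF assms(4) cl, of l1] lin_ext_Tens_closed[of M V W f, OF assms(4) cl, of l2]
      by (simp add: app module_add_ac(2)[OF assms(4)])
  next
    case (zero w)
    then show ?case using assms linear_map_zero[of V M "\<lambda>v. f v w"] by simp
  next
    case (add_left v v' w)
    then show ?case using assms linear_map_add[of V M "\<lambda>v. f v w"] cl by (simp add: module_add_ac)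
  next
    case (add_right v w w')
    then show ?case using assms linear_map_add[of W M "\<lambda>w. f v w"] cl by (simp add: module_add_ac)
  next
    case (smult a v w)
    then show ?case using assms linear_map_smult[of V M "\<lambda>v. f v w"] linear_map_smult[of W M "\<lambda>w. f v w"] cl
      by simp
  }
qed auto

lemma tensor_class_eq:
  assumes "tensor_eq K V W l l'"
  shows "tensor_class K V W l = tensor_class K V W l'"
proof -
  have "tensor_eq K V W l = tensor_eq K V W l'"
    using assms by (blast intro: tensor_eq.sym tensor_eq.trans)
  then show ?thesis by (simp add: tensor_class_def)
qed

lemma tensor_eq_summands:
  assumes "l \<in> lists (carrier V \<times> carrier W)"
  shows "tensor_eq K V W l (summands (tensor_class K V W l))"
  unfolding tensor_class_def univ.sel by (rule someI) (rule tensor_eq.refl[OF assms])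

lemma tensor_eq_smult:
  assumes "tensor_eq K V W l l'" "a \<in> carrier K" "module K V" "module K W"
  shows "tensor_eq K V W (map (\<lambda>(v, w). (a \<odot>\<^bsub>V\<^esub> v, w)) l) (map (\<lambda>(v, w). (a \<odot>\<^bsub>V\<^esub> v, w)) l')"
  using assms(1)
proof (induction rule: tensor_eq.induct)
  case (refl l)
  then have "map (\<lambda>(v, w). (a \<odot>\<^bsub>V\<^esub> v, w)) l \<in> lists (carrier V \<times> carrier W)"
    by (induction l) (use assms in auto)
  then show ?case by (rule tensor_eq.refl)
next
  case (sym l l')
  show ?case by (rule tensor_eq.sym[OF sym.IH])
next
  case (trans l l' l'')
  then show ?case by (blast intro: tensor_eq.trans)
next
  case (commute l1 l2)
  have "map (\<lambda>(v, w). (a \<odot>\<^bsub>V\<^esub> v, w)) l \<in> lists (carrier V \<times> carrier W)"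
    if "l \<in> lists (carrier V \<times> carrier W)" for l using that
    by (induction l) (use assms in auto)
  then show ?case using commute by (auto intro: tensor_eq.commute)
next
  case (smult b v w)
  then have "a \<odot>\<^bsub>V\<^esub> (b \<odot>\<^bsub>V\<^esub> v) = b \<odot>\<^bsub>V\<^esub> (a \<odot>\<^bsub>V\<^esub> v)"
    using assms by (simp add: module_smult m_comm)
  then show ?case using assms smult tensor_eq.smult[of b K "a \<odot>\<^bsub>V\<^esub> v" V w W] by simp
qed (use assms in \<open>simp_all add: tensor_eq.append tensor_eq.zero tensor_eq.add_left tensor_eq.add_right module_smult\<close>)

context
  fixes V :: "('k, ('k, 'a) univ, 's) module_scheme" and W :: "('k, ('k, 'a) univ, 't) module_scheme"
  assumes V: "module K V" and W: "module K W"
begin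

abbreviation (input) "scale a \<equiv> map (\<lambda>(v, w). (a \<odot>\<^bsub>V\<^esub> v, w))"
abbreviation (input) "sums \<equiv> lists (carrier V \<times> carrier W)"

text \<open>Each relation changes single terms only. The next three lemmas extend to whole formal sums
  what the module axioms \<open>0 x = 0\<close> and \<open>(a + b) x = a x + b x\<close> require.\<close>

lemma tensor_eq_zero_coefficients: "l \<in> sums \<Longrightarrow> tensor_eq K V W (scale \<zero> l) []"
proof (induction l)
  case (Cons p l)
  then show ?case
    using tensor_eq.append[OF tensor_eq.zero[of "snd p" W K V] Cons.IH] V by auto
qed (simp add: tensor_eq.refl)

lemma tensor_eq_move_second:
  assumes "x \<in> carrier V \<times> carrier W" "y \<in> carrier V \<times> carrier W" "l \<in> sums" "l' \<in> sums"
  shows "tensor_eq K V W (x # l @ y # l') (x # y # l @ l')"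
proof -
  have "tensor_eq K V W (l @ [y]) ([y] @ l)"
    by (rule tensor_eq.commute) (use assms in auto)
  then have "tensor_eq K V W ((l @ [y]) @ l') (([y] @ l) @ l')"
    by (rule tensor_eq.append[OF _ tensor_eq.refl]) (use assms in auto)
  from tensor_eq.append[OF tensor_eq.refl this, of "[x]"] assms show ?thesis by simp
qed

lemma tensor_eq_add_coefficients:
  assumes "l \<in> sums" "a \<in> carrier K" "b \<in> carrier K"
  shows "tensor_eq K V W (scale (a \<oplus> b) l) (scale a l @ scale b l)"
  using assms(1)
proof (induction l)
  case (Cons p l)
  obtain v w where p: "p = (v, w)" by (cases p)
  have vw: "v \<in> carrier V" "w \<in> carrier W" "l \<in> sums" using Cons p by auto
  have sc: "scale c l \<in> sums" if "c \<in> carrier K" for c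
    using vw(3) by (induction l) (use V that in auto)
  have "tensor_eq K V W ([((a \<oplus> b) \<odot>\<^bsub>V\<^esub> v, w)] @ scale (a \<oplus> b) l)
      ([(a \<odot>\<^bsub>V\<^esub> v, w), (b \<odot>\<^bsub>V\<^esub> v, w)] @ (scale a l @ scale b l))"
  proof (rule tensor_eq.append)
    show "tensor_eq K V W [((a \<oplus> b) \<odot>\<^bsub>V\<^esub> v, w)] [(a \<odot>\<^bsub>V\<^esub> v, w), (b \<odot>\<^bsub>V\<^esub> v, w)]"
      using vw assms V by (simp add: module_smult tensor_eq.add_left)
  qed (rule Cons.IH)
  moreover have "tensor_eq K V W ((a \<odot>\<^bsub>V\<^esub> v, w) # scale a l @ (b \<odot>\<^bsub>V\<^esub> v, w) # scale b l)
     ((a \<odot>\<^bsub>V\<^esub> v, w) # (b \<odot>\<^bsub>V\<^esub> v, w) # scale a l @ scale b l)"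
    using vw assms V sc by (intro tensor_eq_move_second) auto
  ultimately show ?case using p by (auto intro: tensor_eq.trans tensor_eq.sym)
qed (simp add: tensor_eq.refl)

lemma tensor_carrier: "x \<in> carrier (tensor K V W) \<longleftrightarrow> (\<exists>l\<in>sums. x = tensor_class K V W l)"
  by (auto simp: tensor_def)

lemma summands_tensor:
  assumes "x \<in> carrier (tensor K V W)"
  shows "summands x \<in> sums" "tensor_class K V W (summands x) = x"
proof -
  obtain l where l: "l \<in> sums" "x = tensor_class K V W l" using assms tensor_carrier by blast
  note e = tensor_eq_summands[OF l(1)]
  show "summands x \<in> sums" using e tensor_eq_lists[OF _ V W] l by blast
  show "tensor_class K V W (summands x) = x" using tensor_class_eq[OF e] l by simp
qed

lemma tensor_add_class:
  assumes "l \<in> sums" "l' \<in> sums"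
  shows "tensor_class K V W l \<oplus>\<^bsub>tensor K V W\<^esub> tensor_class K V W l' = tensor_class K V W (l @ l')"
proof -
  have "tensor_eq K V W (l @ l') (summands (tensor_class K V W l) @ summands (tensor_class K V W l'))"
    using assms by (intro tensor_eq.append tensor_eq_summands)
  from tensor_class_eq[OF this] show ?thesis by (simp add: tensor_def)
qed

lemma tensor_smult_class:
  assumes "l \<in> sums" "a \<in> carrier K"
  shows "a \<odot>\<^bsub>tensor K V W\<^esub> tensor_class K V W l = tensor_class K V W (scale a l)"
  using tensor_class_eq[OF tensor_eq_smult[OF tensor_eq_summands[OF assms(1)] assms(2) V W]]
  by (simp add: tensor_def)

lemma module_tensor [simp]: "module K (tensor K V W)"
proof -
  have sc: "scale a l \<in> sums" if "l \<in> sums" "a \<in> carrier K" for a l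
    using that(1) by (induction l) (use V that(2) in auto)
  have scale_one: "scale \<one> l = l" if "l \<in> sums" for l
    using that by (induction l) (use V in auto)
  have scale_scale: "scale a (scale b l) = scale (a \<otimes> b) l" if "l \<in> sums" "a \<in> carrier K" "b \<in> carrier K" for a b l
    using that(1) by (induction l) (use V that(2,3) in \<open>auto simp: module_smult simp del: map_map\<close>)
  have zero: "\<zero>\<^bsub>tensor K V W\<^esub> = tensor_class K V W []" by (simp add: tensor_def)
  have closed: "tensor_class K V W l \<in> carrier (tensor K V W)" if "l \<in> sums" for l
    using that tensor_carrier by blast
  have elem: P if "x \<in> carrier (tensor K V W)" "\<And>l. l \<in> sums \<Longrightarrow> x = tensor_class K V W l \<Longrightarrow> P" for x P
    using that tensor_carrier by blast
  note classes = closed zero tensor_add_class tensor_smult_class append_in_lists_conv sc scale_one scale_scale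
    tensor_class_eq[OF tensor_eq_zero_coefficients] tensor_class_eq[OF tensor_eq_add_coefficients]
  show ?thesis
  proof (rule moduleI', goal_cases)
    case (5 x y)
    then show ?case
      using tensor_class_eq[OF tensor_eq.commute, of _ V W] by (elim elem) (simp add: classes del: in_lists_conv_set)
  qed (((erule elem)+)?, simp add: classes del: in_lists_conv_set map_map)+
qed

lemma pure_closed [simp]: "v \<in> carrier V \<Longrightarrow> w \<in> carrier W \<Longrightarrow> pure K V W v w \<in> carrier (tensor K V W)"
  by (auto simp: pure_def tensor_carrier)

lemma tensor_class_Cons:
  "v \<in> carrier V \<Longrightarrow> w \<in> carrier W \<Longrightarrow> l \<in> sums \<Longrightarrow>
    tensor_class K V W ((v, w) # l) = pure K V W v w \<oplus>\<^bsub>tensor K V W\<^esub> tensor_class K V W l"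
  using tensor_add_class[of "[(v, w)]" l] by (simp add: pure_def)

lemma bilinear_pure: "bilinear_map V W (tensor K V W) (pure K V W)"
  unfolding bilinear_map_def
proof (intro conjI ballI linear_mapI)
  fix v w x assume vwx: "v \<in> carrier V" "w \<in> carrier W" "x \<in> carrier W"
  show "pure K V W v (w \<oplus>\<^bsub>W\<^esub> x) = pure K V W v w \<oplus>\<^bsub>tensor K V W\<^esub> pure K V W v x"
    using vwx tensor_add_class[of "[(v, w)]" "[(v, x)]"] tensor_class_eq[OF tensor_eq.add_right[of v V w W x K]]
    by (simp add: pure_def)
next
  fix v w x assume vwx: "v \<in> carrier V" "w \<in> carrier W" "x \<in> carrier V"
  show "pure K V W (v \<oplus>\<^bsub>V\<^esub> x) w = pure K V W v w \<oplus>\<^bsub>tensor K V W\<^esub> pure K V W x w"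
    using vwx tensor_add_class[of "[(v, w)]" "[(x, w)]"] tensor_class_eq[OF tensor_eq.add_left[of v V x w W K]]
    by (simp add: pure_def)
  fix a assume a: "a \<in> carrier K"
  show "pure K V W (a \<odot>\<^bsub>V\<^esub> v) w = a \<odot>\<^bsub>tensor K V W\<^esub> pure K V W v w"
    using vwx a tensor_smult_class[of "[(v, w)]" a] by (simp add: pure_def)
next
  fix v w a assume vwx: "v \<in> carrier V" "w \<in> carrier W" "a \<in> carrier K"
  show "pure K V W v (a \<odot>\<^bsub>W\<^esub> w) = a \<odot>\<^bsub>tensor K V W\<^esub> pure K V W v w"
    using vwx tensor_smult_class[of "[(v, w)]" a] tensor_class_eq[OF tensor_eq.smult[of a K v V w W]]
    by (simp add: pure_def)
qed auto

lemma tensor_induct [consumes 1, case_names zero pure add]: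
  assumes "x \<in> carrier (tensor K V W)"
    and "P \<zero>\<^bsub>tensor K V W\<^esub>"
    and "\<And>v w. v \<in> carrier V \<Longrightarrow> w \<in> carrier W \<Longrightarrow> P (pure K V W v w)"
    and "\<And>x y. x \<in> carrier (tensor K V W) \<Longrightarrow> y \<in> carrier (tensor K V W) \<Longrightarrow> P x \<Longrightarrow> P y \<Longrightarrow>
      P (x \<oplus>\<^bsub>tensor K V W\<^esub> y)"
  shows "P x"
proof -
  have "P (tensor_class K V W l)" if "l \<in> sums" for l
    using that
  proof (induction l)
    case Nil
    then show ?case using assms(2) by (simp add: tensor_def)
  next
    case (Cons p l)
    obtain v w where p: "p = (v, w)" by (cases p)
    have "tensor_class K V W l \<in> carrier (tensor K V W)" using Cons by (auto simp: tensor_carrier simp del: in_lists_conv_set)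
    then show ?case using Cons p assms(3,4) by (auto simp: tensor_class_Cons simp del: in_lists_conv_set)
  qed
  then show ?thesis using assms(1) tensor_carrier by auto
qed

lemma linear_lin_ext:
  assumes "module K M" "bilinear_map V W M f"
  shows "linear_map K (tensor K V W) M (lin_ext M f)"
proof -
  have cl: "\<And>v w. v \<in> carrier V \<Longrightarrow> w \<in> carrier W \<Longrightarrow> f v w \<in> carrier M"
    using assms by (auto dest: linear_map_closed)
  have eval: "lin_ext M f (tensor_class K V W l) = lin_ext M f (Tens l)" if "l \<in> sums" for l
    using lin_ext_tensor_eq[OF tensor_eq_summands[OF that] V W assms] by (simp add: lin_ext_def)
  have sc: "scale a l \<in> sums" if "l \<in> sums" "a \<in> carrier K" for a l
    using that(1) by (induction l) (use V that(2) in auto)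
  have scale: "lin_ext M f (Tens (scale a l)) = a \<odot>\<^bsub>M\<^esub> lin_ext M f (Tens l)"
    if "l \<in> sums" "a \<in> carrier K" for a l using that(1)
  proof (induction l)
    case (Cons p l)
    obtain v w where p: "p = (v, w)" by (cases p)
    then have "f (a \<odot>\<^bsub>V\<^esub> v) w = a \<odot>\<^bsub>M\<^esub> f v w"
      using Cons that assms linear_map_smult[of V M "\<lambda>v. f v w"] by auto
    then show ?case using Cons p that assms cl lin_ext_Tens_closed[of M V W f, OF assms(1) cl, of l]
      by (auto simp: module_smult)
  qed (use that assms in simp)
  show ?thesis
  proof (rule linear_mapI)
    fix x assume "x \<in> carrier (tensor K V W)"
    then obtain l where l: "l \<in> sums" "x = tensor_class K V W l"
      by (auto simp: tensor_carrier simp del: in_lists_conv_set)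
    then show "lin_ext M f x \<in> carrier M"
      using eval lin_ext_Tens_closed[of M V W f, OF assms(1) cl] by simp
    fix a assume a: "a \<in> carrier K"
    show "lin_ext M f (a \<odot>\<^bsub>tensor K V W\<^esub> x) = a \<odot>\<^bsub>M\<^esub> lin_ext M f x"
      using l a eval sc scale by (simp add: tensor_smult_class del: in_lists_conv_set)
  next
    fix x y assume "x \<in> carrier (tensor K V W)" "y \<in> carrier (tensor K V W)"
    then obtain l l' where "l \<in> sums" "l' \<in> sums" "x = tensor_class K V W l" "y = tensor_class K V W l'"
      by (auto simp: tensor_carrier simp del: in_lists_conv_set)
    then show "lin_ext M f (x \<oplus>\<^bsub>tensor K V W\<^esub> y) = lin_ext M f x \<oplus>\<^bsub>M\<^esub> lin_ext M f y"
      using eval lin_ext_append[of M V W f, OF assms(1) cl] by (simp add: tensor_add_class append_in_lists_conv del: in_lists_conv_set)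
  qed
qed

lemma lin_ext_pure:
  assumes "module K M" "bilinear_map V W M f" "v \<in> carrier V" "w \<in> carrier W"
  shows "lin_ext M f (pure K V W v w) = f v w"
proof -
  have "f v w \<in> carrier M" using assms by (auto dest: linear_map_closed)
  then show ?thesis
    using lin_ext_tensor_eq[OF tensor_eq_summands[of "[(v, w)]" V W] V W assms(1,2)] assms
    by (simp add: pure_def lin_ext_def[of M f "tensor_class K V W l" for l] lin_ext_def)
qed

end

end

section \<open>Sums over the terms of a tensor\<close>

text \<open>The terms of a tensor in \<open>V \<otimes> W\<close> lie in \<open>V\<close> and \<open>W\<close>, so the guard changes nothing for tensors. It
  makes the congruence rule, closure and the exchange of sums hold for an arbitrary \<open>x\<close>, so
  that rewriting below a sum may use \<open>v \<in> carrier V\<close> and \<open>w \<in> carrier W\<close>.\<close>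

definition tsum ::
  "('k, ('k, 'a) univ, 's) module_scheme \<Rightarrow> ('k, ('k, 'a) univ, 't) module_scheme \<Rightarrow>
   ('k, 'm, 'u) module_scheme \<Rightarrow> (('k, 'a) univ \<Rightarrow> ('k, 'a) univ \<Rightarrow> 'm) \<Rightarrow> ('k, 'a) univ \<Rightarrow> 'm"
  where "tsum V W M f x =
    lin_ext M (\<lambda>v w. if v \<in> carrier V \<and> w \<in> carrier W then f v w else \<zero>\<^bsub>M\<^esub>) x"

lemma tsum_cong [cong]:
  assumes "V = V'" "W = W'" "M = M'"
    and "\<And>v w. v \<in> carrier V' \<Longrightarrow> w \<in> carrier W' \<Longrightarrow> f v w = g v w" "x = y"
  shows "tsum V W M f x = tsum V' W' M' g y"
proof -
  have "(\<lambda>v w. if v \<in> carrier V \<and> w \<in> carrier W then f v w else \<zero>\<^bsub>M\<^esub>) =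
        (\<lambda>v w. if v \<in> carrier V' \<and> w \<in> carrier W' then g v w else \<zero>\<^bsub>M'\<^esub>)"
    using assms by (intro HOL.ext) simp
  then show ?thesis using assms by (simp only: tsum_def)
qed

lemma lin_ext_zero_add_cong:
  assumes "\<zero>\<^bsub>M\<^esub> = \<zero>\<^bsub>M'\<^esub>" "add M = add M'"
  shows "lin_ext M f x = lin_ext M' f x"
  using assms by (simp add: lin_ext_def)

context base_field
begin

lemma lin_ext_closed:
  assumes "module K M" "\<And>v w. f v w \<in> carrier M"
  shows "lin_ext M f x \<in> carrier M"
proof -
  have "lin_ext M f (Tens l) \<in> carrier M" for l
    by (induction l) (use assms in auto)
  from this[of "summands x"] show ?thesis by (simp add: lin_ext_def)
qed

lemma lin_ext_linear:
  assumes "module K M" "module K N" "linear_map K M N g" "\<And>v w. f v w \<in> carrier M"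
  shows "g (lin_ext M f x) = lin_ext N (\<lambda>v w. g (f v w)) x"
proof -
  have "g (lin_ext M f (Tens l)) = lin_ext N (\<lambda>v w. g (f v w)) (Tens l)" for l
    by (induction l)
      (use assms lin_ext_closed[of M f] in \<open>auto simp: linear_map_zero[OF assms(3)] linear_map_add[OF assms(3)]\<close>)
  from this[of "summands x"] show ?thesis by (simp add: lin_ext_def)
qed

lemma lin_ext_add:
  assumes "module K M" "\<And>v w. f v w \<in> carrier M" "\<And>v w. g v w \<in> carrier M"
  shows "lin_ext M (\<lambda>v w. f v w \<oplus>\<^bsub>M\<^esub> g v w) x = lin_ext M f x \<oplus>\<^bsub>M\<^esub> lin_ext M g x"
proof -
  have "lin_ext M (\<lambda>v w. f v w \<oplus>\<^bsub>M\<^esub> g v w) (Tens l) = lin_ext M f (Tens l) \<oplus>\<^bsub>M\<^esub> lin_ext M g (Tens l)" for l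
    by (induction l) (use assms in \<open>auto simp: module_add_ac lin_ext_closed\<close>)
  from this[of "summands x"] show ?thesis by (simp add: lin_ext_def)
qed

lemma tsum_closed [simp]:
  assumes "module K M" "\<And>v w. v \<in> carrier V \<Longrightarrow> w \<in> carrier W \<Longrightarrow> f v w \<in> carrier M"
  shows "tsum V W M f x \<in> carrier M"
  unfolding tsum_def by (rule lin_ext_closed) (use assms in auto)

lemma linear_tsum:
  assumes "linear_map K M N g" "module K M" "module K N"
    and "\<And>v w. v \<in> carrier V \<Longrightarrow> w \<in> carrier W \<Longrightarrow> f v w \<in> carrier M"
  shows "g (tsum V W M f x) = tsum V W N (\<lambda>v w. g (f v w)) x"
proof -
  have "g (tsum V W M f x) = lin_ext N (\<lambda>v w. g (if v \<in> carrier V \<and> w \<in> carrier W then f v w else \<zero>\<^bsub>M\<^esub>)) x"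
    unfolding tsum_def by (rule lin_ext_linear) (use assms in auto)
  also have "\<dots> = tsum V W N (\<lambda>v w. g (f v w)) x"
    unfolding tsum_def by (rule arg_cong[where f="\<lambda>h. lin_ext N h x"])
      (use assms linear_map_zero[OF assms(1)] in \<open>auto intro!: ext\<close>)
  finally show ?thesis .
qed

lemma tsum_add:
  assumes "module K M"
    and "\<And>v w. v \<in> carrier V \<Longrightarrow> w \<in> carrier W \<Longrightarrow> f v w \<in> carrier M"
    and "\<And>v w. v \<in> carrier V \<Longrightarrow> w \<in> carrier W \<Longrightarrow> g v w \<in> carrier M"
  shows "tsum V W M (\<lambda>v w. f v w \<oplus>\<^bsub>M\<^esub> g v w) x = tsum V W M f x \<oplus>\<^bsub>M\<^esub> tsum V W M g x"
proof -
  have "tsum V W M (\<lambda>v w. f v w \<oplus>\<^bsub>M\<^esub> g v w) x =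
    lin_ext M (\<lambda>v w. (if v \<in> carrier V \<and> w \<in> carrier W then f v w else \<zero>\<^bsub>M\<^esub>) \<oplus>\<^bsub>M\<^esub>
      (if v \<in> carrier V \<and> w \<in> carrier W then g v w else \<zero>\<^bsub>M\<^esub>)) x"
    unfolding tsum_def by (rule arg_cong[where f="\<lambda>h. lin_ext M h x"]) (use assms in \<open>auto intro!: ext\<close>)
  also have "\<dots> = tsum V W M f x \<oplus>\<^bsub>M\<^esub> tsum V W M g x"
    unfolding tsum_def by (rule lin_ext_add) (use assms in auto)
  finally show ?thesis .
qed

lemma tsum_zero [simp]:
  assumes "module K M"
  shows "tsum V W M (\<lambda>v w. \<zero>\<^bsub>M\<^esub>) x = \<zero>\<^bsub>M\<^esub>"
proof -
  have "lin_ext M (\<lambda>v w. \<zero>\<^bsub>M\<^esub>) (Tens l) = \<zero>\<^bsub>M\<^esub>" for l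
    by (induction l) (use assms in auto)
  from this[of "summands x"] show ?thesis by (simp add: tsum_def lin_ext_def)
qed

text \<open>This holds for all \<open>f\<close>, bilinear or not, because both sides are finite sums over the same lists
  of terms.\<close>

lemma tsum_swap:
  assumes "module K M"
    and "\<And>v w v' w'. v \<in> carrier V \<Longrightarrow> w \<in> carrier W \<Longrightarrow> v' \<in> carrier V' \<Longrightarrow> w' \<in> carrier W' \<Longrightarrow>
      f v w v' w' \<in> carrier M"
  shows "tsum V W M (\<lambda>v w. tsum V' W' M (\<lambda>v' w'. f v w v' w') y) x =
    tsum V' W' M (\<lambda>v' w'. tsum V W M (\<lambda>v w. f v w v' w') x) y"
proof -
  have "tsum V W M (\<lambda>v w. tsum V' W' M (\<lambda>v' w'. f v w v' w') y) (Tens l) =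
    tsum V' W' M (\<lambda>v' w'. tsum V W M (\<lambda>v w. f v w v' w') (Tens l)) y" for l
  proof (induction l)
    case Nil
    have "tsum V W M g (Tens []) = \<zero>\<^bsub>M\<^esub>" for g by (simp add: tsum_def)
    then show ?case using assms(1) by simp
  next
    case (Cons p l)
    obtain a b where p: "p = (a, b)" by (cases p)
    have cons: "tsum V W M g (Tens (p # l)) =
      (if a \<in> carrier V \<and> b \<in> carrier W then g a b else \<zero>\<^bsub>M\<^esub>) \<oplus>\<^bsub>M\<^esub> tsum V W M g (Tens l)" for g
      by (simp add: tsum_def p)
    have "tsum V' W' M (\<lambda>v' w'. tsum V W M (\<lambda>v w. f v w v' w') (Tens (p # l))) y =
      tsum V' W' M (\<lambda>v' w'. if a \<in> carrier V \<and> b \<in> carrier W then f a b v' w' else \<zero>\<^bsub>M\<^esub>) y \<oplus>\<^bsub>M\<^esub>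
      tsum V' W' M (\<lambda>v' w'. tsum V W M (\<lambda>v w. f v w v' w') (Tens l)) y"
      unfolding cons by (rule tsum_add) (use assms in auto)
    then show ?case using Cons assms by (auto simp: cons)
  qed
  from this[of "summands x"] show ?thesis by (simp add: tsum_def lin_ext_def)
qed

text \<open>It brings two sums next to each other to which coassociativity or a balancing condition applies,
  when a sum over a tensor that depends on the outer term stands between them.\<close>

lemma tsum_swap_inner:
  assumes "module K M"
    and "\<And>v w p q a b. v \<in> carrier V \<Longrightarrow> w \<in> carrier W \<Longrightarrow> p \<in> carrier P \<Longrightarrow> q \<in> carrier Q \<Longrightarrow>
      a \<in> carrier A \<Longrightarrow> b \<in> carrier B \<Longrightarrow> f v w p q a b \<in> carrier M"
  shows "tsum V W M (\<lambda>v w. tsum P Q M (\<lambda>p q. tsum A B M (\<lambda>a b. f v w p q a b) (s v w)) (t v w)) x =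
    tsum V W M (\<lambda>v w. tsum A B M (\<lambda>a b. tsum P Q M (\<lambda>p q. f v w p q a b) (t v w)) (s v w)) x"
  by (intro tsum_cong HOL.refl tsum_swap) (use assms in auto)

lemma tsum_eq_lin_ext:
  assumes "x \<in> carrier (tensor K V W)" "module K V" "module K W"
  shows "tsum V W M f x = lin_ext M f x"
proof -
  have "lin_ext M (\<lambda>v w. if v \<in> carrier V \<and> w \<in> carrier W then f v w else \<zero>\<^bsub>M\<^esub>) (Tens l) = lin_ext M f (Tens l)"
    if "l \<in> lists (carrier V \<times> carrier W)" for l using that
    by (induction l) auto
  from this[OF summands_tensor(1)[OF assms(2,3,1)]] show ?thesis
    by (simp add: tsum_def lin_ext_def)
qed

lemma linear_map_tsum_parameter [simp]:
  assumes "module K U" "module K M"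
    and "\<And>v w. v \<in> carrier V \<Longrightarrow> w \<in> carrier W \<Longrightarrow> linear_map K U M (\<lambda>u. f u v w)"
  shows "linear_map K U M (\<lambda>u. tsum V W M (\<lambda>v w. f u v w) x)"
proof (rule linear_mapI)
  fix u assume u: "u \<in> carrier U"
  then have cl: "f u v w \<in> carrier M" if "v \<in> carrier V" "w \<in> carrier W" for v w
    using assms(3)[OF that] linear_map_closed by metis
  then show "tsum V W M (f u) x \<in> carrier M" using assms by simp
  fix a assume a: "a \<in> carrier K"
  have "linear_map K M M (\<lambda>m. a \<odot>\<^bsub>M\<^esub> m)"
    using a assms(2) by (auto intro!: linear_mapI simp: module_smult m_comm)
  from linear_tsum[OF this assms(2,2)] cl
  have "a \<odot>\<^bsub>M\<^esub> tsum V W M (f u) x = tsum V W M (\<lambda>v w. a \<odot>\<^bsub>M\<^esub> f u v w) x" by auto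
  also have "\<dots> = tsum V W M (f (a \<odot>\<^bsub>U\<^esub> u)) x"
    by (rule tsum_cong) (use linear_map_smult[OF assms(3)] a u in auto)
  finally show "tsum V W M (f (a \<odot>\<^bsub>U\<^esub> u)) x = a \<odot>\<^bsub>M\<^esub> tsum V W M (f u) x" by simp
next
  fix u u' assume u: "u \<in> carrier U" "u' \<in> carrier U"
  have cl: "f u v w \<in> carrier M" if "v \<in> carrier V" "w \<in> carrier W" "u \<in> carrier U" for u v w
    using assms(3)[OF that(1,2)] linear_map_closed that(3) by metis
  have "tsum V W M (f (u \<oplus>\<^bsub>U\<^esub> u')) x = tsum V W M (\<lambda>v w. f u v w \<oplus>\<^bsub>M\<^esub> f u' v w) x"
    by (rule tsum_cong) (use linear_map_add[OF assms(3)] u in auto)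
  also have "\<dots> = tsum V W M (f u) x \<oplus>\<^bsub>M\<^esub> tsum V W M (f u') x"
    by (rule tsum_add) (use cl u assms in auto)
  finally show "tsum V W M (f (u \<oplus>\<^bsub>U\<^esub> u')) x = tsum V W M (f u) x \<oplus>\<^bsub>M\<^esub> tsum V W M (f u') x" .
qed

lemma linear_map_tsum_tensor:
  assumes "module K V" "module K W" "module K M" "bilinear_map V W M f"
  shows "linear_map K (tensor K V W) M (tsum V W M f)"
  using linear_lin_ext[OF assms] by (auto simp: linear_map_def Pi_def tsum_eq_lin_ext assms(1,2))

lemma linear_map_tsum_argument [simp]:
  assumes "module K U" "module K V" "module K W" "module K M"
    and "linear_map K U (tensor K V W) (\<lambda>u. t u)" "bilinear_map V W M f"
  shows "linear_map K U M (\<lambda>u. tsum V W M f (t u))"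
  by (rule linear_map_compose[OF linear_map_tsum_tensor assms(5)]) (use assms in blast)+

lemma tsum_pure [simp]:
  assumes "module K V" "module K W" "module K M" "bilinear_map V W M f" "v \<in> carrier V" "w \<in> carrier W"
  shows "tsum V W M f (pure K V W v w) = f v w"
  using lin_ext_pure[OF assms] assms by (simp add: tsum_eq_lin_ext)

lemma tsum_tsum [simp]:
  assumes "module K V" "module K W" "module K M" "bilinear_map V W M f"
    and "\<And>v' w'. v' \<in> carrier V' \<Longrightarrow> w' \<in> carrier W' \<Longrightarrow> g v' w' \<in> carrier (tensor K V W)"
  shows "tsum V W M f (tsum V' W' (tensor K V W) (\<lambda>v w. g v w) x) = tsum V' W' M (\<lambda>v' w'. tsum V W M f (g v' w')) x"
  by (rule linear_tsum[OF linear_map_tsum_tensor]) (use assms in auto)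

lemma tsum_smult_argument [simp]:
  assumes "module K V" "module K W" "module K M" "bilinear_map V W M f"
    and "a \<in> carrier K" "x \<in> carrier (tensor K V W)"
  shows "tsum V W M f (a \<odot>\<^bsub>tensor K V W\<^esub> x) = a \<odot>\<^bsub>M\<^esub> tsum V W M f x"
  by (rule linear_map_smult[OF linear_map_tsum_tensor]) (use assms in auto)

lemma linear_map_scale [simp]:
  assumes "module K M" "a \<in> carrier K" "linear_map K V M (\<lambda>v. f v)"
  shows "linear_map K V M (\<lambda>v. a \<odot>\<^bsub>M\<^esub> f v)"
proof -
  have "linear_map K M M (\<lambda>m. a \<odot>\<^bsub>M\<^esub> m)"
    using assms by (auto intro!: linear_mapI simp: module_smult m_comm)
  then show ?thesis using assms(3) by (rule linear_map_compose)
qed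

lemma scale_tsum [simp]:
  assumes "module K M" "a \<in> carrier K" "\<And>v w. v \<in> carrier V \<Longrightarrow> w \<in> carrier W \<Longrightarrow> f v w \<in> carrier M"
  shows "a \<odot>\<^bsub>M\<^esub> tsum V W M (\<lambda>v w. f v w) x = tsum V W M (\<lambda>v w. a \<odot>\<^bsub>M\<^esub> f v w) x"
  by (rule linear_tsum[OF linear_map_scale]) (use assms in auto)

lemma linear_map_pure [simp]:
  assumes "module K V" "module K W"
  shows "linear_map K U V (\<lambda>u. f u) \<Longrightarrow> w \<in> carrier W \<Longrightarrow> linear_map K U (tensor K V W) (\<lambda>u. pure K V W (f u) w)"
    and "linear_map K U W (\<lambda>u. g u) \<Longrightarrow> v \<in> carrier V \<Longrightarrow> linear_map K U (tensor K V W) (\<lambda>u. pure K V W v (g u))"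
  using bilinear_pure[OF assms] linear_map_compose unfolding bilinear_map_def by blast+

lemma pure_tsum [simp]:
  assumes "module K V" "module K W"
  shows "(\<And>a b. a \<in> carrier A \<Longrightarrow> b \<in> carrier B \<Longrightarrow> f a b \<in> carrier V) \<Longrightarrow> w \<in> carrier W \<Longrightarrow>
      pure K V W (tsum A B V (\<lambda>a b. f a b) x) w = tsum A B (tensor K V W) (\<lambda>a b. pure K V W (f a b) w) x"
    and "(\<And>a b. a \<in> carrier A \<Longrightarrow> b \<in> carrier B \<Longrightarrow> g a b \<in> carrier W) \<Longrightarrow> v \<in> carrier V \<Longrightarrow>
      pure K V W v (tsum A B W (\<lambda>a b. g a b) x) = tsum A B (tensor K V W) (\<lambda>a b. pure K V W v (g a b)) x"
   by (rule linear_tsum[OF linear_map_pure(1)], use assms in auto)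
     (rule linear_tsum[OF linear_map_pure(2)], use assms in auto)

lemma pure_scale [simp]:
  assumes "module K V" "module K W" "a \<in> carrier K" "v \<in> carrier V" "w \<in> carrier W"
  shows "pure K V W (a \<odot>\<^bsub>V\<^esub> v) w = a \<odot>\<^bsub>tensor K V W\<^esub> pure K V W v w"
    and "pure K V W v (a \<odot>\<^bsub>W\<^esub> w) = a \<odot>\<^bsub>tensor K V W\<^esub> pure K V W v w"
  using linear_map_smult[OF linear_map_pure(1)[OF assms(1,2) linear_map_id], of w a v]
    linear_map_smult[OF linear_map_pure(2)[OF assms(1,2) linear_map_id], of v a w] assms by auto

lemma tsum_pure_id [simp]:
  assumes "module K V" "module K W" "x \<in> carrier (tensor K V W)"
  shows "tsum V W (tensor K V W) (pure K V W) x = x"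
  using assms(3)
proof (induction rule: tensor_induct[OF assms(1,2), consumes 1, case_names zero pure add])
  case zero
  have "linear_map K (tensor K V W) (tensor K V W) (tsum V W (tensor K V W) (pure K V W))"
    using assms by simp
  then show ?case using linear_map_zero assms by (metis module_tensor)
next
  case (add x y)
  have "linear_map K (tensor K V W) (tensor K V W) (tsum V W (tensor K V W) (pure K V W))"
    using assms by simp
  from linear_map_add[OF this] add show ?case by simp
qed (use assms in simp)

lemma collapse_pure:
  assumes "module K U" "module K V" "module K W" "t \<in> carrier (tensor K U V)" "w \<in> carrier W"
  shows "tsum U V (tensor K (tensor K U V) W) (\<lambda>u v. pure K (tensor K U V) W (pure K U V u v) w) t = pure K (tensor K U V) W t w"
    and "tsum U V (tensor K W (tensor K U V)) (\<lambda>u v. pure K W (tensor K U V) w (pure K U V u v)) t = pure K W (tensor K U V) w t"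
  using assms pure_tsum(1)[of "tensor K U V" W U V "pure K U V" w t] pure_tsum(2)[of W "tensor K U V" U V "pure K U V" w t]
  by simp_all

subsection \<open>The ground field and algebras\<close>

lemma ground_algebra_simps [simp]:
  "carrier (ground_algebra K) = carrier K" "mult (ground_algebra K) = mult K" "one (ground_algebra K) = one K"
  "zero (ground_algebra K) = zero K" "add (ground_algebra K) = add K" "smult (ground_algebra K) = mult K"
  by (simp_all add: ground_algebra_def)

lemma linear_map_scale_left [simp]:
  assumes "module K M" "m \<in> carrier M" "linear_map K V (ground_algebra K) (\<lambda>v. f v)"
  shows "linear_map K V M (\<lambda>v. f v \<odot>\<^bsub>M\<^esub> m)"
proof -
  have "linear_map K (ground_algebra K) M (\<lambda>a. a \<odot>\<^bsub>M\<^esub> m)"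
    using assms by (auto intro!: linear_mapI simp: module_smult)
  then show ?thesis using assms(3) by (rule linear_map_compose)
qed

lemma assoc_algebra_ring: "assoc_algebra K A \<Longrightarrow> ring A"
  by (simp add: assoc_algebra_def)

lemma algebra_rules [simp]:
  assumes "assoc_algebra K A"
  shows "module K A"
    and "\<one>\<^bsub>A\<^esub> \<in> carrier A"
    and "x \<in> carrier A \<Longrightarrow> y \<in> carrier A \<Longrightarrow> x \<otimes>\<^bsub>A\<^esub> y \<in> carrier A"
    and "x \<in> carrier A \<Longrightarrow> \<one>\<^bsub>A\<^esub> \<otimes>\<^bsub>A\<^esub> x = x"
    and "x \<in> carrier A \<Longrightarrow> x \<otimes>\<^bsub>A\<^esub> \<one>\<^bsub>A\<^esub> = x"
    and "a \<in> carrier K \<Longrightarrow> x \<in> carrier A \<Longrightarrow> y \<in> carrier A \<Longrightarrow> (a \<odot>\<^bsub>A\<^esub> x) \<otimes>\<^bsub>A\<^esub> y = a \<odot>\<^bsub>A\<^esub> (x \<otimes>\<^bsub>A\<^esub> y)"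
    and "a \<in> carrier K \<Longrightarrow> x \<in> carrier A \<Longrightarrow> y \<in> carrier A \<Longrightarrow> x \<otimes>\<^bsub>A\<^esub> (a \<odot>\<^bsub>A\<^esub> y) = a \<odot>\<^bsub>A\<^esub> (x \<otimes>\<^bsub>A\<^esub> y)"
  using assms ring.ring_simprules(5,6,12)[OF assoc_algebra_ring[OF assms]] monoid.r_one[OF ring.is_monoid[OF assoc_algebra_ring[OF assms]]]
  unfolding assoc_algebra_def by blast+

lemma algebra_mult_assoc:
  "assoc_algebra K A \<Longrightarrow> x \<in> carrier A \<Longrightarrow> y \<in> carrier A \<Longrightarrow> z \<in> carrier A \<Longrightarrow>
    (x \<otimes>\<^bsub>A\<^esub> y) \<otimes>\<^bsub>A\<^esub> z = x \<otimes>\<^bsub>A\<^esub> (y \<otimes>\<^bsub>A\<^esub> z)"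
  by (rule monoid.m_assoc[OF ring.is_monoid[OF assoc_algebra_ring]])

lemma linear_map_mult [simp]:
  assumes "assoc_algebra K A"
  shows "linear_map K U A (\<lambda>u. f u) \<Longrightarrow> y \<in> carrier A \<Longrightarrow> linear_map K U A (\<lambda>u. f u \<otimes>\<^bsub>A\<^esub> y)"
    and "linear_map K U A (\<lambda>u. g u) \<Longrightarrow> x \<in> carrier A \<Longrightarrow> linear_map K U A (\<lambda>u. x \<otimes>\<^bsub>A\<^esub> g u)"
proof -
  interpret A: ring A using assms by (rule assoc_algebra_ring)
  have "linear_map K A A (\<lambda>x. x \<otimes>\<^bsub>A\<^esub> y)" "linear_map K A A (\<lambda>x. y \<otimes>\<^bsub>A\<^esub> x)" if "y \<in> carrier A" for y
    by (rule linear_mapI; use assms that in \<open>simp add: A.l_distr A.r_distr\<close>)+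
  then show "linear_map K U A (\<lambda>u. f u) \<Longrightarrow> y \<in> carrier A \<Longrightarrow> linear_map K U A (\<lambda>u. f u \<otimes>\<^bsub>A\<^esub> y)"
    "linear_map K U A (\<lambda>u. g u) \<Longrightarrow> x \<in> carrier A \<Longrightarrow> linear_map K U A (\<lambda>u. x \<otimes>\<^bsub>A\<^esub> g u)"
    using linear_map_compose by blast+
qed

lemma tensor_algebra_simps [simp]:
  "carrier (tensor_algebra K A B) = carrier (tensor K A B)"
  "\<one>\<^bsub>tensor_algebra K A B\<^esub> = pure K A B \<one>\<^bsub>A\<^esub> \<one>\<^bsub>B\<^esub>"
  by (simp_all add: tensor_algebra_def)

lemma linear_map_tensor_algebra [simp]:
  "linear_map K V (tensor_algebra K A B) f \<longleftrightarrow> linear_map K V (tensor K A B) f"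
  by (simp add: linear_map_def tensor_algebra_def)

lemma tensor_algebra_mult:
  assumes "assoc_algebra K A" "assoc_algebra K B" "x \<in> carrier (tensor K A B)" "y \<in> carrier (tensor K A B)"
  shows "x \<otimes>\<^bsub>tensor_algebra K A B\<^esub> y =
    tsum A B (tensor K A B) (\<lambda>a b. tsum A B (tensor K A B) (\<lambda>a' b'. pure K A B (a \<otimes>\<^bsub>A\<^esub> a') (b \<otimes>\<^bsub>B\<^esub> b')) y) x"
  using assms by (simp add: tensor_algebra_def tsum_eq_lin_ext)

subsection \<open>Trilinear maps\<close>

definition trilinear_map where
  "trilinear_map U V W M f \<longleftrightarrow>
    (\<forall>v\<in>carrier V. \<forall>w\<in>carrier W. linear_map K U M (\<lambda>u. f u v w)) \<and>
    (\<forall>u\<in>carrier U. \<forall>w\<in>carrier W. linear_map K V M (\<lambda>v. f u v w)) \<and>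
    (\<forall>u\<in>carrier U. \<forall>v\<in>carrier V. linear_map K W M (\<lambda>w. f u v w))"

declare trilinear_map_def [simp]

lemma trilinear_map_compose:
  assumes "trilinear_map U V W M f"
  shows "v \<in> carrier V \<Longrightarrow> w \<in> carrier W \<Longrightarrow> linear_map K N U g \<Longrightarrow> linear_map K N M (\<lambda>n. f (g n) v w)"
    and "u \<in> carrier U \<Longrightarrow> w \<in> carrier W \<Longrightarrow> linear_map K N V g \<Longrightarrow> linear_map K N M (\<lambda>n. f u (g n) w)"
    and "u \<in> carrier U \<Longrightarrow> v \<in> carrier V \<Longrightarrow> linear_map K N W g \<Longrightarrow> linear_map K N M (\<lambda>n. f u v (g n))"
  using assms linear_map_compose unfolding trilinear_map_def by blast+

lemma trilinear_map_closed:
  "trilinear_map U V W M f \<Longrightarrow> u \<in> carrier U \<Longrightarrow> v \<in> carrier V \<Longrightarrow> w \<in> carrier W \<Longrightarrow> f u v w \<in> carrier M"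
  by (auto dest: linear_map_closed)

subsection \<open>Maps between tensor products\<close>

lemma tensor_map_tsum:
  assumes "x \<in> carrier (tensor K V' W')" "module K V'" "module K W'"
  shows "tensor_map K V W f g x = tsum V' W' (tensor K V W) (\<lambda>v w. pure K V W (f v) (g w)) x"
  using assms by (simp add: tensor_map_def tsum_eq_lin_ext)

lemma tensor_assoc_tsum:
  assumes "x \<in> carrier (tensor K (tensor K U V) W)" "module K U" "module K V" "module K W"
  shows "tensor_assoc K U V W x =
    tsum (tensor K U V) W (tensor K U (tensor K V W))
      (\<lambda>t w. tsum U V (tensor K U (tensor K V W)) (\<lambda>u v. pure K U (tensor K V W) u (pure K V W v w)) t) x"
proof -
  have "tensor_assoc K U V W x =
     tsum (tensor K U V) W (tensor K U (tensor K V W))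
      (\<lambda>t w. lin_ext (tensor K U (tensor K V W)) (\<lambda>u v. pure K U (tensor K V W) u (pure K V W v w)) t) x"
    using assms by (simp add: tensor_assoc_def Let_def tsum_eq_lin_ext)
  also have "\<dots> = tsum (tensor K U V) W (tensor K U (tensor K V W))
      (\<lambda>t w. tsum U V (tensor K U (tensor K V W)) (\<lambda>u v. pure K U (tensor K V W) u (pure K V W v w)) t) x"
    by (rule tsum_cong) (use assms in \<open>auto simp: tsum_eq_lin_ext\<close>)
  finally show ?thesis .
qed

subsection \<open>Forgetting the coaction\<close>

text \<open>A comodule is a vector space record extended by a coaction. The constructions on vector spaces
  see only the four fields below, which allows the simplifier to drop the coaction from them.\<close>

definition same_space where
  "same_space V V' \<longleftrightarrow> carrier V = carrier V' \<and> zero V = zero V' \<and> add V = add V' \<and> smult V = smult V'"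

lemma tensor_eq_same_space:
  assumes "same_space V V'" "same_space W W'" "tensor_eq K V W l l'"
  shows "tensor_eq K V' W' l l'"
  using assms(3)
proof (induction rule: tensor_eq.induct)
  case (sym l l')
  then show ?case by (blast intro: tensor_eq.sym)
next
  case (trans l l' l'')
  then show ?case by (blast intro: tensor_eq.trans)
next
  case (zero w)
  then show ?case using assms tensor_eq.zero[of w W' K V'] by (simp add: same_space_def)
qed (use assms in \<open>auto simp: same_space_def tensor_eq.refl tensor_eq.append tensor_eq.commute
      tensor_eq.add_left[of _ V' _ _ W', simplified] tensor_eq.add_right[of _ V' _ W'] tensor_eq.smult[of _ K _ V' _ W']\<close>)

lemma tensor_class_same_space:
  assumes "same_space V V'" "same_space W W'"
  shows "tensor_class K V W = tensor_class K V' W'"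
proof -
  have "same_space V' V" "same_space W' W" using assms by (auto simp: same_space_def)
  then have "tensor_eq K V W l = tensor_eq K V' W' l" for l
    using assms tensor_eq_same_space[of V' V W' W l] tensor_eq_same_space[of V V' W W' l]
    by (intro HOL.ext iffI) auto
  then show ?thesis by (intro HOL.ext) (simp add: tensor_class_def)
qed

lemma tensor_same_space:
  assumes "same_space V V'" "same_space W W'"
  shows "tensor K V W = tensor K V' W'" "pure K V W = pure K V' W'"
  using tensor_class_same_space[OF assms] assms
  by (auto simp: tensor_def pure_def same_space_def intro!: HOL.ext)

lemma module_same_space:
  assumes "same_space V V'" "module K V"
  shows "module K V'"
proof -
  note V = module_rules[OF assms(2)] module_add_ac[OF assms(2)] module_smult[OF assms(2)]
  show ?thesis
    by (rule moduleI') (use V assms(1) in \<open>simp_all add: same_space_def\<close>)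
qed

lemma with_coact_simps [simp]:
  "carrier (with_coact M \<alpha>) = carrier M"
  "zero (with_coact M \<alpha>) = zero M"
  "add (with_coact M \<alpha>) = add M"
  "smult (with_coact M \<alpha>) = smult M"
  "coact (with_coact M \<alpha>) = \<alpha>"
  by (simp_all add: with_coact_def)

lemma same_space_with_coact: "same_space (with_coact M \<alpha>) M" "same_space M (with_coact M \<alpha>)" "same_space V V"
  by (simp_all add: same_space_def)

lemma lin_ext_with_coact: "lin_ext (with_coact M \<alpha>) f x = lin_ext M f x"
  by (rule lin_ext_zero_add_cong) simp_all

lemma module_with_coact: "module K (with_coact M \<alpha>) \<longleftrightarrow> module K M"
  using module_same_space[OF same_space_with_coact(1)] module_same_space[OF same_space_with_coact(2)] by blast

lemma forget_coact [simp]: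
  "tensor K (with_coact M \<alpha>) W = tensor K M W"
  "tensor K W (with_coact M \<alpha>) = tensor K W M"
  "pure K (with_coact M \<alpha>) W = pure K M W"
  "pure K W (with_coact M \<alpha>) = pure K W M"
  "tsum (with_coact M \<alpha>) W N f x = tsum M W N f x"
  "tsum W (with_coact M \<alpha>) N f x = tsum W M N f x"
  "tsum W W' (with_coact M \<alpha>) f' x = tsum W W' M f' x"
  "linear_map K (with_coact M \<alpha>) N g \<longleftrightarrow> linear_map K M N g"
  "linear_map K N (with_coact M \<alpha>) h \<longleftrightarrow> linear_map K N M h"
  "module K (with_coact M \<alpha>) \<longleftrightarrow> module K M"
  by (simp_all add: tensor_same_space[OF same_space_with_coact(1,3)] tensor_same_space[OF same_space_with_coact(3,1)]
      tsum_def linear_map_def lin_ext_with_coact module_with_coact cong: if_cong)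

end

section \<open>Comodules over a bialgebra form a linear monoidal category\<close>

lemma compose_eqI:
  assumes "\<And>x. x \<in> A \<Longrightarrow> g (f x) = g' (f' x)"
  shows "compose A g f = compose A g' f'"
  using assms by (auto simp: compose_def intro!: restrict_ext)

context base_field
begin

lemma scale_scale [simp]:
  "module K V \<Longrightarrow> a \<in> carrier K \<Longrightarrow> b \<in> carrier K \<Longrightarrow> x \<in> carrier V \<Longrightarrow> (a \<otimes> b) \<odot>\<^bsub>V\<^esub> x = a \<odot>\<^bsub>V\<^esub> (b \<odot>\<^bsub>V\<^esub> x)"
  by (simp add: module_smult)

end

locale bialgebra_maps = base_field K for K :: "('k, 'r) ring_scheme" (structure) +
  fixes H :: "('k, ('k, 'a) univ) module" and \<Delta> :: "('k, 'a) univ \<Rightarrow> ('k, 'a) univ"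
    and \<epsilon> :: "('k, 'a) univ \<Rightarrow> 'k"
  assumes H [simp]: "assoc_algebra K H"
    and Delta_hom: "algebra_hom K H (tensor_algebra K H H) \<Delta>"
    and counit_hom: "algebra_hom K H (ground_algebra K) \<epsilon>"
begin

lemma Delta_linear0: "linear_map K H (tensor K H H) \<Delta>"
  using Delta_hom by (simp add: algebra_hom_def)

lemma counit_linear0: "linear_map K H (ground_algebra K) \<epsilon>"
  using counit_hom by (simp add: algebra_hom_def)

lemma Delta_closed [simp]: "h \<in> carrier H \<Longrightarrow> \<Delta> h \<in> carrier (tensor K H H)"
  and counit_closed [simp]: "h \<in> carrier H \<Longrightarrow> \<epsilon> h \<in> carrier K"
  using linear_map_closed[OF Delta_linear0] linear_map_closed[OF counit_linear0] by auto

lemma Delta_linear [simp]: "linear_map K U H (\<lambda>u. f u) \<Longrightarrow> linear_map K U (tensor K H H) (\<lambda>u. \<Delta> (f u))"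
  and counit_linear [simp]: "linear_map K U H (\<lambda>u. f u) \<Longrightarrow> linear_map K U (ground_algebra K) (\<lambda>u. \<epsilon> (f u))"
  using linear_map_compose[OF Delta_linear0] linear_map_compose[OF counit_linear0] by auto

lemma counit_mult [simp]: "a \<in> carrier H \<Longrightarrow> b \<in> carrier H \<Longrightarrow> \<epsilon> (a \<otimes>\<^bsub>H\<^esub> b) = \<epsilon> a \<otimes> \<epsilon> b"
  and counit_one [simp]: "\<epsilon> \<one>\<^bsub>H\<^esub> = \<one>"
  using counit_hom by (auto simp: algebra_hom_def ring_hom_def)

lemma Delta_mult [simp]:
  assumes "a \<in> carrier H" "b \<in> carrier H"
  shows "\<Delta> (a \<otimes>\<^bsub>H\<^esub> b) =
    tsum H H (tensor K H H) (\<lambda>a1 a2. tsum H H (tensor K H H)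
      (\<lambda>b1 b2. pure K H H (a1 \<otimes>\<^bsub>H\<^esub> b1) (a2 \<otimes>\<^bsub>H\<^esub> b2)) (\<Delta> b)) (\<Delta> a)"
proof -
  have "\<Delta> (a \<otimes>\<^bsub>H\<^esub> b) = \<Delta> a \<otimes>\<^bsub>tensor_algebra K H H\<^esub> \<Delta> b"
    using assms Delta_hom by (auto simp: algebra_hom_def ring_hom_def)
  then show ?thesis using assms by (simp add: tensor_algebra_mult)
qed

lemma Delta_one [simp]: "\<Delta> \<one>\<^bsub>H\<^esub> = pure K H H \<one>\<^bsub>H\<^esub> \<one>\<^bsub>H\<^esub>"
  using Delta_hom by (auto simp: algebra_hom_def ring_hom_def)

abbreviation comod :: "('k, 'a) comod \<Rightarrow> bool" where "comod V \<equiv> right_comodule K H \<Delta> \<epsilon> V"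

lemma comodD:
  assumes "comod V"
  shows "module K V" "linear_map K V (tensor K V H) (coact V)"
    "v \<in> carrier V \<Longrightarrow> tensor_assoc K V H H (tensor_map K (tensor K V H) H (coact V) (\<lambda>h. h) (coact V v)) =
          tensor_map K V (tensor K H H) (\<lambda>u. u) \<Delta> (coact V v)"
    "v \<in> carrier V \<Longrightarrow> lin_ext V (\<lambda>u h. \<epsilon> h \<odot>\<^bsub>V\<^esub> u) (coact V v) = v"
  using assms by (simp_all add: right_comodule_def)

lemmas comod_module [simp] = comodD(1)
lemmas coact_linear0 = comodD(2)

lemma coact_closed [simp]: "comod V \<Longrightarrow> v \<in> carrier V \<Longrightarrow> coact V v \<in> carrier (tensor K V H)"
  using linear_map_closed[OF coact_linear0] by simp

lemma coact_linear [simp]: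
  "comod V \<Longrightarrow> linear_map K U V (\<lambda>u. f u) \<Longrightarrow> linear_map K U (tensor K V H) (\<lambda>u. coact V (f u))"
  using linear_map_compose[OF coact_linear0] by auto

lemma coact_tsum [simp]:
  assumes "comod V" "\<And>a b. a \<in> carrier A \<Longrightarrow> b \<in> carrier B \<Longrightarrow> f a b \<in> carrier V"
  shows "coact V (tsum A B V f x) = tsum A B (tensor K V H) (\<lambda>a b. coact V (f a b)) x"
  by (rule linear_tsum[OF coact_linear0]) (use assms in auto)

text \<open>Coassociativity \<open>v\<^sub>0\<^sub>0 \<otimes> v\<^sub>0\<^sub>1 \<otimes> v\<^sub>1 = v\<^sub>0 \<otimes> v\<^sub>1\<^sub>1 \<otimes> v\<^sub>1\<^sub>2\<close> after application of an arbitrary linear map. As a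
  rewrite rule it moves all iterated coactions into iterated comultiplications.\<close>

lemma coact_coassoc [simp]:
  assumes "comod V" "x \<in> carrier V" "module K M"
    and f: "trilinear_map V H H M f"
  shows "tsum V H M (\<lambda>v h. tsum V H M (\<lambda>u g. f u g h) (coact V v)) (coact V x) =
    tsum V H M (\<lambda>u t. tsum H H M (\<lambda>g h. f u g h) (\<Delta> t)) (coact V x)" (is "?l = ?r")
proof -
  have "tensor_assoc K V H H (tensor_map K (tensor K V H) H (coact V) (\<lambda>h. h) (coact V x)) =
          tensor_map K V (tensor K H H) (\<lambda>u. u) \<Delta> (coact V x)"
    using assms(1,2) by (rule comodD)
  then have e: "tsum (tensor K V H) H (tensor K V (tensor K H H))
      (\<lambda>t w. tsum V H (tensor K V (tensor K H H)) (\<lambda>u v. pure K V (tensor K H H) u (pure K H H v w)) t)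
      (tsum V H (tensor K (tensor K V H) H) (\<lambda>v h. pure K (tensor K V H) H (coact V v) h) (coact V x)) =
    tsum V H (tensor K V (tensor K H H)) (\<lambda>v h. pure K V (tensor K H H) v (\<Delta> h)) (coact V x)"
    using assms(1,2) by (simp only: tensor_map_tsum[where V'=V and W'=H] coact_closed comod_module algebra_rules H)
      (subst (asm) tensor_assoc_tsum; simp)
  note [simp] = trilinear_map_compose[OF f]
  have "?l = tsum V (tensor K H H) M (\<lambda>u t. tsum H H M (\<lambda>g h. f u g h) t) (tsum (tensor K V H) H (tensor K V (tensor K H H))
      (\<lambda>t w. tsum V H (tensor K V (tensor K H H)) (\<lambda>u v. pure K V (tensor K H H) u (pure K H H v w)) t)
      (tsum V H (tensor K (tensor K V H) H) (\<lambda>v h. pure K (tensor K V H) H (coact V v) h) (coact V x)))"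
    using assms(1-3) by simp
  also have "\<dots> = ?r" unfolding e using assms(1-3) by simp
  finally show ?thesis .
qed

lemma coact_coassoc' [simp]:
  assumes "comod V" "x \<in> carrier V" "module K M"
    and f: "\<And>a b. a \<in> carrier A \<Longrightarrow> b \<in> carrier B \<Longrightarrow> trilinear_map V H H M (f a b)"
  shows "tsum V H M (\<lambda>v h. tsum A B M (\<lambda>a b. tsum V H M (\<lambda>u g. f a b u g h) (coact V v)) y) (coact V x) =
    tsum V H M (\<lambda>u t. tsum A B M (\<lambda>a b. tsum H H M (\<lambda>g h. f a b u g h) (\<Delta> t)) y) (coact V x)"
  by (subst (2 4) tsum_swap) (use assms(1-3) f trilinear_map_closed[OF f] in simp_all)

text \<open>The sum in between runs over \<open>y h\<close>, which depends on the outer term. It takes the place of the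
  primed rule where the two would compete.\<close>

lemma coact_coassoc_dependent:
  assumes "comod V" "x \<in> carrier V" "module K M"
    and cl: "\<And>a b u g h. a \<in> carrier A \<Longrightarrow> b \<in> carrier B \<Longrightarrow> u \<in> carrier V \<Longrightarrow> g \<in> carrier H \<Longrightarrow> h \<in> carrier H \<Longrightarrow>
      f a b u g h \<in> carrier M"
    and "trilinear_map V H H M (\<lambda>u g h. tsum A B M (\<lambda>a b. f a b u g h) (y h))"
  shows "tsum V H M (\<lambda>v h. tsum A B M (\<lambda>a b. tsum V H M (\<lambda>u g. f a b u g h) (coact V v)) (y h)) (coact V x) =
    tsum V H M (\<lambda>u t. tsum H H M (\<lambda>g h. tsum A B M (\<lambda>a b. f a b u g h) (y h)) (\<Delta> t)) (coact V x)"
  by (rule HOL.trans[OF tsum_swap_inner coact_coassoc]) (use assms cl in auto)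

lemma coact_counit [simp]:
  assumes "comod V" "x \<in> carrier V" "module K M" "linear_map K V M (\<lambda>u. f u)"
  shows "tsum V H M (\<lambda>u h. \<epsilon> h \<odot>\<^bsub>M\<^esub> f u) (coact V x) = f x"
    and "a \<in> carrier K \<Longrightarrow> tsum V H M (\<lambda>u h. a \<odot>\<^bsub>M\<^esub> (\<epsilon> h \<odot>\<^bsub>M\<^esub> f u)) (coact V x) = a \<odot>\<^bsub>M\<^esub> f x"
proof -
  have f: "f u \<in> carrier M" if "u \<in> carrier V" for u using that linear_map_closed[OF assms(4)] by simp
  have "tsum V H V (\<lambda>u h. \<epsilon> h \<odot>\<^bsub>V\<^esub> u) (coact V x) = x"
    using comodD(4)[OF assms(1,2)] assms(1,2) by (simp add: tsum_eq_lin_ext)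
  then have "f x = f (tsum V H V (\<lambda>u h. \<epsilon> h \<odot>\<^bsub>V\<^esub> u) (coact V x))" by simp
  also have "\<dots> = tsum V H M (\<lambda>u h. \<epsilon> h \<odot>\<^bsub>M\<^esub> f u) (coact V x)"
    by (subst linear_tsum[OF assms(4)]) (use assms linear_map_smult[OF assms(4)] in simp_all)
  finally show "tsum V H M (\<lambda>u h. \<epsilon> h \<odot>\<^bsub>M\<^esub> f u) (coact V x) = f x" by simp
  then show "a \<in> carrier K \<Longrightarrow> tsum V H M (\<lambda>u h. a \<odot>\<^bsub>M\<^esub> (\<epsilon> h \<odot>\<^bsub>M\<^esub> f u)) (coact V x) = a \<odot>\<^bsub>M\<^esub> f x"
    using scale_tsum[OF assms(3), of a V H "\<lambda>u h. \<epsilon> h \<odot>\<^bsub>M\<^esub> f u" "coact V x"] f assms by simp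
qed

lemma coact_scale [simp]:
  "comod V \<Longrightarrow> a \<in> carrier K \<Longrightarrow> v \<in> carrier V \<Longrightarrow> coact V (a \<odot>\<^bsub>V\<^esub> v) = a \<odot>\<^bsub>tensor K V H\<^esub> coact V v"
  by (rule linear_map_smult[OF coact_linear0])

lemma right_comoduleI:
  assumes "module K V" "linear_map K V (tensor K V H) (coact V)"
    and coassoc: "\<And>v. v \<in> carrier V \<Longrightarrow>
      tsum V H (tensor K V (tensor K H H))
          (\<lambda>v h. tsum V H (tensor K V (tensor K H H)) (\<lambda>u g. pure K V (tensor K H H) u (pure K H H g h)) (coact V v)) (coact V v) =
      tsum V H (tensor K V (tensor K H H))
          (\<lambda>u t. tsum H H (tensor K V (tensor K H H)) (\<lambda>g h. pure K V (tensor K H H) u (pure K H H g h)) (\<Delta> t)) (coact V v)"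
    and counit: "\<And>v. v \<in> carrier V \<Longrightarrow> tsum V H V (\<lambda>u h. \<epsilon> h \<odot>\<^bsub>V\<^esub> u) (coact V v) = v"
  shows "comod V"
  unfolding right_comodule_def
proof (intro conjI ballI)
  fix v assume v: "v \<in> carrier V"
  then have cv: "coact V v \<in> carrier (tensor K V H)" using linear_map_closed[OF assms(2)] by simp
  have cl: "coact V v \<in> carrier (tensor K V H)" if "v \<in> carrier V" for v
    using linear_map_closed[OF assms(2)] that by simp
  have "tsum H H (tensor K V (tensor K H H)) (\<lambda>g h. pure K V (tensor K H H) u (pure K H H g h)) (\<Delta> t) =
      pure K V (tensor K H H) u (\<Delta> t)" if "u \<in> carrier V" "t \<in> carrier H" for u t
    using pure_tsum(2)[of V "tensor K H H" H H "pure K H H" u "\<Delta> t"] that assms(1) by simp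
  then show "tensor_assoc K V H H (tensor_map K (tensor K V H) H (coact V) (\<lambda>h. h) (coact V v)) =
          tensor_map K V (tensor K H H) (\<lambda>u. u) \<Delta> (coact V v)"
    using assms(1) v cv cl coassoc[OF v] linear_map_compose[OF assms(2), of V]
    by (simp add: tensor_map_tsum[where V'=V and W'=H] tensor_assoc_tsum)
  show "lin_ext V (\<lambda>u h. \<epsilon> h \<odot>\<^bsub>V\<^esub> u) (coact V v) = v"
    using counit[OF v] assms(1) cv by (simp add: tsum_eq_lin_ext)
qed (fact assms)+

definition colinear where
  "colinear V W f \<longleftrightarrow> linear_map K V W f \<and>
    (\<forall>v\<in>carrier V. coact W (f v) = tsum V H (tensor K W H) (\<lambda>u h. pure K W H (f u) h) (coact V v))"

lemma Comod_simps [simp]: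
  "Ob (Comod K H \<Delta> \<epsilon>) = {V. comod V}"
  "Hom (Comod K H \<Delta> \<epsilon>) = comodule_Hom K H"
  "Ident (Comod K H \<Delta> \<epsilon>) = (\<lambda>V. \<lambda>v\<in>carrier V. v)"
  "Comp (Comod K H \<Delta> \<epsilon>) = (\<lambda>U V W g f. compose (carrier U) g f)"
  "TensO (Comod K H \<Delta> \<epsilon>) = comodule_tensor K H"
  "UnitO (Comod K H \<Delta> \<epsilon>) = unit_comodule K H"
  by (simp_all add: Comod_def)

lemma arrows_iff:
  assumes "comod V"
  shows "f \<in> carrier (comodule_Hom K H V W) \<longleftrightarrow> f \<in> extensional (carrier V) \<and> colinear V W f"
proof -
  have "tensor_map K W H f (\<lambda>h. h) (coact V v) = tsum V H (tensor K W H) (\<lambda>u h. pure K W H (f u) h) (coact V v)"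
    if "v \<in> carrier V" for v
    using assms that by (simp add: tensor_map_tsum[where V'=V and W'=H])
  then show ?thesis by (auto simp: comodule_Hom_def colinear_def PiE_iff linear_map_def)
qed

lemma colinear_linear: "colinear V W f \<Longrightarrow> linear_map K V W f"
  by (simp add: colinear_def)

lemma tsum_colinear:
  assumes "colinear V W f" "module K V" "module K W" "module K M" "bilinear_map W H M F" "v \<in> carrier V"
  shows "tsum W H M F (coact W (f v)) = tsum V H M (\<lambda>u h. F (f u) h) (coact V v)"
proof -
  have f: "linear_map K V W f" "\<And>u. u \<in> carrier V \<Longrightarrow> f u \<in> carrier W"
    using assms(1) linear_map_closed by (auto simp: colinear_def)
  have "coact W (f v) = tsum V H (tensor K W H) (\<lambda>u h. pure K W H (f u) h) (coact V v)"
    using assms by (simp add: colinear_def)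
  then show ?thesis using assms f by simp
qed

lemma colinear_cong:
  assumes "comod V" "\<And>v. v \<in> carrier V \<Longrightarrow> f v = g v"
  shows "colinear V W f \<longleftrightarrow> colinear V W g"
proof -
  have "linear_map K V W f \<longleftrightarrow> linear_map K V W g"
    using assms by (intro linear_map_cong') auto
  moreover have "(coact W (f v) = tsum V H (tensor K W H) (\<lambda>u h. pure K W H (f u) h) (coact V v)) \<longleftrightarrow>
    (coact W (g v) = tsum V H (tensor K W H) (\<lambda>u h. pure K W H (g u) h) (coact V v))" if "v \<in> carrier V" for v
    using assms(2) that by (simp cong: tsum_cong)
  ultimately show ?thesis unfolding colinear_def by blast
qed

lemma restrict_arrow:
  assumes "comod V" "colinear V W f" "A = carrier V"
  shows "restrict f A \<in> carrier (comodule_Hom K H V W)"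
proof -
  have "colinear V W (restrict f A)"
    using assms colinear_cong[of V "restrict f A" f W] by simp
  then show ?thesis using assms by (simp add: arrows_iff)
qed

lemma colinear_id: "comod V \<Longrightarrow> colinear V V (\<lambda>v. v)"
  by (simp add: colinear_def)

lemma colinear_compose:
  assumes "comod U" "comod V" "comod W" "colinear V W g" "colinear U V f"
  shows "colinear U W (\<lambda>u. g (f u))"
  unfolding colinear_def
proof (intro conjI ballI)
  note f = colinear_linear[OF assms(5)] and g = colinear_linear[OF assms(4)]
  note [simp] = linear_map_compose[OF f] linear_map_compose[OF g]
  show "linear_map K U W (\<lambda>u. g (f u))" using linear_map_compose[OF g f] .
  fix u assume u: "u \<in> carrier U"
  then have fu: "f u \<in> carrier V" using linear_map_closed[OF f] by simp
  have "coact W (g (f u)) = tsum V H (tensor K W H) (\<lambda>v h. pure K W H (g v) h) (coact V (f u))"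
    using assms(4) fu by (simp add: colinear_def)
  also have "\<dots> = tsum U H (tensor K W H) (\<lambda>v h. pure K W H (g (f v)) h) (coact U u)"
    by (rule tsum_colinear[OF assms(5)])
      (use assms u linear_map_closed[OF g] in simp_all)
  finally show "coact W (g (f u)) = tsum U H (tensor K W H) (\<lambda>v h. pure K W H (g (f v)) h) (coact U u)" .
qed

lemma compose_arrow:
  assumes "comod U" "comod V" "comod W" "g \<in> carrier (comodule_Hom K H V W)" "f \<in> carrier (comodule_Hom K H U V)"
  shows "compose (carrier U) g f \<in> carrier (comodule_Hom K H U W)"
  using restrict_arrow[OF assms(1) colinear_compose[OF assms(1,2,3)] HOL.refl] assms
  by (simp add: arrows_iff compose_def)

text \<open>The inverse of a bijective colinear map is automatically linear and colinear.\<close>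

lemma is_iso_ComodI:
  assumes V: "comod V" and W: "comod W" and f: "colinear V W f" "A = carrier V"
    and g: "\<And>w. w \<in> carrier W \<Longrightarrow> g w \<in> carrier V"
      "\<And>v. v \<in> carrier V \<Longrightarrow> g (f v) = v" "\<And>w. w \<in> carrier W \<Longrightarrow> f (g w) = w"
  shows "is_iso (Comod K H \<Delta> \<epsilon>) V W (restrict f A)"
proof -
  note lf = colinear_linear[OF f(1)]
  note [simp] = V W g linear_map_closed[OF lf]
  have glin: "linear_map K W V g"
  proof (rule linear_mapI)
    fix x y assume [simp]: "x \<in> carrier W" "y \<in> carrier W"
    have "g (x \<oplus>\<^bsub>W\<^esub> y) = g (f (g x) \<oplus>\<^bsub>W\<^esub> f (g y))" by simp
    also have "\<dots> = g (f (g x \<oplus>\<^bsub>V\<^esub> g y))" by (simp del: g add: linear_map_add[OF lf] g(1))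
    finally show "g (x \<oplus>\<^bsub>W\<^esub> y) = g x \<oplus>\<^bsub>V\<^esub> g y" by simp
  next
    fix a x assume [simp]: "a \<in> carrier K" "x \<in> carrier W"
    have "g (a \<odot>\<^bsub>W\<^esub> x) = g (a \<odot>\<^bsub>W\<^esub> f (g x))" by simp
    also have "\<dots> = g (f (a \<odot>\<^bsub>V\<^esub> g x))" by (simp del: g add: linear_map_smult[OF lf] g(1))
    finally show "g (a \<odot>\<^bsub>W\<^esub> x) = a \<odot>\<^bsub>V\<^esub> g x" by simp
  qed simp
  have "colinear W V g"
    unfolding colinear_def
  proof (intro conjI ballI)
    fix w assume [simp]: "w \<in> carrier W"
    have "coact V (g w) = tsum V H (tensor K V H) (\<lambda>u h. pure K V H (g (f u)) h) (coact V (g w))"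
      by (simp cong: tsum_cong)
    also have "\<dots> = tsum W H (tensor K V H) (\<lambda>u h. pure K V H (g u) h) (coact W (f (g w)))"
      by (rule tsum_colinear[OF f(1), symmetric]) (simp_all add: linear_map_compose[OF glin])
    finally show "coact V (g w) = tsum W H (tensor K V H) (\<lambda>u h. pure K V H (g u) h) (coact W w)" by simp
  qed (rule glin)
  then have "restrict g (carrier W) \<in> carrier (comodule_Hom K H W V)"
    by (intro restrict_arrow) simp_all
  moreover have "restrict f A \<in> carrier (comodule_Hom K H V W)"
    using f by (intro restrict_arrow) simp_all
  moreover have "compose (carrier V) (restrict g (carrier W)) (restrict f A) = (\<lambda>v\<in>carrier V. v)"
    "compose (carrier W) (restrict f A) (restrict g (carrier W)) = (\<lambda>w\<in>carrier W. w)"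
    using f by (auto simp: compose_def intro!: restrict_ext)
  ultimately show ?thesis unfolding is_iso_def by auto
qed

end

subsection \<open>Spaces of colinear maps\<close>

context bialgebra_maps
begin

lemma colinear_add:
  assumes "comod V" "comod W" "colinear V W f" "colinear V W g"
  shows "colinear V W (\<lambda>v. f v \<oplus>\<^bsub>W\<^esub> g v)"
  unfolding colinear_def
proof (intro conjI ballI)
  note f = colinear_linear[OF assms(3)] and g = colinear_linear[OF assms(4)]
  note [simp] = assms(1,2) linear_map_closed[OF f] linear_map_closed[OF g]
  show "linear_map K V W (\<lambda>v. f v \<oplus>\<^bsub>W\<^esub> g v)"
    by (rule linear_mapI)
      (simp_all add: linear_map_add[OF f] linear_map_add[OF g] linear_map_smult[OF f] linear_map_smult[OF g]
        module_add_ac[OF comod_module[OF assms(2)]] module_smult)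
  fix v assume [simp]: "v \<in> carrier V"
  have "coact W (f v \<oplus>\<^bsub>W\<^esub> g v) = coact W (f v) \<oplus>\<^bsub>tensor K W H\<^esub> coact W (g v)"
    by (simp add: linear_map_add[OF coact_linear0])
  also have "\<dots> = tsum V H (tensor K W H) (\<lambda>u h. pure K W H (f u) h) (coact V v) \<oplus>\<^bsub>tensor K W H\<^esub>
      tsum V H (tensor K W H) (\<lambda>u h. pure K W H (g u) h) (coact V v)"
    using assms by (simp add: colinear_def)
  also have "\<dots> = tsum V H (tensor K W H) (\<lambda>u h. pure K W H (f u) h \<oplus>\<^bsub>tensor K W H\<^esub> pure K W H (g u) h) (coact V v)"
    by (rule tsum_add[symmetric]) simp_all
  also have "\<dots> = tsum V H (tensor K W H) (\<lambda>u h. pure K W H (f u \<oplus>\<^bsub>W\<^esub> g u) h) (coact V v)"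
    by (rule tsum_cong) (simp_all add: linear_map_add[OF linear_map_pure(1)[OF _ _ linear_map_id]])
  finally show "coact W (f v \<oplus>\<^bsub>W\<^esub> g v) = tsum V H (tensor K W H) (\<lambda>u h. pure K W H (f u \<oplus>\<^bsub>W\<^esub> g u) h) (coact V v)" .
qed

lemma colinear_scale:
  assumes "comod V" "comod W" "colinear V W f" "a \<in> carrier K"
  shows "colinear V W (\<lambda>v. a \<odot>\<^bsub>W\<^esub> f v)"
proof -
  note f = colinear_linear[OF assms(3)]
  note [simp] = assms(1,2,4) linear_map_closed[OF f] linear_map_compose[OF f]
  have "coact W (a \<odot>\<^bsub>W\<^esub> f v) = tsum V H (tensor K W H) (\<lambda>u h. pure K W H (a \<odot>\<^bsub>W\<^esub> f u) h) (coact V v)"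
    if [simp]: "v \<in> carrier V" for v
  proof -
    have "coact W (a \<odot>\<^bsub>W\<^esub> f v) = a \<odot>\<^bsub>tensor K W H\<^esub> coact W (f v)"
      by (simp add: linear_map_smult[OF coact_linear0])
    then show ?thesis using assms(3) by (simp add: colinear_def)
  qed
  then show ?thesis by (simp add: colinear_def)
qed

lemma colinear_zero:
  assumes "comod V" "comod W"
  shows "colinear V W (\<lambda>v. \<zero>\<^bsub>W\<^esub>)"
proof -
  have "linear_map K V W (\<lambda>v. \<zero>\<^bsub>W\<^esub>)" by (rule linear_mapI) (use assms in auto)
  moreover have "pure K W H \<zero>\<^bsub>W\<^esub> h = \<zero>\<^bsub>tensor K W H\<^esub>" if "h \<in> carrier H" for h
    using linear_map_zero[OF linear_map_pure(1)[OF _ _ linear_map_id that], of W] assms by simp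
  ultimately show ?thesis
    using assms linear_map_zero[OF coact_linear0] by (simp add: colinear_def cong: tsum_cong)
qed

lemma comodule_Hom_simps [simp]:
  "add (comodule_Hom K H V W) = (\<lambda>f g. \<lambda>v\<in>carrier V. f v \<oplus>\<^bsub>W\<^esub> g v)"
  "zero (comodule_Hom K H V W) = (\<lambda>v\<in>carrier V. \<zero>\<^bsub>W\<^esub>)"
  "smult (comodule_Hom K H V W) = (\<lambda>a f. \<lambda>v\<in>carrier V. a \<odot>\<^bsub>W\<^esub> f v)"
  by (simp_all add: comodule_Hom_def)

lemma arrow_closed: "f \<in> carrier (comodule_Hom K H V W) \<Longrightarrow> v \<in> carrier V \<Longrightarrow> f v \<in> carrier W"
  by (auto simp: comodule_Hom_def)

lemma arrow_colinear: "comod V \<Longrightarrow> f \<in> carrier (comodule_Hom K H V W) \<Longrightarrow> colinear V W f"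
  and arrow_extensional: "comod V \<Longrightarrow> f \<in> carrier (comodule_Hom K H V W) \<Longrightarrow> f \<in> extensional (carrier V)"
  by (simp_all add: arrows_iff)

lemma module_comodule_Hom:
  assumes V [simp]: "comod V" and W [simp]: "comod W"
  shows "module K (comodule_Hom K H V W)"
proof (rule moduleI', goal_cases)
  case 1
  show ?case by (simp add: restrict_arrow[OF V _ HOL.refl] colinear_zero)
next
  case (2 f g)
  then show ?case by (simp add: restrict_arrow[OF V _ HOL.refl] arrow_colinear colinear_add)
next
  case (3 a f)
  then show ?case by (simp add: restrict_arrow[OF V _ HOL.refl] arrow_colinear colinear_scale)
next
  case (5 f g)
  then show ?case
    using module_add_ac(2)[OF comod_module[OF W]] by (auto simp: arrow_closed intro!: restrict_ext)
next
  case (6 f)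
  then show ?case
    using arrow_extensional[OF V] by (auto simp: arrow_closed intro!: extensionalityI[of _ "carrier V"])
next
  case (7 f)
  then show ?case
    using arrow_extensional[OF V] by (auto simp: arrow_closed intro!: extensionalityI[of _ "carrier V"])
qed (auto simp: arrow_closed module_smult(1,2)[OF comod_module[OF W]] module_add_ac(1)[OF comod_module[OF W]]
    intro!: restrict_ext)

end

subsection \<open>Tensor products of comodules\<close>

text \<open>A name for the coaction of a tensor product, which gives comodules the form \<open>with_coact M \<alpha>\<close>
  that the rules for forgetting coactions expect.\<close>

definition codiagonal where "codiagonal K H V W = coact (comodule_tensor K H V W)"

lemma comodule_tensor_eq [simp]: "comodule_tensor K H V W = with_coact (tensor K V W) (codiagonal K H V W)"
  by (simp add: codiagonal_def comodule_tensor_def with_coact_def Let_def)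

lemma unit_comodule_eq [simp]: "unit_comodule K H = with_coact (unit_space K) (\<lambda>x. pure K (unit_space K) H x \<one>\<^bsub>H\<^esub>)"
  by (simp add: unit_comodule_def)

context base_field
begin

lemma unit_space_simps:
  "carrier (unit_space K) = Scal ` carrier K"
  "zero (unit_space K) = Scal \<zero>"
  "add (unit_space K) = (\<lambda>x y. Scal (scal x \<oplus> scal y))"
  "smult (unit_space K) = (\<lambda>a x. Scal (a \<otimes> scal x))"
  by (simp_all add: unit_space_def)

lemma module_unit_space [simp]: "module K (unit_space K)"
  by (rule moduleI') (auto simp: unit_space_simps a_ac m_ac l_distr r_distr)

lemma scal_closed [simp]: "x \<in> carrier (unit_space K) \<Longrightarrow> scal x \<in> carrier K"
  and Scal_closed [simp]: "a \<in> carrier K \<Longrightarrow> Scal a \<in> carrier (unit_space K)"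
  by (auto simp: unit_space_simps)

lemma linear_map_scal0: "linear_map K (unit_space K) (ground_algebra K) scal"
  by (rule linear_mapI) (auto simp: unit_space_simps)

lemma linear_map_scal [simp]:
  "linear_map K U (unit_space K) (\<lambda>u. f u) \<Longrightarrow> linear_map K U (ground_algebra K) (\<lambda>u. scal (f u))"
  using linear_map_compose[OF linear_map_scal0] .

lemma pure_scal:
  assumes "module K V"
  shows "c \<in> carrier (unit_space K) \<Longrightarrow> v \<in> carrier V \<Longrightarrow>
      scal c \<odot>\<^bsub>tensor K (unit_space K) V\<^esub> pure K (unit_space K) V (Scal \<one>) v = pure K (unit_space K) V c v"
    and "c \<in> carrier (unit_space K) \<Longrightarrow> v \<in> carrier V \<Longrightarrow>
      scal c \<odot>\<^bsub>tensor K V (unit_space K)\<^esub> pure K V (unit_space K) v (Scal \<one>) = pure K V (unit_space K) v c"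
proof -
  assume c: "c \<in> carrier (unit_space K)" and v: "v \<in> carrier V"
  then have "c = scal c \<odot>\<^bsub>unit_space K\<^esub> Scal \<one>" by (auto simp: unit_space_simps)
  then show "scal c \<odot>\<^bsub>tensor K (unit_space K) V\<^esub> pure K (unit_space K) V (Scal \<one>) v = pure K (unit_space K) V c v"
    "scal c \<odot>\<^bsub>tensor K V (unit_space K)\<^esub> pure K V (unit_space K) v (Scal \<one>) = pure K V (unit_space K) v c"
    using c v assms pure_scale[of "unit_space K" V "scal c" "Scal \<one>" v] pure_scale[of V "unit_space K" "scal c" v "Scal \<one>"]
    by simp_all
qed

end

context bialgebra_maps
begin

lemma codiagonal_tsum [simp]:
  assumes "comod V" "comod W" "x \<in> carrier (tensor K V W)"
  shows "codiagonal K H V W x =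
    tsum V W (tensor K (tensor K V W) H) (\<lambda>v w.
      tsum V H (tensor K (tensor K V W) H) (\<lambda>v\<^sub>0 v\<^sub>1.
        tsum W H (tensor K (tensor K V W) H) (\<lambda>w\<^sub>0 w\<^sub>1.
          pure K (tensor K V W) H (pure K V W v\<^sub>0 w\<^sub>0) (v\<^sub>1 \<otimes>\<^bsub>H\<^esub> w\<^sub>1)) (coact W w)) (coact V v)) x"
  using assms by (simp add: codiagonal_def comodule_tensor_def Let_def tsum_eq_lin_ext del: comodule_tensor_eq cong: tsum_cong)

lemma comod_tensor:
  assumes "comod V" "comod W"
  shows "comod (with_coact (tensor K V W) (codiagonal K H V W))"
proof (rule right_comoduleI, unfold forget_coact with_coact_simps)
  show "linear_map K (tensor K V W) (tensor K (tensor K V W) H) (codiagonal K H V W)"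
    using assms by (subst linear_map_cong'[OF _ codiagonal_tsum]) simp_all
qed (use assms in simp_all)

text \<open>The side condition lets the simplifier recognise iterated tensor products, in which the
  inner coactions have been forgotten in the underlying space.\<close>

lemma comod_tensor' [simp]:
  "comod V \<Longrightarrow> comod W \<Longrightarrow> T = tensor K V W \<Longrightarrow> comod (with_coact T (codiagonal K H V W))"
  using comod_tensor by simp

lemma comod_unit [simp]: "comod (with_coact (unit_space K) (\<lambda>x. pure K (unit_space K) H x \<one>\<^bsub>H\<^esub>))"
  by (rule right_comoduleI, unfold forget_coact with_coact_simps) simp_all

lemma TensM_Comod:
  assumes "module K V" "module K W"
  shows "TensM (Comod K H \<Delta> \<epsilon>) V V' W W' f g =
    (\<lambda>x\<in>carrier (tensor K V W). tsum V W (tensor K V' W') (\<lambda>v w. pure K V' W' (f v) (g w)) x)"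
  using assms by (auto simp: Comod_def tensor_map_tsum intro!: restrict_ext)

lemma AssocM_Comod:
  assumes "module K U" "module K V" "module K W"
  shows "AssocM (Comod K H \<Delta> \<epsilon>) U V W = (\<lambda>x\<in>carrier (tensor K (tensor K U V) W).
    tsum (tensor K U V) W (tensor K U (tensor K V W))
      (\<lambda>t w. tsum U V (tensor K U (tensor K V W)) (\<lambda>u v. pure K U (tensor K V W) u (pure K V W v w)) t) x)"
  using assms by (auto simp: Comod_def tensor_assoc_tsum intro!: restrict_ext)

lemma LUnitM_Comod:
  assumes "module K V"
  shows "LUnitM (Comod K H \<Delta> \<epsilon>) V =
    (\<lambda>x\<in>carrier (tensor K (unit_space K) V). tsum (unit_space K) V V (\<lambda>c v. scal c \<odot>\<^bsub>V\<^esub> v) x)"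
  using assms by (auto simp: Comod_def tsum_eq_lin_ext intro!: restrict_ext)

lemma RUnitM_Comod:
  assumes "module K V"
  shows "RUnitM (Comod K H \<Delta> \<epsilon>) V =
    (\<lambda>x\<in>carrier (tensor K V (unit_space K)). tsum V (unit_space K) V (\<lambda>v c. scal c \<odot>\<^bsub>V\<^esub> v) x)"
  using assms by (auto simp: Comod_def tsum_eq_lin_ext intro!: restrict_ext)

lemma colinear_tensor:
  assumes [simp]: "comod V" "comod V'" "comod W" "comod W'" and f: "colinear V V' f" and g: "colinear W W' g"
  shows "colinear (comodule_tensor K H V W) (comodule_tensor K H V' W')
    (\<lambda>x. tsum V W (tensor K V' W') (\<lambda>v w. pure K V' W' (f v) (g w)) x)"
proof -
  note lf = colinear_linear[OF f] and lg = colinear_linear[OF g]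
  note [simp] = linear_map_closed[OF lf] linear_map_compose[OF lf] tsum_colinear[OF f]
    linear_map_closed[OF lg] linear_map_compose[OF lg] tsum_colinear[OF g]
  show ?thesis unfolding colinear_def by simp
qed

lemma colinear_assoc:
  assumes [simp]: "comod U" "comod V" "comod W"
  shows "colinear (comodule_tensor K H (comodule_tensor K H U V) W) (comodule_tensor K H U (comodule_tensor K H V W))
    (\<lambda>x. tsum (tensor K U V) W (tensor K U (tensor K V W))
      (\<lambda>t w. tsum U V (tensor K U (tensor K V W)) (\<lambda>u v. pure K U (tensor K V W) u (pure K V W v w)) t) x)"
  unfolding colinear_def by (simp add: algebra_mult_assoc)

lemma scale_coact:
  assumes "comod V" "a \<in> carrier K" "v \<in> carrier V"
  shows "tsum V H (tensor K V H) (\<lambda>u h. a \<odot>\<^bsub>tensor K V H\<^esub> pure K V H u h) (coact V v) = a \<odot>\<^bsub>tensor K V H\<^esub> coact V v"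
  using scale_tsum[of "tensor K V H" a V H "pure K V H" "coact V v"] assms by simp

lemma colinear_lunit:
  assumes [simp]: "comod V"
  shows "colinear (comodule_tensor K H (unit_comodule K H) V) V (\<lambda>x. tsum (unit_space K) V V (\<lambda>c v. scal c \<odot>\<^bsub>V\<^esub> v) x)"
  unfolding colinear_def by (simp add: scale_coact)

lemma colinear_runit:
  assumes [simp]: "comod V"
  shows "colinear (comodule_tensor K H V (unit_comodule K H)) V (\<lambda>x. tsum V (unit_space K) V (\<lambda>v c. scal c \<odot>\<^bsub>V\<^esub> v) x)"
  unfolding colinear_def by (simp add: scale_coact)

lemma compose_linear_left:
  assumes [simp]: "comod U" "comod V" "comod W" and f: "f \<in> carrier (comodule_Hom K H U V)"
  shows "linear_map K (comodule_Hom K H V W) (comodule_Hom K H U W) (\<lambda>g. compose (carrier U) g f)"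
proof (rule linear_mapI)
  fix g assume "g \<in> carrier (comodule_Hom K H V W)"
  then show "compose (carrier U) g f \<in> carrier (comodule_Hom K H U W)"
    using f by (intro compose_arrow[of U V W]) simp_all
qed (use arrow_closed[OF f] in \<open>auto simp: compose_def intro!: restrict_ext\<close>)

lemma compose_linear_right:
  assumes [simp]: "comod U" "comod V" "comod W" and g: "g \<in> carrier (comodule_Hom K H V W)"
  shows "linear_map K (comodule_Hom K H U V) (comodule_Hom K H U W) (\<lambda>f. compose (carrier U) g f)"
proof (rule linear_mapI)
  note lg = colinear_linear[OF arrow_colinear[OF assms(2) g]]
  fix f assume f: "f \<in> carrier (comodule_Hom K H U V)"
  then show "compose (carrier U) g f \<in> carrier (comodule_Hom K H U W)"
    using g by (intro compose_arrow[of U V W]) simp_all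
  show "compose (carrier U) g (a \<odot>\<^bsub>comodule_Hom K H U V\<^esub> f) = a \<odot>\<^bsub>comodule_Hom K H U W\<^esub> compose (carrier U) g f"
    if "a \<in> carrier K" for a
    using that arrow_closed[OF f] linear_map_smult[OF lg] by (auto simp: compose_def intro!: restrict_ext)
  fix f' assume f': "f' \<in> carrier (comodule_Hom K H U V)"
  show "compose (carrier U) g (f \<oplus>\<^bsub>comodule_Hom K H U V\<^esub> f') =
      compose (carrier U) g f \<oplus>\<^bsub>comodule_Hom K H U W\<^esub> compose (carrier U) g f'"
    using arrow_closed[OF f] arrow_closed[OF f'] linear_map_add[OF lg] by (auto simp: compose_def intro!: restrict_ext)
qed

abbreviation "tensor_arrow V V' W W' f g \<equiv>
  \<lambda>x\<in>carrier (tensor K V W). tsum V W (tensor K V' W') (\<lambda>v w. pure K V' W' (f v) (g w)) x"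

lemma tensor_arrow:
  assumes "comod V" "comod V'" "comod W" "comod W'"
    and "f \<in> carrier (comodule_Hom K H V V')" "g \<in> carrier (comodule_Hom K H W W')"
  shows "tensor_arrow V V' W W' f g \<in> carrier (comodule_Hom K H (comodule_tensor K H V W) (comodule_tensor K H V' W'))"
  using assms by (intro restrict_arrow colinear_tensor) (simp_all add: arrow_colinear)

lemma tensor_arrow_linear_left:
  assumes [simp]: "comod V" "comod V'" "comod W" "comod W'" and g: "g \<in> carrier (comodule_Hom K H W W')"
  shows "linear_map K (comodule_Hom K H V V') (comodule_Hom K H (comodule_tensor K H V W) (comodule_tensor K H V' W'))
    (\<lambda>f. tensor_arrow V V' W W' f g)"
proof (rule linear_mapI)
  note lg = colinear_linear[OF arrow_colinear[OF assms(3) g]]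
  note [simp] = linear_map_closed[OF lg]
  fix f assume f: "f \<in> carrier (comodule_Hom K H V V')"
  note [simp] = arrow_closed[OF f]
  show "tensor_arrow V V' W W' f g \<in> carrier (comodule_Hom K H (comodule_tensor K H V W) (comodule_tensor K H V' W'))"
    using f g by (intro tensor_arrow) simp_all
  show "tensor_arrow V V' W W' (a \<odot>\<^bsub>comodule_Hom K H V V'\<^esub> f) g =
    a \<odot>\<^bsub>comodule_Hom K H (comodule_tensor K H V W) (comodule_tensor K H V' W')\<^esub> tensor_arrow V V' W W' f g"
    if "a \<in> carrier K" for a
    using that by (auto intro!: restrict_ext)
  fix f' assume f': "f' \<in> carrier (comodule_Hom K H V V')"
  note [simp] = arrow_closed[OF f']
  show "tensor_arrow V V' W W' (f \<oplus>\<^bsub>comodule_Hom K H V V'\<^esub> f') g =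
    tensor_arrow V V' W W' f g \<oplus>\<^bsub>comodule_Hom K H (comodule_tensor K H V W) (comodule_tensor K H V' W')\<^esub> tensor_arrow V V' W W' f' g"
    by (auto simp: tsum_add[symmetric] linear_map_add[OF linear_map_pure(1)[OF _ _ linear_map_id]] intro!: restrict_ext)
qed

lemma tensor_arrow_linear_right:
  assumes [simp]: "comod V" "comod V'" "comod W" "comod W'" and f: "f \<in> carrier (comodule_Hom K H V V')"
  shows "linear_map K (comodule_Hom K H W W') (comodule_Hom K H (comodule_tensor K H V W) (comodule_tensor K H V' W'))
    (\<lambda>g. tensor_arrow V V' W W' f g)"
proof (rule linear_mapI)
  note lf = colinear_linear[OF arrow_colinear[OF assms(1) f]]
  note [simp] = linear_map_closed[OF lf]
  fix g assume g: "g \<in> carrier (comodule_Hom K H W W')"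
  note [simp] = arrow_closed[OF g]
  show "tensor_arrow V V' W W' f g \<in> carrier (comodule_Hom K H (comodule_tensor K H V W) (comodule_tensor K H V' W'))"
    using f g by (intro tensor_arrow) simp_all
  show "tensor_arrow V V' W W' f (a \<odot>\<^bsub>comodule_Hom K H W W'\<^esub> g) =
    a \<odot>\<^bsub>comodule_Hom K H (comodule_tensor K H V W) (comodule_tensor K H V' W')\<^esub> tensor_arrow V V' W W' f g"
    if "a \<in> carrier K" for a
    using that by (auto intro!: restrict_ext)
  fix g' assume g': "g' \<in> carrier (comodule_Hom K H W W')"
  note [simp] = arrow_closed[OF g']
  show "tensor_arrow V V' W W' f (g \<oplus>\<^bsub>comodule_Hom K H W W'\<^esub> g') =
    tensor_arrow V V' W W' f g \<oplus>\<^bsub>comodule_Hom K H (comodule_tensor K H V W) (comodule_tensor K H V' W')\<^esub> tensor_arrow V V' W W' f g'"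
    by (auto simp: tsum_add[symmetric] linear_map_add[OF linear_map_pure(2)[OF _ _ linear_map_id]] intro!: restrict_ext)
qed

lemma assoc_iso:
  assumes [simp]: "comod U" "comod V" "comod W"
  shows "is_iso (Comod K H \<Delta> \<epsilon>) (comodule_tensor K H (comodule_tensor K H U V) W) (comodule_tensor K H U (comodule_tensor K H V W))
    (AssocM (Comod K H \<Delta> \<epsilon>) U V W)"
  unfolding AssocM_Comod[OF assms[THEN comod_module]]
  by (rule is_iso_ComodI[where g="\<lambda>y. tsum U (tensor K V W) (tensor K (tensor K U V) W)
      (\<lambda>u t. tsum V W (tensor K (tensor K U V) W) (\<lambda>v w. pure K (tensor K U V) W (pure K U V u v) w) t) y"])
    (rule colinear_assoc[OF assms] | simp add: collapse_pure)+

lemma lunit_iso: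
  assumes [simp]: "comod V"
  shows "is_iso (Comod K H \<Delta> \<epsilon>) (comodule_tensor K H (unit_comodule K H) V) V (LUnitM (Comod K H \<Delta> \<epsilon>) V)"
  unfolding LUnitM_Comod[OF assms[THEN comod_module]]
  by (rule is_iso_ComodI[where g="\<lambda>v. pure K (unit_space K) V (Scal \<one>) v"])
    (rule colinear_lunit[OF assms] | simp add: pure_scal)+

lemma runit_iso:
  assumes [simp]: "comod V"
  shows "is_iso (Comod K H \<Delta> \<epsilon>) (comodule_tensor K H V (unit_comodule K H)) V (RUnitM (Comod K H \<Delta> \<epsilon>) V)"
  unfolding RUnitM_Comod[OF assms[THEN comod_module]]
  by (rule is_iso_ComodI[where g="\<lambda>v. pure K V (unit_space K) v (Scal \<one>)"])
    (rule colinear_runit[OF assms] | simp add: pure_scal)+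

lemma linear_category_Comod: "linear_category K (Comod K H \<Delta> \<epsilon>)"
proof (rule linear_category.intro, unfold Comod_simps mem_Collect_eq, goal_cases)
  case (1 X Y)
  then show ?case by (rule module_comodule_Hom)
next
  case (2 X)
  then show ?case by (intro restrict_arrow colinear_id) simp_all
next
  case (3 X Y Z f)
  then show ?case by (rule compose_linear_left)
next
  case (4 X Y Z g)
  then show ?case by (rule compose_linear_right)
next
  case (5 X Y f)
  then show ?case
    using arrow_extensional[of X f Y] arrow_closed[of f X Y]
    by (auto simp: compose_def intro!: extensionalityI[of _ "carrier X"])
next
  case (6 X Y f)
  then show ?case
    using arrow_extensional[of X f Y] arrow_closed[of f X Y]
    by (auto simp: compose_def intro!: extensionalityI[of _ "carrier X"])
next
  case (7 W X Y Z f g h)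
  then show ?case using arrow_closed[of f W X] by (auto simp: compose_def intro!: restrict_ext)
qed

text \<open>Each coherence equation is an identity between multilinear expressions, which the
  simplifier checks on pure tensors.\<close>

lemma linear_monoidal_category_Comod: "linear_monoidal_category K (Comod K H \<Delta> \<epsilon>)"
proof (rule linear_monoidal_category.intro[OF linear_category_Comod linear_monoidal_category_axioms.intro],
    unfold Comod_simps mem_Collect_eq, goal_cases)
  case 1
  then show ?case by simp
next
  case (2 X Y)
  then show ?case by simp
next
  case (3 X X' Y Y' g)
  then show ?case using tensor_arrow_linear_left by (simp only: TensM_Comod comod_module)
next
  case (4 X X' Y Y' f)
  then show ?case using tensor_arrow_linear_right by (simp only: TensM_Comod comod_module)
next
  case (5 X Y)
  then show ?case by (auto simp: TensM_Comod intro!: restrict_ext)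
next
  case (6 X X' X'' Y Y' Y'' f f' g g')
  note [simp] = 6(1-6) 6(7-10)[THEN arrow_closed]
    6(8,10)[THEN arrow_colinear[rotated], THEN colinear_linear, THEN linear_map_compose]
  show ?case by (auto simp: TensM_Comod compose_def intro!: restrict_ext)
next
  case (7 X Y Z)
  then show ?case by (rule assoc_iso)
next
  case (8 X X' Y Y' Z Z' f g h)
  note [simp] = 8(1-6) 8(7-9)[THEN arrow_closed]
    8(7-9)[THEN arrow_colinear[rotated], THEN colinear_linear, THEN linear_map_compose]
  show ?case by (auto simp: TensM_Comod AssocM_Comod compose_def intro!: restrict_ext)
next
  case (9 X)
  then show ?case by (rule lunit_iso)
next
  case (10 X X' f)
  note [simp] = 10(1,2) arrow_closed[OF 10(3)]
  note lf = colinear_linear[OF arrow_colinear[OF 10(1,3)]]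
  note [simp] = linear_map_compose[OF lf] linear_tsum[OF lf] linear_map_smult[OF lf]
  show ?case by (auto simp: TensM_Comod LUnitM_Comod compose_def intro!: restrict_ext)
next
  case (11 X)
  then show ?case by (rule runit_iso)
next
  case (12 X X' f)
  note [simp] = 12(1,2) arrow_closed[OF 12(3)]
  note lf = colinear_linear[OF arrow_colinear[OF 12(1,3)]]
  note [simp] = linear_map_compose[OF lf] linear_tsum[OF lf] linear_map_smult[OF lf]
  show ?case by (auto simp: TensM_Comod RUnitM_Comod compose_def intro!: restrict_ext)
next
  case (13 W X Y Z)
  then show ?case by (auto simp: TensM_Comod AssocM_Comod compose_def intro!: restrict_ext)
next
  case (14 X Y)
  then show ?case
    by (auto simp: TensM_Comod AssocM_Comod LUnitM_Comod RUnitM_Comod compose_def intro!: restrict_ext)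
qed

end

section \<open>Linear functionals\<close>

context base_field
begin

lemma subspace_module:
  assumes "module K M" and ops: "\<zero>\<^bsub>U\<^esub> = \<zero>\<^bsub>M\<^esub>"
    "\<And>x y. x \<oplus>\<^bsub>U\<^esub> y = x \<oplus>\<^bsub>M\<^esub> y" "\<And>a x. a \<odot>\<^bsub>U\<^esub> x = a \<odot>\<^bsub>M\<^esub> x"
    and "\<And>x. x \<in> carrier U \<Longrightarrow> x \<in> carrier M" and "\<zero>\<^bsub>M\<^esub> \<in> carrier U"
    and "\<And>x y. x \<in> carrier U \<Longrightarrow> y \<in> carrier U \<Longrightarrow> x \<oplus>\<^bsub>M\<^esub> y \<in> carrier U"
    and "\<And>a x. a \<in> carrier K \<Longrightarrow> x \<in> carrier U \<Longrightarrow> a \<odot>\<^bsub>M\<^esub> x \<in> carrier U"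
  shows "module K U"
  by (rule moduleI'; use assms(5-8) in \<open>simp add: ops module_rules[OF assms(1)] module_add_ac[OF assms(1)]
      module_smult(1,2)[OF assms(1)] scale_scale[OF assms(1)]\<close>)

text \<open>By Zorn's lemma there is a maximal subspace \<open>U\<close> that avoids the given vector \<open>v\<close>. It is a
  complement of the line through \<open>v\<close>, and the coordinate along \<open>v\<close> is the functional.\<close>

lemma functional_exists:
  assumes "module K V" "v \<in> carrier V" "v \<noteq> \<zero>\<^bsub>V\<^esub>"
  shows "\<exists>\<phi>. linear_map K V (ground_algebra K) \<phi> \<and> \<phi> v = \<one>"
proof -
  interpret V: module K V by fact
  define subspaces where "subspaces = {S. S \<subseteq> carrier V \<and> \<zero>\<^bsub>V\<^esub> \<in> S \<and> v \<notin> S \<and>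
    (\<forall>x\<in>S. \<forall>y\<in>S. x \<oplus>\<^bsub>V\<^esub> y \<in> S) \<and> (\<forall>a\<in>carrier K. \<forall>x\<in>S. a \<odot>\<^bsub>V\<^esub> x \<in> S)}"
  have "\<exists>U\<in>subspaces. \<forall>S\<in>subspaces. U \<subseteq> S \<longrightarrow> S = U"
  proof (rule subset_Zorn_nonempty)
    have "{\<zero>\<^bsub>V\<^esub>} \<in> subspaces" using assms by (auto simp: subspaces_def)
    then show "subspaces \<noteq> {}" by blast
  next
    fix \<C> assume ne: "\<C> \<noteq> {}" and ch: "subset.chain subspaces \<C>"
    have sub: "S \<subseteq> carrier V" "\<zero>\<^bsub>V\<^esub> \<in> S" "v \<notin> S"
      "x \<in> S \<Longrightarrow> y \<in> S \<Longrightarrow> x \<oplus>\<^bsub>V\<^esub> y \<in> S" "a \<in> carrier K \<Longrightarrow> x \<in> S \<Longrightarrow> a \<odot>\<^bsub>V\<^esub> x \<in> S"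
      if "S \<in> \<C>" for S x y a
      using ch that unfolding subset.chain_def subspaces_def by blast+
    have dir: "S \<subseteq> S' \<or> S' \<subseteq> S" if "S \<in> \<C>" "S' \<in> \<C>" for S S'
      using ch that by (auto simp: subset.chain_def)
    show "\<Union>\<C> \<in> subspaces"
      unfolding subspaces_def
    proof (intro CollectI conjI ballI)
      fix x y assume "x \<in> \<Union>\<C>" "y \<in> \<Union>\<C>"
      then obtain S S' where "S \<in> \<C>" "S' \<in> \<C>" "x \<in> S" "y \<in> S'" by blast
      then have "\<exists>T\<in>\<C>. x \<in> T \<and> y \<in> T" using dir by blast
      then show "x \<oplus>\<^bsub>V\<^esub> y \<in> \<Union>\<C>" using sub(4) by blast
    next
      show "\<Union>\<C> \<subseteq> carrier V" "v \<notin> \<Union>\<C>" using sub(1,3) by blast+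
      show "\<zero>\<^bsub>V\<^esub> \<in> \<Union>\<C>" using ne sub(2) by blast
    next
      fix a x assume "a \<in> carrier K" "x \<in> \<Union>\<C>"
      then show "a \<odot>\<^bsub>V\<^esub> x \<in> \<Union>\<C>" using sub(5) by blast
    qed
  qed
  then obtain U where U: "U \<in> subspaces" and max: "\<And>S. S \<in> subspaces \<Longrightarrow> U \<subseteq> S \<Longrightarrow> S = U" by blast
  have sub: "U \<subseteq> carrier V" and z: "\<zero>\<^bsub>V\<^esub> \<in> U" and v: "v \<notin> U"
    and add: "\<And>x y. x \<in> U \<Longrightarrow> y \<in> U \<Longrightarrow> x \<oplus>\<^bsub>V\<^esub> y \<in> U"
    and scale: "\<And>a x. a \<in> carrier K \<Longrightarrow> x \<in> U \<Longrightarrow> a \<odot>\<^bsub>V\<^esub> x \<in> U"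
    using U by (auto simp: subspaces_def)
  have U_closed: "x \<in> carrier V" if "x \<in> U" for x using sub that by blast
  note [simp] = assms(2) U_closed[simp]
  note alg = V.smult_l_distr V.smult_r_distr V.smult_assoc1[symmetric] V.a_ac
  have ex: "\<exists>u\<in>U. \<exists>c\<in>carrier K. x = u \<oplus>\<^bsub>V\<^esub> c \<odot>\<^bsub>V\<^esub> v" if x [simp]: "x \<in> carrier V" for x
  proof (cases "x \<in> U")
    case True
    then show ?thesis by (intro bexI[of _ x] bexI[of _ \<zero>]) auto
  next
    case False
    define S where "S = {w \<oplus>\<^bsub>V\<^esub> a \<odot>\<^bsub>V\<^esub> x | w a. w \<in> U \<and> a \<in> carrier K}"
    have in_S: "w \<oplus>\<^bsub>V\<^esub> a \<odot>\<^bsub>V\<^esub> x \<in> S" if "w \<in> U" "a \<in> carrier K" for w a using that by (auto simp: S_def)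
    have US: "U \<subseteq> S" using in_S[of _ \<zero>] by auto
    have "x \<in> S" using in_S[OF z, of \<one>] by simp
    then have "S \<notin> subspaces" using False max US by blast
    moreover have "y \<oplus>\<^bsub>V\<^esub> y' \<in> S" if y: "y \<in> S" "y' \<in> S" for y y'
    proof -
      obtain w a w' a' where e: "y = w \<oplus>\<^bsub>V\<^esub> a \<odot>\<^bsub>V\<^esub> x" "y' = w' \<oplus>\<^bsub>V\<^esub> a' \<odot>\<^bsub>V\<^esub> x"
        "w \<in> U" "a \<in> carrier K" "w' \<in> U" "a' \<in> carrier K" using y by (auto simp: S_def)
      then have "y \<oplus>\<^bsub>V\<^esub> y' = (w \<oplus>\<^bsub>V\<^esub> w') \<oplus>\<^bsub>V\<^esub> (a \<oplus> a') \<odot>\<^bsub>V\<^esub> x" by (simp add: alg)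
      then show ?thesis using in_S add e by simp
    qed
    moreover have "b \<odot>\<^bsub>V\<^esub> y \<in> S" if y: "b \<in> carrier K" "y \<in> S" for b y
    proof -
      obtain w a where e: "y = w \<oplus>\<^bsub>V\<^esub> a \<odot>\<^bsub>V\<^esub> x" "w \<in> U" "a \<in> carrier K" using y by (auto simp: S_def)
      then have "b \<odot>\<^bsub>V\<^esub> y = b \<odot>\<^bsub>V\<^esub> w \<oplus>\<^bsub>V\<^esub> (b \<otimes> a) \<odot>\<^bsub>V\<^esub> x"
        using y by (simp add: V.smult_r_distr V.smult_assoc1)
      then show ?thesis using in_S scale e y by simp
    qed
    moreover have "S \<subseteq> carrier V" "\<zero>\<^bsub>V\<^esub> \<in> S" using US z by (auto simp: S_def)
    ultimately have "v \<in> S" by (auto simp: subspaces_def)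
    then obtain w a where w: "v = w \<oplus>\<^bsub>V\<^esub> a \<odot>\<^bsub>V\<^esub> x" "w \<in> U" "a \<in> carrier K" by (auto simp: S_def)
    have "a \<noteq> \<zero>" using w v by auto
    then have a: "inv a \<in> carrier K" "inv a \<otimes> a = \<one>" using w field_Units by auto
    have "(\<ominus> (inv a)) \<odot>\<^bsub>V\<^esub> w \<oplus>\<^bsub>V\<^esub> (inv a) \<odot>\<^bsub>V\<^esub> v = ((\<ominus> (inv a)) \<odot>\<^bsub>V\<^esub> w \<oplus>\<^bsub>V\<^esub> (inv a) \<odot>\<^bsub>V\<^esub> w) \<oplus>\<^bsub>V\<^esub> (inv a \<otimes> a) \<odot>\<^bsub>V\<^esub> x"
      using a(1) w by (simp add: V.smult_r_distr V.smult_assoc1 V.a_assoc del: scale_scale)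
    also have "\<dots> = x" using a w by (simp add: V.smult_l_minus V.l_neg)
    finally show ?thesis using scale[of "\<ominus> (inv a)" w] a w by (metis a_inv_closed)
  qed
  have unique: "c = c'" if [simp]: "c \<in> carrier K" "c' \<in> carrier K" and u: "u \<in> U" "u' \<in> U"
    and e: "u \<oplus>\<^bsub>V\<^esub> c \<odot>\<^bsub>V\<^esub> v = u' \<oplus>\<^bsub>V\<^esub> c' \<odot>\<^bsub>V\<^esub> v" for c c' u u'
  proof (rule ccontr)
    assume "c \<noteq> c'"
    moreover have "c = (c \<ominus> c') \<oplus> c'" by (simp add: a_minus_def a_assoc l_neg)
    ultimately have ne: "c \<ominus> c' \<noteq> \<zero>" by auto
    note [simp] = u
    have "(c \<ominus> c') \<odot>\<^bsub>V\<^esub> v = (\<ominus>\<^bsub>V\<^esub> u) \<oplus>\<^bsub>V\<^esub> (u \<oplus>\<^bsub>V\<^esub> c \<odot>\<^bsub>V\<^esub> v) \<oplus>\<^bsub>V\<^esub> (\<ominus>\<^bsub>V\<^esub> (c' \<odot>\<^bsub>V\<^esub> v))"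
      by (simp add: a_minus_def V.smult_l_distr V.smult_l_minus V.r_neg2 V.r_neg1 V.a_assoc[symmetric] V.l_neg)
    also have "\<dots> = u' \<oplus>\<^bsub>V\<^esub> (\<ominus> \<one>) \<odot>\<^bsub>V\<^esub> u"
      unfolding e by (simp add: V.smult_l_minus V.a_ac V.r_neg V.r_neg2 V.r_neg1)
    finally have "(c \<ominus> c') \<odot>\<^bsub>V\<^esub> v \<in> U" using add scale by simp
    then have "(inv (c \<ominus> c')) \<odot>\<^bsub>V\<^esub> ((c \<ominus> c') \<odot>\<^bsub>V\<^esub> v) \<in> U" using ne scale[of "inv (c \<ominus> c')" "(c \<ominus> c') \<odot>\<^bsub>V\<^esub> v"] by (simp add: field_Units)
    then show False using ne v by (simp add: V.smult_assoc1[symmetric] field_Units del: scale_scale)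
  qed
  define \<phi> where "\<phi> x = (THE c. c \<in> carrier K \<and> (\<exists>u\<in>U. x = u \<oplus>\<^bsub>V\<^esub> c \<odot>\<^bsub>V\<^esub> v))" for x
  have \<phi>: "\<phi> (u \<oplus>\<^bsub>V\<^esub> c \<odot>\<^bsub>V\<^esub> v) = c" if "u \<in> U" "c \<in> carrier K" for u c
    unfolding \<phi>_def using that unique by blast
  have "linear_map K V (ground_algebra K) \<phi>"
  proof (rule linear_mapI)
    fix x assume "x \<in> carrier V"
    then obtain u c where x: "u \<in> U" "c \<in> carrier K" "x = u \<oplus>\<^bsub>V\<^esub> c \<odot>\<^bsub>V\<^esub> v" using ex by blast
    then show "\<phi> x \<in> carrier (ground_algebra K)" by (simp add: \<phi>)
    show "\<phi> (a \<odot>\<^bsub>V\<^esub> x) = a \<odot>\<^bsub>ground_algebra K\<^esub> \<phi> x" if "a \<in> carrier K" for a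
      using x that scale \<phi>[of "a \<odot>\<^bsub>V\<^esub> u" "a \<otimes> c"] \<phi>[of u c] by (simp add: V.smult_r_distr V.smult_assoc1)
    fix y assume "y \<in> carrier V"
    then obtain u' c' where y: "u' \<in> U" "c' \<in> carrier K" "y = u' \<oplus>\<^bsub>V\<^esub> c' \<odot>\<^bsub>V\<^esub> v" using ex by blast
    then show "\<phi> (x \<oplus>\<^bsub>V\<^esub> y) = \<phi> x \<oplus>\<^bsub>ground_algebra K\<^esub> \<phi> y"
      using x add \<phi>[of "u \<oplus>\<^bsub>V\<^esub> u'" "c \<oplus> c'"] \<phi>[of u c] \<phi>[of u' c'] by (simp add: alg)
  qed
  moreover have "\<phi> v = \<one>" using \<phi>[OF z, of \<one>] by simp
  ultimately show ?thesis by blast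
qed

end

section \<open>Calculating in a cogroupoid\<close>

text \<open>A connected cogroupoid in the context of the calculus over its base field.\<close>

locale nonzero_cogroupoid = connected_cogroupoid K C
  for K :: "('k, 'r) ring_scheme" (structure) and C :: "('k, 'o, 'a) cogroupoid_data"

sublocale nonzero_cogroupoid \<subseteq> base_field K ..

context nonzero_cogroupoid
begin

lemma Alg_algebra [simp]: "X \<in> Obs C \<Longrightarrow> Y \<in> Obs C \<Longrightarrow> assoc_algebra K (Alg C X Y)"
  by (rule Alg)

lemma bialgebra_maps: "X \<in> Obs C \<Longrightarrow> bialgebra_maps K (Alg C X X) (Delta C X X X) (Counit C X)"
  by unfold_locales (simp_all add: Delta Counit)

lemma Delta_linear0:
  "X \<in> Obs C \<Longrightarrow> Y \<in> Obs C \<Longrightarrow> Z \<in> Obs C \<Longrightarrow>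
    linear_map K (Alg C X Y) (tensor K (Alg C X Z) (Alg C Z Y)) (Delta C X Y Z)"
  using Delta[of X Y Z] by (simp add: algebra_hom_def)

lemma Delta_closed [simp]:
  "X \<in> Obs C \<Longrightarrow> Y \<in> Obs C \<Longrightarrow> Z \<in> Obs C \<Longrightarrow> a \<in> carrier (Alg C X Y) \<Longrightarrow>
    Delta C X Y Z a \<in> carrier (tensor K (Alg C X Z) (Alg C Z Y))"
  using linear_map_closed[OF Delta_linear0] by simp

lemma Delta_linear [simp]:
  "X \<in> Obs C \<Longrightarrow> Y \<in> Obs C \<Longrightarrow> Z \<in> Obs C \<Longrightarrow> linear_map K U (Alg C X Y) (\<lambda>u. f u) \<Longrightarrow>
    linear_map K U (tensor K (Alg C X Z) (Alg C Z Y)) (\<lambda>u. Delta C X Y Z (f u))"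
  using linear_map_compose[OF Delta_linear0] .

lemma Delta_mult [simp]:
  assumes "X \<in> Obs C" "Y \<in> Obs C" "Z \<in> Obs C" "a \<in> carrier (Alg C X Y)" "b \<in> carrier (Alg C X Y)"
  shows "Delta C X Y Z (a \<otimes>\<^bsub>Alg C X Y\<^esub> b) =
    tsum (Alg C X Z) (Alg C Z Y) (tensor K (Alg C X Z) (Alg C Z Y)) (\<lambda>a1 a2.
      tsum (Alg C X Z) (Alg C Z Y) (tensor K (Alg C X Z) (Alg C Z Y)) (\<lambda>b1 b2.
        pure K (Alg C X Z) (Alg C Z Y) (a1 \<otimes>\<^bsub>Alg C X Z\<^esub> b1) (a2 \<otimes>\<^bsub>Alg C Z Y\<^esub> b2)) (Delta C X Y Z b)) (Delta C X Y Z a)"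
proof -
  have "Delta C X Y Z (a \<otimes>\<^bsub>Alg C X Y\<^esub> b) =
    Delta C X Y Z a \<otimes>\<^bsub>tensor_algebra K (Alg C X Z) (Alg C Z Y)\<^esub> Delta C X Y Z b"
    using assms Delta[of X Y Z] by (auto simp: algebra_hom_def ring_hom_def)
  then show ?thesis using assms by (simp add: tensor_algebra_mult)
qed

lemma Delta_one [simp]:
  assumes "X \<in> Obs C" "Y \<in> Obs C" "Z \<in> Obs C"
  shows "Delta C X Y Z \<one>\<^bsub>Alg C X Y\<^esub> = pure K (Alg C X Z) (Alg C Z Y) \<one>\<^bsub>Alg C X Z\<^esub> \<one>\<^bsub>Alg C Z Y\<^esub>"
  using assms Delta[of X Y Z] by (auto simp: algebra_hom_def ring_hom_def)

lemma Counit_linear0: "X \<in> Obs C \<Longrightarrow> linear_map K (Alg C X X) (ground_algebra K) (Counit C X)"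
  using Counit[of X] by (simp add: algebra_hom_def)

lemma Counit_closed [simp]: "X \<in> Obs C \<Longrightarrow> a \<in> carrier (Alg C X X) \<Longrightarrow> Counit C X a \<in> carrier K"
  using linear_map_closed[OF Counit_linear0] by simp

lemma Counit_linear [simp]:
  "X \<in> Obs C \<Longrightarrow> linear_map K U (Alg C X X) (\<lambda>u. f u) \<Longrightarrow> linear_map K U (ground_algebra K) (\<lambda>u. Counit C X (f u))"
  using linear_map_compose[OF Counit_linear0] .

lemma Antip_closed [simp]:
  "X \<in> Obs C \<Longrightarrow> Y \<in> Obs C \<Longrightarrow> a \<in> carrier (Alg C X Y) \<Longrightarrow> Antip C X Y a \<in> carrier (Alg C Y X)"
  using linear_map_closed[OF Antip] by simp

lemma Antip_linear [simp]:
  "X \<in> Obs C \<Longrightarrow> Y \<in> Obs C \<Longrightarrow> linear_map K U (Alg C X Y) (\<lambda>u. f u) \<Longrightarrow>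
    linear_map K U (Alg C Y X) (\<lambda>u. Antip C X Y (f u))"
  using linear_map_compose[OF Antip] .

lemma tsum_coassoc [simp]:
  assumes "X \<in> Obs C" "Y \<in> Obs C" "Z \<in> Obs C" "T \<in> Obs C" "a \<in> carrier (Alg C X Y)" "module K M"
    and f: "trilinear_map (Alg C X T) (Alg C T Z) (Alg C Z Y) M f"
  shows "tsum (Alg C X Z) (Alg C Z Y) M (\<lambda>b c. tsum (Alg C X T) (Alg C T Z) M (\<lambda>d e. f d e c) (Delta C X Z T b)) (Delta C X Y Z a) =
    tsum (Alg C X T) (Alg C T Y) M (\<lambda>d b. tsum (Alg C T Z) (Alg C Z Y) M (\<lambda>e c. f d e c) (Delta C T Y Z b)) (Delta C X Y T a)"
    (is "?l = ?r")
proof -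
  note [simp] = assms(1-6)
  note [simp] = trilinear_map_compose[OF f]
  let ?XT = "Alg C X T" and ?TZ = "Alg C T Z" and ?ZY = "Alg C Z Y"
  let ?g = "tsum ?XT (tensor K ?TZ ?ZY) M (\<lambda>d t. tsum ?TZ ?ZY M (\<lambda>e c. f d e c) t)"
  have "?l = ?g (tensor_assoc K ?XT ?TZ ?ZY
        (tensor_map K (tensor K ?XT ?TZ) ?ZY (Delta C X Z T) (\<lambda>b. b) (Delta C X Y Z a)))"
    by (simp add: tensor_map_tsum[where V'="Alg C X Z" and W'="?ZY"] tensor_assoc_tsum)
  also have "\<dots> = ?g (tensor_map K ?XT (tensor K ?TZ ?ZY) (\<lambda>b. b) (Delta C T Y Z) (Delta C X Y T a))"
    by (simp add: coassoc)
  also have "\<dots> = ?r"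
    by (simp add: tensor_map_tsum[where V'="?XT" and W'="Alg C T Y"])
  finally show ?thesis .
qed

lemma tsum_coassoc' [simp]:
  assumes "X \<in> Obs C" "Y \<in> Obs C" "Z \<in> Obs C" "T \<in> Obs C" "a \<in> carrier (Alg C X Y)" "module K M"
    and f: "\<And>u v. u \<in> carrier U \<Longrightarrow> v \<in> carrier V \<Longrightarrow> trilinear_map (Alg C X T) (Alg C T Z) (Alg C Z Y) M (f u v)"
  shows "tsum (Alg C X Z) (Alg C Z Y) M (\<lambda>b c. tsum U V M (\<lambda>u v.
      tsum (Alg C X T) (Alg C T Z) M (\<lambda>d e. f u v d e c) (Delta C X Z T b)) y) (Delta C X Y Z a) =
    tsum (Alg C X T) (Alg C T Y) M (\<lambda>d b. tsum U V M (\<lambda>u v.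
      tsum (Alg C T Z) (Alg C Z Y) M (\<lambda>e c. f u v d e c) (Delta C T Y Z b)) y) (Delta C X Y T a)"
  by (subst (2 4) tsum_swap) (use assms(1-6) f trilinear_map_closed[OF f] in simp_all)

lemma tsum_counit [simp]:
  assumes "X \<in> Obs C" "Y \<in> Obs C" "a \<in> carrier (Alg C X Y)" "module K M" "linear_map K (Alg C X Y) M (\<lambda>b. f b)"
  shows "tsum (Alg C X Y) (Alg C Y Y) M (\<lambda>b c. Counit C Y c \<odot>\<^bsub>M\<^esub> f b) (Delta C X Y Y a) = f a"
    and "tsum (Alg C X X) (Alg C X Y) M (\<lambda>b c. Counit C X b \<odot>\<^bsub>M\<^esub> f c) (Delta C X Y X a) = f a"
proof -
  note [simp] = assms(1-4) linear_map_closed[OF assms(5)] linear_map_smult[OF assms(5)] linear_tsum[OF assms(5)]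
  have "tsum (Alg C X Y) (Alg C Y Y) (Alg C X Y) (\<lambda>b c. Counit C Y c \<odot>\<^bsub>Alg C X Y\<^esub> b) (Delta C X Y Y a) = a"
    using counit_right[of X Y a] by (simp add: tsum_eq_lin_ext)
  from arg_cong[OF this, of f]
  show "tsum (Alg C X Y) (Alg C Y Y) M (\<lambda>b c. Counit C Y c \<odot>\<^bsub>M\<^esub> f b) (Delta C X Y Y a) = f a"
    by simp
  have "tsum (Alg C X X) (Alg C X Y) (Alg C X Y) (\<lambda>b c. Counit C X b \<odot>\<^bsub>Alg C X Y\<^esub> c) (Delta C X Y X a) = a"
    using counit_left[of X Y a] by (simp add: tsum_eq_lin_ext)
  from arg_cong[OF this, of f]
  show "tsum (Alg C X X) (Alg C X Y) M (\<lambda>b c. Counit C X b \<odot>\<^bsub>M\<^esub> f c) (Delta C X Y X a) = f a"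
    by simp
qed

lemma tsum_antip:
  assumes "X \<in> Obs C" "Y \<in> Obs C" "a \<in> carrier (Alg C X X)" "module K M"
  shows "linear_map K (Alg C X Y) M (\<lambda>b. f b) \<Longrightarrow>
      tsum (Alg C X Y) (Alg C Y X) M (\<lambda>b c. f (b \<otimes>\<^bsub>Alg C X Y\<^esub> Antip C Y X c)) (Delta C X X Y a) =
      Counit C X a \<odot>\<^bsub>M\<^esub> f \<one>\<^bsub>Alg C X Y\<^esub>"
    and "linear_map K (Alg C Y X) M (\<lambda>b. g b) \<Longrightarrow>
      tsum (Alg C X Y) (Alg C Y X) M (\<lambda>b c. g (Antip C X Y b \<otimes>\<^bsub>Alg C Y X\<^esub> c)) (Delta C X X Y a) =
      Counit C X a \<odot>\<^bsub>M\<^esub> g \<one>\<^bsub>Alg C Y X\<^esub>"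
proof -
  note [simp] = assms
  have 1: "tsum (Alg C X Y) (Alg C Y X) (Alg C X Y) (\<lambda>b c. b \<otimes>\<^bsub>Alg C X Y\<^esub> Antip C Y X c) (Delta C X X Y a) =
      Counit C X a \<odot>\<^bsub>Alg C X Y\<^esub> \<one>\<^bsub>Alg C X Y\<^esub>"
    using antip_right[of X Y a] by (simp add: tsum_eq_lin_ext)
  have 2: "tsum (Alg C X Y) (Alg C Y X) (Alg C Y X) (\<lambda>b c. Antip C X Y b \<otimes>\<^bsub>Alg C Y X\<^esub> c) (Delta C X X Y a) =
      Counit C X a \<odot>\<^bsub>Alg C Y X\<^esub> \<one>\<^bsub>Alg C Y X\<^esub>"
    using antip_left[of X Y a] by (simp add: tsum_eq_lin_ext)
  {
    assume f: "linear_map K (Alg C X Y) M (\<lambda>b. f b)"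
    from arg_cong[OF 1, of f]
    show "tsum (Alg C X Y) (Alg C Y X) M (\<lambda>b c. f (b \<otimes>\<^bsub>Alg C X Y\<^esub> Antip C Y X c)) (Delta C X X Y a) =
      Counit C X a \<odot>\<^bsub>M\<^esub> f \<one>\<^bsub>Alg C X Y\<^esub>"
      by (simp add: linear_map_smult[OF f] linear_tsum[OF f])
  next
    assume g: "linear_map K (Alg C Y X) M (\<lambda>b. g b)"
    from arg_cong[OF 2, of g]
    show "tsum (Alg C X Y) (Alg C Y X) M (\<lambda>b c. g (Antip C X Y b \<otimes>\<^bsub>Alg C Y X\<^esub> c)) (Delta C X X Y a) =
      Counit C X a \<odot>\<^bsub>M\<^esub> g \<one>\<^bsub>Alg C Y X\<^esub>"
      by (simp add: linear_map_smult[OF g] linear_tsum[OF g])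
  }
qed

lemma one_nonzero:
  assumes "X \<in> Obs C" "Y \<in> Obs C"
  shows "\<one>\<^bsub>Alg C X Y\<^esub> \<noteq> \<zero>\<^bsub>Alg C X Y\<^esub>"
proof
  interpret A: ring "Alg C X Y" using assms by (simp add: assoc_algebra_ring)
  assume "\<one>\<^bsub>Alg C X Y\<^esub> = \<zero>\<^bsub>Alg C X Y\<^esub>"
  then have "x = \<zero>\<^bsub>Alg C X Y\<^esub>" if "x \<in> carrier (Alg C X Y)" for x
    using A.l_one[OF that] A.l_null[OF that] by simp
  then show False using connected[OF assms] A.zero_closed by blast
qed

definition unit_functional :: "'o \<Rightarrow> 'o \<Rightarrow> ('k, 'a) univ \<Rightarrow> 'k" where
  "unit_functional X Y = (SOME \<phi>. linear_map K (Alg C X Y) (ground_algebra K) \<phi> \<and> \<phi> \<one>\<^bsub>Alg C X Y\<^esub> = \<one>)"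

lemma unit_functional:
  assumes "X \<in> Obs C" "Y \<in> Obs C"
  shows "linear_map K (Alg C X Y) (ground_algebra K) (unit_functional X Y) \<and> unit_functional X Y \<one>\<^bsub>Alg C X Y\<^esub> = \<one>"
  unfolding unit_functional_def
  by (rule someI_ex[OF functional_exists]) (use assms one_nonzero in auto)

lemma unit_functional_one [simp]: "X \<in> Obs C \<Longrightarrow> Y \<in> Obs C \<Longrightarrow> unit_functional X Y \<one>\<^bsub>Alg C X Y\<^esub> = \<one>"
  using unit_functional by simp

lemma unit_functional_closed [simp]:
  "X \<in> Obs C \<Longrightarrow> Y \<in> Obs C \<Longrightarrow> a \<in> carrier (Alg C X Y) \<Longrightarrow> unit_functional X Y a \<in> carrier K"
  using linear_map_closed[of "Alg C X Y" "ground_algebra K" "unit_functional X Y" a] unit_functional by simp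

lemma unit_functional_linear [simp]:
  "X \<in> Obs C \<Longrightarrow> Y \<in> Obs C \<Longrightarrow> linear_map K U (Alg C X Y) (\<lambda>u. f u) \<Longrightarrow>
    linear_map K U (ground_algebra K) (\<lambda>u. unit_functional X Y (f u))"
  using linear_map_compose unit_functional by blast

end

section \<open>The cotensor product with a space of morphisms\<close>

locale cogroupoid_pair = nonzero_cogroupoid K C
  for K :: "('k, 'r) ring_scheme" (structure) and C :: "('k, 'o, 'a) cogroupoid_data" +
  fixes X Y :: 'o
  assumes X [simp]: "X \<in> Obs C" and Y [simp]: "Y \<in> Obs C"

sublocale cogroupoid_pair \<subseteq> HX: bialgebra_maps K "Alg C X X" "Delta C X X X" "Counit C X"
  by (rule bialgebra_maps[OF X])

sublocale cogroupoid_pair \<subseteq> HY: bialgebra_maps K "Alg C Y Y" "Delta C Y Y Y" "Counit C Y"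
  by (rule bialgebra_maps[OF Y])

context cogroupoid_pair
begin

abbreviation "XX \<equiv> Alg C X X"
abbreviation "XY \<equiv> Alg C X Y"
abbreviation "YX \<equiv> Alg C Y X"
abbreviation "YY \<equiv> Alg C Y Y"

abbreviation "box V \<equiv> cotensor K XX V XY (Delta C X Y X)"
abbreviation "cobox V \<equiv> cotensor K YY V YX (Delta C Y X Y)"

lemma box_operations:
  "\<zero>\<^bsub>box V\<^esub> = \<zero>\<^bsub>tensor K V XY\<^esub>"
  "x \<oplus>\<^bsub>box V\<^esub> y = x \<oplus>\<^bsub>tensor K V XY\<^esub> y"
  "a \<odot>\<^bsub>box V\<^esub> x = a \<odot>\<^bsub>tensor K V XY\<^esub> x"
  by (simp_all add: cotensor_def)

lemma tsum_box_target: "tsum U W (box V) f x = tsum U W (tensor K V XY) f x"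
  unfolding tsum_def box_operations by (rule lin_ext_zero_add_cong) (simp_all add: cotensor_def)

lemma box_tensor [simp]: "x \<in> carrier (box V) \<Longrightarrow> x \<in> carrier (tensor K V XY)"
  by (simp add: cotensor_def)

lemma box_iff:
  assumes "HX.comod V"
  shows "x \<in> carrier (box V) \<longleftrightarrow> x \<in> carrier (tensor K V XY) \<and>
    tsum V XY (tensor K V (tensor K XX XY)) (\<lambda>v a.
      tsum V XX (tensor K V (tensor K XX XY)) (\<lambda>v0 v1.
        pure K V (tensor K XX XY) v0 (pure K XX XY v1 a)) (coact V v)) x =
    tsum V XY (tensor K V (tensor K XX XY)) (\<lambda>v a.
      tsum XX XY (tensor K V (tensor K XX XY)) (\<lambda>a1 a2.
        pure K V (tensor K XX XY) v (pure K XX XY a1 a2)) (Delta C X Y X a)) x"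
proof -
  note [simp] = assms
  let ?T = "tensor K V (tensor K XX XY)"
  have "tensor_assoc K V XX XY (tensor_map K (tensor K V XX) XY (coact V) (\<lambda>a. a) x) =
    tsum V XY ?T (\<lambda>v a. tsum V XX ?T (\<lambda>v0 v1.
        pure K V (tensor K XX XY) v0 (pure K XX XY v1 a)) (coact V v)) x"
    if "x \<in> carrier (tensor K V XY)"
    using that by (simp add: tensor_map_tsum[where V'=V and W'=XY] tensor_assoc_tsum)
  moreover have "tensor_map K V (tensor K XX XY) (\<lambda>v. v) (Delta C X Y X) x =
    tsum V XY ?T (\<lambda>v a. tsum XX XY ?T (\<lambda>a1 a2.
        pure K V (tensor K XX XY) v (pure K XX XY a1 a2)) (Delta C X Y X a)) x"
    if "x \<in> carrier (tensor K V XY)"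
    using that by (simp add: tensor_map_tsum[where V'=V and W'=XY] collapse_pure)
  ultimately show ?thesis unfolding cotensor_def by auto
qed

lemma box_balanced:
  assumes "HX.comod V" "x \<in> carrier (box V)" "module K M"
    and f: "trilinear_map V XX XY M f"
  shows "tsum V XY M (\<lambda>v a. tsum V XX M (\<lambda>v0 v1. f v0 v1 a) (coact V v)) x =
    tsum V XY M (\<lambda>v a. tsum XX XY M (\<lambda>a1 a2. f v a1 a2) (Delta C X Y X a)) x"
proof -
  note [simp] = assms(1,3)
  note [simp] = trilinear_map_compose[OF f]
  let ?g = "tsum V (tensor K XX XY) M (\<lambda>v t. tsum XX XY M (\<lambda>h a. f v h a) t)"
  show ?thesis
    using arg_cong[OF conjunct2[OF iffD1[OF box_iff[OF assms(1)] assms(2)]], of ?g] by simp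
qed

lemma module_box [simp]:
  assumes "HX.comod V"
  shows "module K (box V)"
proof -
  note [simp] = assms
  let ?VA = "tensor K V XY" and ?T = "tensor K V (tensor K XX XY)"
  have T: "module K ?VA" by simp
  let ?l = "tsum V XY ?T (\<lambda>v a. tsum V XX ?T (\<lambda>v0 v1.
        pure K V (tensor K XX XY) v0 (pure K XX XY v1 a)) (coact V v))"
  let ?r = "tsum V XY ?T (\<lambda>v a. tsum XX XY ?T (\<lambda>a1 a2.
        pure K V (tensor K XX XY) v (pure K XX XY a1 a2)) (Delta C X Y X a))"
  have l: "linear_map K ?VA ?T ?l" and r: "linear_map K ?VA ?T ?r" by simp_all
  have iff: "x \<in> carrier (box V) \<longleftrightarrow> x \<in> carrier ?VA \<and> ?l x = ?r x" for x
    by (rule box_iff) simp_all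
  show ?thesis
  proof (rule subspace_module[OF T box_operations], unfold iff)
    show "\<zero>\<^bsub>?VA\<^esub> \<in> carrier ?VA \<and> ?l \<zero>\<^bsub>?VA\<^esub> = ?r \<zero>\<^bsub>?VA\<^esub>"
      using linear_map_zero[OF l] linear_map_zero[OF r] by simp
  next
    fix x y assume "x \<in> carrier ?VA \<and> ?l x = ?r x" "y \<in> carrier ?VA \<and> ?l y = ?r y"
    then show "x \<oplus>\<^bsub>?VA\<^esub> y \<in> carrier ?VA \<and> ?l (x \<oplus>\<^bsub>?VA\<^esub> y) = ?r (x \<oplus>\<^bsub>?VA\<^esub> y)"
      using linear_map_add[OF l] linear_map_add[OF r] by simp
  next
    fix a x assume "a \<in> carrier K" "x \<in> carrier ?VA \<and> ?l x = ?r x"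
    then show "a \<odot>\<^bsub>?VA\<^esub> x \<in> carrier ?VA \<and> ?l (a \<odot>\<^bsub>?VA\<^esub> x) = ?r (a \<odot>\<^bsub>?VA\<^esub> x)"
      using linear_map_smult[OF l] linear_map_smult[OF r] by simp
  qed (use box_tensor in blast)
qed

lemma linear_map_box:
  "linear_map K U (box V) f \<longleftrightarrow> linear_map K U (tensor K V XY) f \<and> (\<forall>u\<in>carrier U. f u \<in> carrier (box V))"
  unfolding linear_map_def box_operations using box_tensor by blast

lemma linear_map_box_inclusion [simp]: "linear_map K (box V) (tensor K V XY) (\<lambda>u. u)"
  using linear_map_id[of "box V"] linear_map_box by blast

text \<open>The projection of \<open>V \<otimes> C(X,Y)\<close> onto the cotensor product that sends \<open>v \<otimes> a\<close> to
  \<open>v\<^sub>0 \<otimes> v\<^sub>1 \<phi>(S(v\<^sub>2) a)\<close>.\<close>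

definition box_projection :: "('k, 'a) comod \<Rightarrow> ('k, 'a) univ \<Rightarrow> ('k, 'a) univ" where
  "box_projection V =
    tsum V XY (tensor K V XY) (\<lambda>v a.
      tsum V XX (tensor K V XY) (\<lambda>v0 h.
        tsum XY YX (tensor K V XY) (\<lambda>v1 v2.
          unit_functional X Y (Antip C Y X v2 \<otimes>\<^bsub>XY\<^esub> a) \<odot>\<^bsub>tensor K V XY\<^esub> pure K V XY v0 v1)
        (Delta C X X Y h)) (coact V v))"

text \<open>The definition of the projection uses \<open>v\<close> only through its coaction, so coassociativity makes
  every value balanced.\<close>

lemma box_projection_closed [simp]:
  assumes "HX.comod V" "t \<in> carrier (tensor K V XY)"
  shows "box_projection V t \<in> carrier (box V)"
proof -
  note [simp] = assms
  show ?thesis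
    unfolding box_iff[OF assms(1)]
    by (simp add: box_projection_def HX.coact_coassoc_dependent del: HX.coact_coassoc' tsum_coassoc')
qed

lemma box_projection_linear [simp]:
  assumes "HX.comod V" "linear_map K U (tensor K V XY) (\<lambda>u. f u)"
  shows "linear_map K U (box V) (\<lambda>u. box_projection V (f u))"
proof -
  note [simp] = assms
  have "linear_map K (tensor K V XY) (tensor K V XY) (\<lambda>t. box_projection V t)"
    unfolding box_projection_def by simp
  from linear_map_compose[OF this assms(2)] show ?thesis
    using linear_map_closed[OF assms(2)] by (simp add: linear_map_box)
qed

text \<open>On a balanced element the coaction on \<open>v\<close> may be replaced by \<open>\<Delta>\<close> of \<open>a\<close>, which turns
  \<open>v\<^sub>0 \<otimes> v\<^sub>1 \<phi>(S(v\<^sub>2) a)\<close> into \<open>v \<otimes> a\<^sub>1 \<phi>(S(a\<^sub>2) a\<^sub>3)\<close>. The antipode axiom and \<open>\<phi>(1) = 1\<close> finish.\<close>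

lemma box_projection_id [simp]:
  assumes "HX.comod V" "x \<in> carrier (box V)"
  shows "box_projection V x = x"
proof -
  note [simp] = assms
  let ?A = XY and ?B = YX and ?H = XX
  let ?M = "tensor K V ?A" and ?\<phi> = "unit_functional X Y"
  have "box_projection V x = tsum V ?A ?M (\<lambda>v a. tsum ?H ?A ?M (\<lambda>h a'.
      tsum ?A ?B ?M (\<lambda>v1 v2. ?\<phi> (Antip C Y X v2 \<otimes>\<^bsub>?A\<^esub> a') \<odot>\<^bsub>?M\<^esub> pure K V ?A v v1) (Delta C X X Y h)) (Delta C X Y X a)) x"
    unfolding box_projection_def by (rule box_balanced) simp_all
  also have "\<dots> = tsum V ?A ?M (\<lambda>v a. tsum ?A YY ?M (\<lambda>v1 h.
      tsum ?B ?A ?M (\<lambda>v2 a'. ?\<phi> (Antip C Y X v2 \<otimes>\<^bsub>?A\<^esub> a') \<odot>\<^bsub>?M\<^esub> pure K V ?A v v1) (Delta C Y Y X h)) (Delta C X Y Y a)) x"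
    by simp
  also have "\<dots> = tsum V ?A ?M (\<lambda>v a. tsum ?A YY ?M (\<lambda>v1 h.
      Counit C Y h \<odot>\<^bsub>?M\<^esub> pure K V ?A v v1) (Delta C X Y Y a)) x"
    by (intro tsum_cong HOL.refl)
      (simp add: tsum_antip(2)[where g="\<lambda>b. ?\<phi> b \<odot>\<^bsub>?M\<^esub> m" for m])
  also have "\<dots> = x" by simp
  finally show ?thesis .
qed

lemma tsum_box_projection:
  assumes "HX.comod V" "module K N" "u \<in> carrier (box V)" "n \<in> carrier N"
  shows "tsum V XY (tensor K (box V) N)
      (\<lambda>v a. pure K (box V) N (box_projection V (pure K V XY v a)) n) u = pure K (box V) N u n"
proof -
  note [simp] = assms
  have l: "linear_map K (tensor K V XY) (tensor K (box V) N)
      (\<lambda>t. pure K (box V) N (box_projection V t) n)"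
    by simp
  from linear_tsum[OF l, of V XY "pure K V XY" u] show ?thesis by simp
qed

text \<open>Over a field the map \<open>U \<otimes> N \<rightarrow> (V \<otimes> C(X,Y)) \<otimes> N\<close> induced by the inclusion of the cotensor
  product \<open>U\<close> is injective; the projection provides a left inverse.\<close>

lemma box_tensor_eqI:
  assumes "HX.comod V" "module K N"
    and "y \<in> carrier (tensor K (box V) N)" "y' \<in> carrier (tensor K (box V) N)"
    and eq: "tsum (box V) N (tensor K V (tensor K XY N)) (\<lambda>u n.
          tsum V XY (tensor K V (tensor K XY N)) (\<lambda>v a.
            pure K V (tensor K XY N) v (pure K XY N a n)) u) y =
        tsum (box V) N (tensor K V (tensor K XY N)) (\<lambda>u n.
          tsum V XY (tensor K V (tensor K XY N)) (\<lambda>v a.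
            pure K V (tensor K XY N) v (pure K XY N a n)) u) y'"
  shows "y = y'"
proof -
  note [simp] = assms(1-4)
  let ?A = XY and ?T = "tensor K V (tensor K XY N)" and ?B = "tensor K (box V) N"
  let ?p = "tsum V (tensor K ?A N) ?B (\<lambda>v t. tsum ?A N ?B (\<lambda>a n.
      pure K (box V) N (box_projection V (pure K V ?A v a)) n) t)"
  let ?i = "tsum (box V) N ?T (\<lambda>u n. tsum V ?A ?T (\<lambda>v a. pure K V (tensor K ?A N) v (pure K ?A N a n)) u)"
  have "?p (?i w) = w" if "w \<in> carrier ?B" for w
    using that by (simp add: tsum_box_projection)
  from this[of y] this[of y'] eq show ?thesis by simp
qed

text \<open>A left inverse of the embedding of \<open>U \<otimes> N\<close> into \<open>V \<otimes> C(X,Y) \<otimes> N\<close>, where \<open>U\<close> is the cotensor product.\<close>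

definition box_lift :: "('k, 'a) comod \<Rightarrow> ('k, ('k, 'a) univ) module \<Rightarrow> ('k, 'a) univ \<Rightarrow> ('k, 'a) univ" where
  "box_lift V N = tsum V (tensor K XY N) (tensor K (box V) N) (\<lambda>v t.
    tsum XY N (tensor K (box V) N) (\<lambda>a n.
      pure K (box V) N (box_projection V (pure K V XY v a)) n) t)"

lemma box_lift_linear [simp]:
  assumes "HX.comod V" "module K N"
    and "linear_map K U (tensor K V (tensor K XY N)) (\<lambda>u. f u)"
  shows "linear_map K U (tensor K (box V) N) (\<lambda>u. box_lift V N (f u))"
proof -
  note [simp] = assms
  have "linear_map K (tensor K V (tensor K XY N)) (tensor K (box V) N) (box_lift V N)"
    unfolding box_lift_def by simp
  from linear_map_compose[OF this assms(3)] show ?thesis .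
qed

lemma box_lift_closed [simp]:
  assumes "HX.comod V" "module K N" "z \<in> carrier (tensor K V (tensor K XY N))"
  shows "box_lift V N z \<in> carrier (tensor K (box V) N)"
  using linear_map_closed[OF box_lift_linear[OF assms(1,2) linear_map_id] assms(3)] .

text \<open>The cotensor condition in the first two tensor factors.\<close>

definition balanced where
  "balanced V N z \<longleftrightarrow> z \<in> carrier (tensor K V (tensor K XY N)) \<and>
    (let T = tensor K V (tensor K XX (tensor K XY N)) in
    tsum V (tensor K XY N) T (\<lambda>v t. tsum XY N T (\<lambda>a n. tsum V XX T (\<lambda>v0 v1.
      pure K V (tensor K XX (tensor K XY N)) v0
        (pure K XX (tensor K XY N) v1 (pure K XY N a n))) (coact V v)) t) z =
    tsum V (tensor K XY N) T (\<lambda>v t. tsum XY N T (\<lambda>a n. tsum XX XY T (\<lambda>a1 a2.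
      pure K V (tensor K XX (tensor K XY N)) v
        (pure K XX (tensor K XY N) a1 (pure K XY N a2 n))) (Delta C X Y X a)) t) z)"

lemma balanced_tsum:
  assumes "HX.comod V" "module K N" "balanced V N z" "module K M"
    and f: "\<And>n. n \<in> carrier N \<Longrightarrow> trilinear_map V XX XY M (\<lambda>v h a. f v h a n)"
    and n: "\<And>v h a. v \<in> carrier V \<Longrightarrow> h \<in> carrier XX \<Longrightarrow> a \<in> carrier XY \<Longrightarrow> linear_map K N M (\<lambda>n. f v h a n)"
  shows "tsum V (tensor K XY N) M (\<lambda>v t. tsum XY N M (\<lambda>a n. tsum V XX M (\<lambda>v0 v1.
      f v0 v1 a n) (coact V v)) t) z =
    tsum V (tensor K XY N) M (\<lambda>v t. tsum XY N M (\<lambda>a n. tsum XX XY M (\<lambda>a1 a2.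
      f v a1 a2 n) (Delta C X Y X a)) t) z"
proof -
  note [simp] = assms(1,2,4)
  note [simp] = trilinear_map_compose[OF f] n[THEN linear_map_compose]
  let ?g = "tsum V (tensor K XX (tensor K XY N)) M (\<lambda>v s.
    tsum XX (tensor K XY N) M (\<lambda>h t. tsum XY N M (\<lambda>a n. f v h a n) t) s)"
  show ?thesis
    using arg_cong[OF conjunct2[OF assms(3)[unfolded balanced_def Let_def]], of ?g] by simp
qed

text \<open>The calculation of \<open>box_projection_id\<close>, done in the first two tensor factors, shows that the
  embedding maps the lift of a balanced element \<open>z\<close> back to \<open>z\<close>, which therefore lies in the image
  of \<open>U \<otimes> N\<close>.\<close>

lemma tsum_box_lift:
  assumes "HX.comod V" "module K N" "balanced V N z" "module K M"
    and f: "trilinear_map V XY N M f"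
  shows "tsum (box V) N M (\<lambda>u n. tsum V XY M (\<lambda>v a. f v a n) u) (box_lift V N z) =
    tsum V (tensor K XY N) M (\<lambda>v t. tsum XY N M (\<lambda>a n. f v a n) t) z"
proof -
  note [simp] = assms(1,2,4)
  note [simp] = trilinear_map_compose[OF f] trilinear_map_closed[OF f]
  let ?A = XY and ?B = YX and ?H = XX and ?\<phi> = "unit_functional X Y"
  have z: "z \<in> carrier (tensor K V (tensor K ?A N))" using assms(3) by (simp add: balanced_def)
  have "tsum (box V) N M (\<lambda>u n. tsum V ?A M (\<lambda>v a. f v a n) u) (box_lift V N z) =
    tsum V (tensor K ?A N) M (\<lambda>v t. tsum ?A N M (\<lambda>a n. tsum V ?A M (\<lambda>v a. f v a n) (box_projection V (pure K V ?A v a))) t) z"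
    unfolding box_lift_def using z by simp
  also have "\<dots> = tsum V (tensor K ?A N) M (\<lambda>v t. tsum ?A N M (\<lambda>a n. tsum V ?H M (\<lambda>v0 h.
      tsum ?A ?B M (\<lambda>v1 v2. ?\<phi> (Antip C Y X v2 \<otimes>\<^bsub>?A\<^esub> a) \<odot>\<^bsub>M\<^esub> f v0 v1 n) (Delta C X X Y h)) (coact V v)) t) z"
    unfolding box_projection_def by simp
  also have "\<dots> = tsum V (tensor K ?A N) M (\<lambda>v t. tsum ?A N M (\<lambda>a n. tsum ?H ?A M (\<lambda>h a'.
      tsum ?A ?B M (\<lambda>v1 v2. ?\<phi> (Antip C Y X v2 \<otimes>\<^bsub>?A\<^esub> a') \<odot>\<^bsub>M\<^esub> f v v1 n) (Delta C X X Y h)) (Delta C X Y X a)) t) z"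
    by (rule balanced_tsum) (use assms(3) in simp_all)
  also have "\<dots> = tsum V (tensor K ?A N) M (\<lambda>v t. tsum ?A N M (\<lambda>a n. tsum ?A YY M (\<lambda>v1 h.
      tsum ?B ?A M (\<lambda>v2 a'. ?\<phi> (Antip C Y X v2 \<otimes>\<^bsub>?A\<^esub> a') \<odot>\<^bsub>M\<^esub> f v v1 n) (Delta C Y Y X h)) (Delta C X Y Y a)) t) z"
    by simp
  also have "\<dots> = tsum V (tensor K ?A N) M (\<lambda>v t. tsum ?A N M (\<lambda>a n. tsum ?A YY M (\<lambda>v1 h.
      Counit C Y h \<odot>\<^bsub>M\<^esub> f v v1 n) (Delta C X Y Y a)) t) z"
    by (intro tsum_cong HOL.refl)
      (simp add: tsum_antip(2)[where g="\<lambda>b. ?\<phi> b \<odot>\<^bsub>M\<^esub> m" for m])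
  also have "\<dots> = tsum V (tensor K ?A N) M (\<lambda>v t. tsum ?A N M (\<lambda>a n. f v a n) t) z"
    by (intro tsum_cong HOL.refl) simp
  finally show ?thesis .
qed

end

section \<open>The coaction on a cotensor product\<close>

text \<open>As for codiagonal coactions, the name keeps the definite description out of sight and brings the
  comodule into the form \<open>with_coact U \<alpha>\<close>.\<close>

definition cotensor_coact where "cotensor_coact K C X Y V = coact (cotensor_comodule K C X Y V)"

lemma cotensor_comodule_eq [simp]:
  "cotensor_comodule K C X Y V =
    with_coact (cotensor K (Alg C X X) V (Alg C X Y) (Delta C X Y X)) (cotensor_coact K C X Y V)"
  by (simp add: cotensor_coact_def cotensor_comodule_def with_coact_def Let_def)

context cogroupoid_pair
begin

abbreviation "box_coact \<equiv> cotensor_coact K C X Y"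
abbreviation "cobox_coact \<equiv> cotensor_coact K C Y X"

declare box_balanced [simp]

lemma box_balanced' [simp]:
  assumes "HX.comod V" "x \<in> carrier (box V)" "module K M"
    and f: "\<And>p q. p \<in> carrier P \<Longrightarrow> q \<in> carrier Q \<Longrightarrow> trilinear_map V XX XY M (f p q)"
  shows "tsum V XY M (\<lambda>v a. tsum P Q M (\<lambda>p q. tsum V XX M (\<lambda>v0 v1. f p q v0 v1 a) (coact V v)) y) x =
    tsum V XY M (\<lambda>v a. tsum P Q M (\<lambda>p q. tsum XX XY M (\<lambda>a1 a2. f p q v a1 a2) (Delta C X Y X a)) y) x"
  by (subst (2 4) tsum_swap) (use assms(1-3) f trilinear_map_closed[OF f] in simp_all)

lemma box_balanced_dependent:
  assumes "HX.comod V" "x \<in> carrier (box V)" "module K M"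
    and cl: "\<And>p q v h a. p \<in> carrier P \<Longrightarrow> q \<in> carrier Q \<Longrightarrow> v \<in> carrier V \<Longrightarrow> h \<in> carrier XX \<Longrightarrow> a \<in> carrier XY \<Longrightarrow>
      f p q v h a \<in> carrier M"
    and "trilinear_map V XX XY M (\<lambda>v h a. tsum P Q M (\<lambda>p q. f p q v h a) (y a))"
  shows "tsum V XY M (\<lambda>v a. tsum P Q M (\<lambda>p q. tsum V XX M (\<lambda>v0 v1. f p q v0 v1 a) (coact V v)) (y a)) x =
    tsum V XY M (\<lambda>v a. tsum XX XY M (\<lambda>a1 a2. tsum P Q M (\<lambda>p q. f p q v a1 a2) (y a2)) (Delta C X Y X a)) x"
  by (rule HOL.trans[OF tsum_swap_inner box_balanced]) (use assms cl in auto)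

text \<open>The description that defines the coaction is satisfied because \<open>(1 \<otimes> \<Delta>) x\<close> is balanced, by
  coassociativity and \<open>x \<in> U\<close>, and has at most one solution because \<open>U \<otimes> C(Y,Y)\<close> embeds.\<close>

lemma cotensor_coact_lift:
  assumes "HX.comod V" "x \<in> carrier (box V)"
  defines "z \<equiv> tsum V XY (tensor K V (tensor K XY YY)) (\<lambda>v a.
      tsum XY YY (tensor K V (tensor K XY YY)) (\<lambda>a1 h.
        pure K V (tensor K XY YY) v (pure K XY YY a1 h)) (Delta C X Y Y a)) x"
  shows "balanced V YY z"
    and "box_coact V x = box_lift V YY z"
proof -
  note [simp] = assms(1,2)
  let ?A = XY and ?H = YY and ?U = "box V"
  let ?T = "tensor K V (tensor K ?A ?H)"
  show bal: "balanced V ?H z"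
    unfolding balanced_def z_def Let_def by (simp add: box_balanced_dependent del: box_balanced')
  have z: "z \<in> carrier ?T" using bal by (simp add: balanced_def)
  have embed: "tensor_assoc K V ?A ?H (tensor_map K (tensor K V ?A) ?H (\<lambda>u. u) (\<lambda>h. h) y) =
     tsum ?U ?H ?T (\<lambda>u h. tsum V ?A ?T (\<lambda>v a. pure K V (tensor K ?A ?H) v (pure K ?A ?H a h)) u) y"
    if "y \<in> carrier (tensor K ?U ?H)" for y
    using that by (simp add: tensor_map_tsum[where V'="?U" and W'="?H"] tensor_assoc_tsum)
  have spread: "tensor_map K V (tensor K ?A ?H) (\<lambda>v. v) (Delta C X Y Y) x = z"
    unfolding z_def by (simp add: tensor_map_tsum[where V'=V and W'="?A"] collapse_pure)
  have lift: "tsum ?U ?H ?T (\<lambda>u h. tsum V ?A ?T (\<lambda>v a. pure K V (tensor K ?A ?H) v (pure K ?A ?H a h)) u)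
      (box_lift V ?H z) = z"
    using z by (subst tsum_box_lift[OF _ _ bal]) (simp_all add: collapse_pure)
  show "box_coact V x = box_lift V ?H z"
    unfolding cotensor_coact_def cotensor_comodule_def Let_def with_coact_simps spread
  proof (rule the_equality)
    show "box_lift V ?H z \<in> carrier (tensor K ?U ?H) \<and>
      tensor_assoc K V ?A ?H (tensor_map K (tensor K V ?A) ?H (\<lambda>u. u) (\<lambda>h. h) (box_lift V ?H z)) = z"
      using z by (simp add: embed lift)
  next
    fix y assume y: "y \<in> carrier (tensor K ?U ?H) \<and>
      tensor_assoc K V ?A ?H (tensor_map K (tensor K V ?A) ?H (\<lambda>u. u) (\<lambda>h. h) y) = z"
    note yc = conjunct1[OF y]
    have e: "tsum ?U ?H ?T (\<lambda>u h. tsum V ?A ?T (\<lambda>v a. pure K V (tensor K ?A ?H) v (pure K ?A ?H a h)) u) y = z"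
      using conjunct2[OF y] unfolding embed[OF yc] .
    show "y = box_lift V ?H z"
      by (rule box_tensor_eqI[of V ?H]) (use yc z lift e in simp_all)
  qed
qed

lemma cotensor_coact_linear0:
  assumes "HX.comod V"
  shows "linear_map K (box V) (tensor K (box V) YY) (box_coact V)"
proof -
  note [simp] = assms
  show ?thesis by (subst linear_map_cong'[OF _ cotensor_coact_lift(2)]) simp_all
qed

lemma cotensor_coact_closed [simp]:
  "HX.comod V \<Longrightarrow> x \<in> carrier (box V) \<Longrightarrow>
    box_coact V x \<in> carrier (tensor K (box V) YY)"
  by (rule linear_map_closed[OF cotensor_coact_linear0])

text \<open>The working form of the coaction: after embedding \<open>U\<close> into \<open>V \<otimes> C(X,Y)\<close> it is \<open>1 \<otimes> \<Delta>\<close>. Together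
  with \<open>box_tensor_eqI\<close> it takes the place of the definite description.\<close>

lemma tsum_cotensor_coact [simp]:
  assumes "HX.comod V" "x \<in> carrier (box V)" "module K M"
    and f: "trilinear_map V XY YY M f"
  shows "tsum (box V) YY M (\<lambda>u n. tsum V XY M (\<lambda>v a. f v a n) u) (box_coact V x) =
    tsum V XY M (\<lambda>v a. tsum XY YY M (\<lambda>a1 n. f v a1 n) (Delta C X Y Y a)) x"
proof -
  note [simp] = assms(1-3)
  note [simp] = trilinear_map_compose[OF f]
  show ?thesis
    unfolding cotensor_coact_lift(2)[OF assms(1,2)]
    by (subst tsum_box_lift[OF _ _ cotensor_coact_lift(1)]) simp_all
qed

lemma tsum_cotensor_coact' [simp]:
  assumes "HX.comod V" "x \<in> carrier (box V)" "module K M"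
    and f: "\<And>p q. p \<in> carrier P \<Longrightarrow> q \<in> carrier Q \<Longrightarrow> trilinear_map V XY YY M (f p q)"
  shows "tsum (box V) YY M (\<lambda>u n. tsum P Q M (\<lambda>p q. tsum V XY M (\<lambda>v a. f p q v a n) u) y)
      (box_coact V x) =
    tsum V XY M (\<lambda>v a. tsum P Q M (\<lambda>p q.
      tsum XY YY M (\<lambda>a1 n. f p q v a1 n) (Delta C X Y Y a)) y) x"
  by (subst (1 3) tsum_swap) (use assms(1-3) f trilinear_map_closed[OF f] in simp_all)

lemma tsum_cotensor_coact_dependent:
  assumes "HX.comod V" "x \<in> carrier (box V)" "module K M"
    and cl: "\<And>p q v a n. p \<in> carrier P \<Longrightarrow> q \<in> carrier Q \<Longrightarrow> v \<in> carrier V \<Longrightarrow> a \<in> carrier XY \<Longrightarrow> n \<in> carrier YY \<Longrightarrow>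
      f p q v a n \<in> carrier M"
    and "trilinear_map V XY YY M (\<lambda>v a n. tsum P Q M (\<lambda>p q. f p q v a n) (y n))"
  shows "tsum (box V) YY M (\<lambda>u n. tsum P Q M (\<lambda>p q. tsum V XY M (\<lambda>v a. f p q v a n) u) (y n))
      (box_coact V x) =
    tsum V XY M (\<lambda>v a. tsum XY YY M (\<lambda>a1 n.
      tsum P Q M (\<lambda>p q. f p q v a1 n) (y n)) (Delta C X Y Y a)) x"
  by (rule HOL.trans[OF tsum_swap_inner tsum_cotensor_coact]) (use assms cl in auto)

lemma comod_cotensor [simp]:
  assumes "HX.comod V"
  shows "HY.comod (with_coact (box V) (box_coact V))"
proof (rule HY.right_comoduleI, unfold forget_coact with_coact_simps, goal_cases)
  case 1
  show ?case using assms by simp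
next
  case 2
  show ?case using assms by (rule cotensor_coact_linear0)
next
  case (3 x)
  show ?case
    by (rule box_tensor_eqI[of V "tensor K YY YY"])
      (use assms 3 in \<open>simp_all add: tsum_cotensor_coact_dependent del: tsum_cotensor_coact'\<close>)
next
  case (4 x)
  note [simp] = assms 4
  let ?A = XY and ?H = YY and ?U = "box V"
  have "tsum ?U ?H ?U (\<lambda>u h. Counit C Y h \<odot>\<^bsub>?U\<^esub> u) (box_coact V x) =
    tsum ?U ?H (tensor K V ?A) (\<lambda>u h. Counit C Y h \<odot>\<^bsub>tensor K V ?A\<^esub> u) (box_coact V x)"
    unfolding tsum_box_target box_operations ..
  also have "\<dots> = tsum ?U ?H (tensor K V ?A) (\<lambda>u h.
      tsum V ?A (tensor K V ?A) (\<lambda>v a. Counit C Y h \<odot>\<^bsub>tensor K V ?A\<^esub> pure K V ?A v a) u) (box_coact V x)"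
  proof (intro tsum_cong HOL.refl)
    fix u h assume [simp]: "u \<in> carrier ?U" "h \<in> carrier ?H"
    show "Counit C Y h \<odot>\<^bsub>tensor K V ?A\<^esub> u = tsum V ?A (tensor K V ?A) (\<lambda>v a. Counit C Y h \<odot>\<^bsub>tensor K V ?A\<^esub> pure K V ?A v a) u"
      using scale_tsum[of "tensor K V ?A" "Counit C Y h" V ?A "pure K V ?A" u] by simp
  qed
  also have "\<dots> = x" by simp
  finally show ?case by simp
qed

end

section \<open>Cotensor products as a functor with monoidal structure maps\<close>

text \<open>A linear functor with natural structure maps, without coherence and invertibility. These
  axioms suffice for deducing the invertibility of the structure maps from a quasi-inverse.\<close>

locale tensor_functor =
  source: linear_monoidal_category K C + target: linear_monoidal_category K D
  for K :: "('k, 'r) ring_scheme"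
    and C :: "('k, 'o, 'm, 's) monoidal_category_data_scheme"
    and D :: "('k, 'p, 'n, 't) monoidal_category_data_scheme" +
  fixes F :: "('o, 'm, 'p, 'n, 'u) monoidal_functor_data_scheme"
  assumes MapO: "X \<in> Ob C \<Longrightarrow> MapO F X \<in> Ob D"
    and MapM_linear: "X \<in> Ob C \<Longrightarrow> Y \<in> Ob C \<Longrightarrow>
      linear_map K (Hom C X Y) (Hom D (MapO F X) (MapO F Y)) (MapM F X Y)"
    and MapM_Ident: "X \<in> Ob C \<Longrightarrow> MapM F X X (Ident C X) = Ident D (MapO F X)"
    and MapM_Comp: "X \<in> Ob C \<Longrightarrow> Y \<in> Ob C \<Longrightarrow> Z \<in> Ob C \<Longrightarrow> f \<in> arrows C X Y \<Longrightarrow> g \<in> arrows C Y Z \<Longrightarrow>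
      MapM F X Z (Comp C X Y Z g f) =
      Comp D (MapO F X) (MapO F Y) (MapO F Z) (MapM F Y Z g) (MapM F X Y f)"
    and UnitF: "UnitF F \<in> arrows D (UnitO D) (MapO F (UnitO C))"
    and TensF: "X \<in> Ob C \<Longrightarrow> Y \<in> Ob C \<Longrightarrow>
      TensF F X Y \<in> arrows D (TensO D (MapO F X) (MapO F Y)) (MapO F (TensO C X Y))"
    and TensF_natural: "X \<in> Ob C \<Longrightarrow> X' \<in> Ob C \<Longrightarrow> Y \<in> Ob C \<Longrightarrow> Y' \<in> Ob C \<Longrightarrow>
      f \<in> arrows C X X' \<Longrightarrow> g \<in> arrows C Y Y' \<Longrightarrow>
      Comp D (TensO D (MapO F X) (MapO F Y)) (TensO D (MapO F X') (MapO F Y')) (MapO F (TensO C X' Y'))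
        (TensF F X' Y')
        (TensM D (MapO F X) (MapO F X') (MapO F Y) (MapO F Y') (MapM F X X' f) (MapM F Y Y' g)) =
      Comp D (TensO D (MapO F X) (MapO F Y)) (MapO F (TensO C X Y)) (MapO F (TensO C X' Y'))
        (MapM F (TensO C X Y) (TensO C X' Y') (TensM C X X' Y Y' f g)) (TensF F X Y)"

context cogroupoid_pair
begin

text \<open>Copies of the calculation rules for comodules that are given with their coaction, whose
  coaction the simplifier forgets in the underlying space.\<close>

lemmas with_coact_rules [simp] =
  linear_map_box_inclusion[where V="with_coact M \<alpha>" for M \<alpha>, unfolded forget_coact]
  box_balanced[where V="with_coact M \<alpha>" for M \<alpha>, unfolded forget_coact with_coact_simps]
  box_balanced'[where V="with_coact M \<alpha>" for M \<alpha>, unfolded forget_coact with_coact_simps]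
  tsum_cotensor_coact[where V="with_coact M \<alpha>" for M \<alpha>, unfolded forget_coact with_coact_simps]
  tsum_cotensor_coact'[where V="with_coact M \<alpha>" for M \<alpha>, unfolded forget_coact with_coact_simps]

lemma MapO_cotensor [simp]:
  "MapO (cotensor_functor K C X Y) V = with_coact (box V) (box_coact V)"
  by (simp add: cotensor_functor_def)

lemma MapM_cotensor:
  assumes "HX.comod V"
  shows "MapM (cotensor_functor K C X Y) V W f =
    (\<lambda>x\<in>carrier (box V). tsum V XY (tensor K W XY) (\<lambda>v a. pure K W XY (f v) a) x)"
  using assms by (auto simp: cotensor_functor_def tensor_map_tsum[where V'=V and W'=XY] intro!: restrict_ext)

lemma UnitF_cotensor:
  "UnitF (cotensor_functor K C X Y) =
    (\<lambda>c\<in>carrier (unit_space K). pure K (unit_space K) XY c \<one>\<^bsub>XY\<^esub>)"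
  by (simp add: cotensor_functor_def)

text \<open>The structure map \<open>F V \<otimes> F W \<rightarrow> F (V \<otimes> W)\<close> on the pure tensor \<open>x \<otimes> y\<close>.\<close>

abbreviation box_mult :: "('k, 'a) comod \<Rightarrow> ('k, 'a) comod \<Rightarrow> ('k, 'a) univ \<Rightarrow> ('k, 'a) univ \<Rightarrow> ('k, 'a) univ" where
  "box_mult V W x y \<equiv>
    tsum V XY (tensor K (tensor K V W) XY) (\<lambda>v a.
      tsum W XY (tensor K (tensor K V W) XY) (\<lambda>w b.
        pure K (tensor K V W) XY (pure K V W v w) (a \<otimes>\<^bsub>XY\<^esub> b)) y) x"

lemma TensF_cotensor:
  assumes "HX.comod V" "HX.comod W"
  shows "TensF (cotensor_functor K C X Y) V W =
    (\<lambda>z\<in>carrier (tensor K (box V) (box W)).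
      tsum (box V) (box W) (tensor K (tensor K V W) XY) (box_mult V W) z)"
proof -
  note [simp] = assms
  let ?T = "tensor K (tensor K V W) XY"
  have "lin_ext ?T (\<lambda>x y. lin_ext ?T (\<lambda>v a. lin_ext ?T (\<lambda>w b.
          pure K (tensor K V W) XY (pure K V W v w) (a \<otimes>\<^bsub>XY\<^esub> b)) y) x) z =
      tsum (box V) (box W) ?T (box_mult V W) z" if "z \<in> carrier (tensor K (box V) (box W))" for z
  proof -
    have "lin_ext ?T (\<lambda>x y. lin_ext ?T (\<lambda>v a. lin_ext ?T (\<lambda>w b.
          pure K (tensor K V W) XY (pure K V W v w) (a \<otimes>\<^bsub>XY\<^esub> b)) y) x) z =
      tsum (box V) (box W) ?T (\<lambda>x y. lin_ext ?T (\<lambda>v a. lin_ext ?T (\<lambda>w b.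
          pure K (tensor K V W) XY (pure K V W v w) (a \<otimes>\<^bsub>XY\<^esub> b)) y) x) z"
      using that by (simp add: tsum_eq_lin_ext)
    also have "\<dots> = tsum (box V) (box W) ?T (box_mult V W) z"
      by (intro tsum_cong HOL.refl) (simp add: tsum_eq_lin_ext cong: tsum_cong)
    finally show ?thesis .
  qed
  then show ?thesis by (auto simp: cotensor_functor_def Let_def intro!: restrict_ext)
qed

lemma box_map_closed:
  assumes "HX.comod V" "HX.comod W"
    and f: "f \<in> carrier (comodule_Hom K XX V W)" and x: "x \<in> carrier (box V)"
  shows "tsum V XY (tensor K W XY) (\<lambda>v a. pure K W XY (f v) a) x \<in> carrier (box W)"
proof -
  note cf = HX.arrow_colinear[OF assms(1) f]
  note lf = HX.colinear_linear[OF cf]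
  note [simp] = assms(1,2) x HX.arrow_closed[OF f] linear_map_compose[OF lf] HX.tsum_colinear[OF cf]
  show ?thesis unfolding box_iff[OF assms(2)] by simp
qed

lemma box_map_linear:
  assumes "HX.comod V" "HX.comod W"
    and f: "f \<in> carrier (comodule_Hom K XX V W)"
    and g: "linear_map K U (box V) (\<lambda>u. g u)"
  shows "linear_map K U (box W) (\<lambda>u. tsum V XY (tensor K W XY) (\<lambda>v a. pure K W XY (f v) a) (g u))"
proof -
  note cf = HX.arrow_colinear[OF assms(1) f]
  note lf = HX.colinear_linear[OF cf]
  note [simp] = assms(1,2) HX.arrow_closed[OF f] linear_map_compose[OF lf]
  have "linear_map K (box V) (box W) (\<lambda>x. tsum V XY (tensor K W XY) (\<lambda>v a. pure K W XY (f v) a) x)"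
    using box_map_closed[OF assms(1,2) f] by (simp add: linear_map_box)
  from linear_map_compose[OF this g] show ?thesis .
qed

lemma MapM_cotensor_arrow:
  assumes "HX.comod V" "HX.comod W"
    and f: "f \<in> carrier (comodule_Hom K XX V W)"
  shows "MapM (cotensor_functor K C X Y) V W f \<in> carrier (comodule_Hom K YY
    (cotensor_comodule K C X Y V) (cotensor_comodule K C X Y W))"
proof -
  note cf = HX.arrow_colinear[OF assms(1) f]
  note lf = HX.colinear_linear[OF cf]
  note [simp] = assms(1,2) HX.arrow_closed[OF f] linear_map_compose[OF lf] box_map_closed[OF assms(1,2) f]
    box_map_linear[OF assms(1,2) f]
  let ?A = XY and ?H = YY
  let ?f = "tsum V ?A (tensor K W ?A) (\<lambda>v a. pure K W ?A (f v) a)"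
  have eq: "box_coact W (?f x) =
    tsum (box V) ?H (tensor K (box W) ?H) (\<lambda>u h. pure K (box W) ?H (?f u) h) (box_coact V x)"
    if [simp]: "x \<in> carrier (box V)" for x
    by (rule box_tensor_eqI[of W ?H]) simp_all
  have "HY.colinear (cotensor_comodule K C X Y V) (cotensor_comodule K C X Y W) ?f"
    unfolding HY.colinear_def by (simp add: eq)
  then show ?thesis
    unfolding MapM_cotensor[OF assms(1)] by (intro HY.restrict_arrow) simp_all
qed

lemma UnitF_cotensor_arrow:
  shows "UnitF (cotensor_functor K C X Y) \<in> carrier (comodule_Hom K YY
    (unit_comodule K YY) (cotensor_comodule K C X Y (unit_comodule K XX)))"
proof -
  let ?A = XY and ?H = YY and ?I = "with_coact (unit_space K) (\<lambda>x. pure K (unit_space K) XX x \<one>\<^bsub>XX\<^esub>)"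
  note [simp] = box_tensor[of _ ?I, unfolded forget_coact]
  have cl [simp]: "pure K (unit_space K) ?A c \<one>\<^bsub>?A\<^esub> \<in> carrier (box ?I)" if "c \<in> carrier (unit_space K)" for c
    unfolding box_iff[OF HX.comod_unit] using that by simp
  have lin [simp]: "linear_map K (unit_space K) (box ?I) (\<lambda>c. pure K (unit_space K) ?A c \<one>\<^bsub>?A\<^esub>)"
    by (simp add: linear_map_box)
  have eq: "box_coact ?I (pure K (unit_space K) ?A c \<one>\<^bsub>?A\<^esub>) =
      pure K (box ?I) ?H (pure K (unit_space K) ?A c \<one>\<^bsub>?A\<^esub>) \<one>\<^bsub>?H\<^esub>" if [simp]: "c \<in> carrier (unit_space K)" for c
    by (rule box_tensor_eqI[of ?I ?H]) simp_all
  have "HY.colinear (unit_comodule K ?H) (cotensor_comodule K C X Y (unit_comodule K XX))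
      (\<lambda>c. pure K (unit_space K) ?A c \<one>\<^bsub>?A\<^esub>)"
    unfolding HY.colinear_def by (simp add: eq)
  then show ?thesis unfolding UnitF_cotensor by (intro HY.restrict_arrow) simp_all
qed

abbreviation "codiag V W \<equiv> with_coact (tensor K V W) (codiagonal K XX V W)"

lemma box_mult_closed [simp]:
  assumes "HX.comod V" "HX.comod W" "x \<in> carrier (box V)" "y \<in> carrier (box W)"
  shows "box_mult V W x y \<in> carrier (box (codiag V W))"
proof -
  note [simp] = assms
  have "HX.comod (codiag V W)" by simp
  from box_iff[OF this] show ?thesis by simp
qed

lemmas box_codiagonal [simp] = box_tensor[of _ "codiag V W" for V W, unfolded forget_coact]

lemma tsum_box_mult_closed [simp]:
  assumes "HX.comod V" "HX.comod W"
  shows "tsum (box V) (box W) (tensor K (tensor K V W) XY) (box_mult V W) z \<in> carrier (box (codiag V W))"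
  using tsum_closed[of "box (codiag V W)" "box V" "box W" "box_mult V W" z] assms by (simp add: tsum_box_target)

lemma box_mult_linear [simp]:
  fixes N :: "('k, ('k, 'a) univ) module"
  assumes "HX.comod V" "HX.comod W" "module K N"
  shows "linear_map K N (tensor K (box V) (box W)) (\<lambda>u. g u) \<Longrightarrow> linear_map K N (box (codiag V W))
      (\<lambda>u. tsum (box V) (box W) (tensor K (tensor K V W) XY) (box_mult V W) (g u))"
    and "linear_map K N (box V) (\<lambda>u. g u) \<Longrightarrow> y \<in> carrier (box W) \<Longrightarrow>
      linear_map K N (box (codiag V W)) (\<lambda>u. box_mult V W (g u) y)"
    and "linear_map K N (box W) (\<lambda>u. g u) \<Longrightarrow> x \<in> carrier (box V) \<Longrightarrow>
      linear_map K N (box (codiag V W)) (\<lambda>u. box_mult V W x (g u))"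
proof -
  note [simp] = assms
  show "linear_map K N (tensor K (box V) (box W)) (\<lambda>u. g u) \<Longrightarrow> linear_map K N (box (codiag V W))
      (\<lambda>u. tsum (box V) (box W) (tensor K (tensor K V W) XY) (box_mult V W) (g u))"
    by (simp add: linear_map_box)
  have "y \<in> carrier (box W) \<Longrightarrow> linear_map K (box V) (box (codiag V W)) (\<lambda>x. box_mult V W x y)"
    and "x \<in> carrier (box V) \<Longrightarrow> linear_map K (box W) (box (codiag V W)) (\<lambda>y. box_mult V W x y)"
    by (simp_all add: linear_map_box)
  then show "linear_map K N (box V) (\<lambda>u. g u) \<Longrightarrow> y \<in> carrier (box W) \<Longrightarrow>
      linear_map K N (box (codiag V W)) (\<lambda>u. box_mult V W (g u) y)"
    "linear_map K N (box W) (\<lambda>u. g u) \<Longrightarrow> x \<in> carrier (box V) \<Longrightarrow>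
      linear_map K N (box (codiag V W)) (\<lambda>u. box_mult V W x (g u))"
    using linear_map_compose by blast+
qed

lemma TensF_cotensor_arrow:
  assumes "HX.comod V" "HX.comod W"
  shows "TensF (cotensor_functor K C X Y) V W \<in> carrier (comodule_Hom K YY
    (comodule_tensor K YY (cotensor_comodule K C X Y V) (cotensor_comodule K C X Y W))
    (cotensor_comodule K C X Y (comodule_tensor K XX V W)))"
proof -
  note [simp] = assms
  let ?A = XY and ?H = YY and ?UV = "box V" and ?UW = "box W" and ?VW = "codiag V W"
  let ?m = "tsum ?UV ?UW (tensor K (tensor K V W) ?A) (box_mult V W)"
  have eq: "box_coact ?VW (?m z) =
    tsum (tensor K ?UV ?UW) ?H (tensor K (box ?VW) ?H) (\<lambda>u h. pure K (box ?VW) ?H (?m u) h)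
      (codiagonal K ?H (cotensor_comodule K C X Y V) (cotensor_comodule K C X Y W) z)"
    if [simp]: "z \<in> carrier (tensor K ?UV ?UW)" for z
    by (rule box_tensor_eqI[of ?VW ?H]) simp_all
  have "HY.colinear (comodule_tensor K ?H (cotensor_comodule K C X Y V) (cotensor_comodule K C X Y W))
      (cotensor_comodule K C X Y (comodule_tensor K XX V W)) ?m"
    unfolding HY.colinear_def using eq by simp
  then show ?thesis unfolding TensF_cotensor[OF assms] by (intro HY.restrict_arrow) simp_all
qed

lemma tensor_functor_cotensor:
  "tensor_functor K (Comod_at K C X) (Comod_at K C Y) (cotensor_functor K C X Y)"
proof (rule tensor_functor.intro[OF HX.linear_monoidal_category_Comod HY.linear_monoidal_category_Comod tensor_functor_axioms.intro],
    unfold HX.Comod_simps HY.Comod_simps mem_Collect_eq, goal_cases)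
  case (1 V)
  then show ?case by simp
next
  case VW: (2 V W)
  note [simp] = VW
  show ?case
  proof (rule linear_mapI, goal_cases)
    case (1 f)
    then show ?case using MapM_cotensor_arrow[of V W f] by simp
  next
    case (2 f g)
    note [simp] = HX.arrow_closed[OF 2(1)] HX.arrow_closed[OF 2(2)]
    show ?case
      by (auto simp: MapM_cotensor box_operations tsum_add[symmetric] linear_map_add[OF linear_map_pure(1)[OF _ _ linear_map_id]]
          intro!: restrict_ext)
  next
    case (3 c f)
    note [simp] = 3(1) HX.arrow_closed[OF 3(2)]
    show ?case by (auto simp: MapM_cotensor box_operations intro!: restrict_ext)
  qed
next
  case (3 V)
  then show ?case by (auto simp: MapM_cotensor intro!: restrict_ext)
next
  case (4 U V W f g)
  note lg = HX.colinear_linear[OF HX.arrow_colinear[OF 4(2,5)]]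
  note [simp] = 4(1-3) 4(4,5)[THEN HX.arrow_closed] linear_map_compose[OF lg] box_map_closed[OF _ _ 4(4)]
  show ?case by (auto simp: MapM_cotensor compose_def intro!: restrict_ext)
next
  case 5
  then show ?case using UnitF_cotensor_arrow by simp
next
  case (6 V W)
  then show ?case using TensF_cotensor_arrow by simp
next
  case (7 V V' W W' f g)
  note [simp] = 7(1-4) 7(5,6)[THEN HX.arrow_closed] 7(5,6)[THEN HX.arrow_colinear[rotated], THEN HX.colinear_linear, THEN linear_map_compose]
    7(5,6)[THEN box_map_closed[rotated 2]] 7(5,6)[THEN box_map_linear[rotated 2]]
  show ?case
    by (auto simp: MapM_cotensor TensF_cotensor HX.TensM_Comod HY.TensM_Comod compose_def intro!: restrict_ext)
qed

text \<open>On pure tensors both sides send \<open>(u \<otimes> a) \<otimes> (v \<otimes> b) \<otimes> (w \<otimes> c)\<close> to \<open>u \<otimes> (v \<otimes> w) \<otimes> a b c\<close>, up to the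
  associativity of \<open>C(X,Y)\<close>.\<close>

lemma TensF_cotensor_assoc:
  assumes [simp]: "HX.comod U" "HX.comod V" "HX.comod W"
  defines "F \<equiv> cotensor_functor K C X Y" and "D \<equiv> Comod_at K C Y" and "E \<equiv> Comod_at K C X"
  shows "Comp D (TensO D (TensO D (MapO F U) (MapO F V)) (MapO F W))
          (MapO F (TensO E (TensO E U V) W)) (MapO F (TensO E U (TensO E V W)))
        (MapM F (TensO E (TensO E U V) W) (TensO E U (TensO E V W)) (AssocM E U V W))
        (Comp D (TensO D (TensO D (MapO F U) (MapO F V)) (MapO F W))
            (TensO D (MapO F (TensO E U V)) (MapO F W)) (MapO F (TensO E (TensO E U V) W))
          (TensF F (TensO E U V) W)
          (TensM D (TensO D (MapO F U) (MapO F V)) (MapO F (TensO E U V)) (MapO F W) (MapO F W)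
            (TensF F U V) (Ident D (MapO F W)))) =
      Comp D (TensO D (TensO D (MapO F U) (MapO F V)) (MapO F W))
          (TensO D (MapO F U) (MapO F (TensO E V W))) (MapO F (TensO E U (TensO E V W)))
        (TensF F U (TensO E V W))
        (Comp D (TensO D (TensO D (MapO F U) (MapO F V)) (MapO F W))
            (TensO D (MapO F U) (TensO D (MapO F V) (MapO F W)))
            (TensO D (MapO F U) (MapO F (TensO E V W)))
          (TensM D (MapO F U) (MapO F U) (TensO D (MapO F V) (MapO F W)) (MapO F (TensO E V W))
            (Ident D (MapO F U)) (TensF F V W))
          (AssocM D (MapO F U) (MapO F V) (MapO F W)))"
proof -
  let ?A = XY and ?UV = "codiag U V"
  \<comment> \<open>Copies at \<open>U \<otimes> V\<close>, whose coaction the simplifier forgets inside tensor products.\<close>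
  note [simp] = box_mult_closed[of ?UV W, unfolded forget_coact] tsum_box_mult_closed[of ?UV W, unfolded forget_coact]
    box_tensor[of _ "codiag ?UV W", unfolded forget_coact]
  have UV: "HX.comod ?UV" by simp
  have flat: "tsum (box ?UV) (box W) (tensor K (tensor K (tensor K U V) W) ?A) (box_mult ?UV W)
      (tsum (tensor K (box U) (box V)) (box W) (tensor K (box ?UV) (box W)) (\<lambda>t w.
        pure K (box ?UV) (box W) (tsum (box U) (box V) (tensor K (tensor K U V) ?A) (box_mult U V) t) w) x) \<in>
      carrier (box (codiag ?UV W))" for x
    unfolding forget_coact by (rule tsum_box_mult_closed[OF UV assms(3), unfolded forget_coact])
  note [simp] = algebra_mult_assoc
  note [simp] = flat[simplified]
  show ?thesis
    unfolding F_def D_def E_def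
    by (auto simp: MapM_cotensor TensF_cotensor HX.TensM_Comod HY.TensM_Comod HX.AssocM_Comod HY.AssocM_Comod
        compose_def intro!: restrict_ext)
qed

lemma TensF_cotensor_units:
  assumes [simp]: "HX.comod V"
  defines "F \<equiv> cotensor_functor K C X Y" and "D \<equiv> Comod_at K C Y" and "E \<equiv> Comod_at K C X"
  shows "Comp D (TensO D (UnitO D) (MapO F V)) (MapO F (TensO E (UnitO E) V)) (MapO F V)
        (MapM F (TensO E (UnitO E) V) V (LUnitM E V))
        (Comp D (TensO D (UnitO D) (MapO F V)) (TensO D (MapO F (UnitO E)) (MapO F V))
            (MapO F (TensO E (UnitO E) V))
          (TensF F (UnitO E) V)
          (TensM D (UnitO D) (MapO F (UnitO E)) (MapO F V) (MapO F V) (UnitF F) (Ident D (MapO F V)))) =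
      LUnitM D (MapO F V)" (is ?left)
    and "Comp D (TensO D (MapO F V) (UnitO D)) (MapO F (TensO E V (UnitO E))) (MapO F V)
        (MapM F (TensO E V (UnitO E)) V (RUnitM E V))
        (Comp D (TensO D (MapO F V) (UnitO D)) (TensO D (MapO F V) (MapO F (UnitO E)))
            (MapO F (TensO E V (UnitO E)))
          (TensF F V (UnitO E))
          (TensM D (MapO F V) (MapO F V) (UnitO D) (MapO F (UnitO E)) (Ident D (MapO F V)) (UnitF F))) =
      RUnitM D (MapO F V)" (is ?right)
proof -
  let ?A = XY and ?I = "with_coact (unit_space K) (\<lambda>x. pure K (unit_space K) XX x \<one>\<^bsub>XX\<^esub>)"
  have I: "HX.comod ?I" by simp
  have unit [simp]: "pure K (unit_space K) ?A c \<one>\<^bsub>?A\<^esub> \<in> carrier (box ?I)" if "c \<in> carrier (unit_space K)" for c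
    unfolding box_iff[OF HX.comod_unit] using that by simp
  have unit_linear [simp]: "linear_map K (unit_space K) (box ?I) (\<lambda>c. pure K (unit_space K) ?A c \<one>\<^bsub>?A\<^esub>)"
    by (simp add: linear_map_box)
  \<comment> \<open>Copies at the unit comodule, whose coaction is likewise forgotten.\<close>
  note [simp] = box_tensor[of _ ?I, unfolded forget_coact] box_tensor[of _ "codiag ?I V", unfolded forget_coact]
    box_tensor[of _ "codiag V ?I", unfolded forget_coact]
  have left: "tsum (box ?I) (box V) (tensor K (tensor K ?I V) ?A) (box_mult ?I V)
    (tsum (unit_space K) (box V) (tensor K (box ?I) (box V))
      (\<lambda>c x. pure K (box ?I) (box V) (pure K (unit_space K) ?A c \<one>\<^bsub>?A\<^esub>) x) z) \<in> carrier (box (codiag ?I V))" for z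
    by (rule tsum_box_mult_closed[OF I assms(1)])
  have right: "tsum (box V) (box ?I) (tensor K (tensor K V ?I) ?A) (box_mult V ?I)
    (tsum (box V) (unit_space K) (tensor K (box V) (box ?I))
      (\<lambda>x c. pure K (box V) (box ?I) x (pure K (unit_space K) ?A c \<one>\<^bsub>?A\<^esub>)) z) \<in> carrier (box (codiag V ?I))" for z
    by (rule tsum_box_mult_closed[OF assms(1) I])
  have scale: "tsum V ?A (tensor K V ?A) (\<lambda>v a. b \<odot>\<^bsub>tensor K V ?A\<^esub> pure K V ?A v a) x = b \<odot>\<^bsub>tensor K V ?A\<^esub> x"
    if "x \<in> carrier (box V)" "b \<in> carrier K" for x b
    using that scale_tsum[of "tensor K V ?A" b V ?A "pure K V ?A" x] by simp
  note [simp] = left[simplified] right[simplified] scale tsum_box_target box_operations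
  show ?left
    unfolding F_def D_def E_def
    by (auto simp: MapM_cotensor TensF_cotensor UnitF_cotensor HX.TensM_Comod HY.TensM_Comod HX.LUnitM_Comod HY.LUnitM_Comod
        compose_def intro!: restrict_ext)
  show ?right
    unfolding F_def D_def E_def
    by (auto simp: MapM_cotensor TensF_cotensor UnitF_cotensor HX.TensM_Comod HY.TensM_Comod HX.RUnitM_Comod HY.RUnitM_Comod
        compose_def intro!: restrict_ext)
qed

end

section \<open>The composite of the two cotensor functors\<close>

sublocale cogroupoid_pair \<subseteq> swap: cogroupoid_pair K C Y X
  by unfold_locales simp_all

context cogroupoid_pair
begin

text \<open>\<open>v \<mapsto> v\<^sub>0 \<otimes> \<Delta>(v\<^sub>1)\<close> in \<open>V \<otimes> (C(X,Y) \<otimes> C(Y,X))\<close>. It is balanced, so it lifts to \<open>U \<otimes> C(Y,X)\<close>, where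
  \<open>cotensor_unit\<close> takes its values.\<close>

definition split_coact :: "('k, 'a) comod \<Rightarrow> ('k, 'a) univ \<Rightarrow> ('k, 'a) univ" where
  "split_coact V v = tsum V XX (tensor K V (tensor K XY YX)) (\<lambda>v0 h.
    tsum XY YX (tensor K V (tensor K XY YX)) (\<lambda>a b.
      pure K V (tensor K XY YX) v0 (pure K XY YX a b)) (Delta C X X Y h)) (coact V v)"

definition cotensor_unit :: "('k, 'a) comod \<Rightarrow> ('k, 'a) univ \<Rightarrow> ('k, 'a) univ" where
  "cotensor_unit V v = box_lift V YX (split_coact V v)"

lemma balanced_split_coact:
  assumes "HX.comod V" "v \<in> carrier V"
  shows "balanced V YX (split_coact V v)"
proof -
  note [simp] = assms
  show ?thesis
    unfolding balanced_def split_coact_def Let_def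
    by (simp add: HX.coact_coassoc_dependent del: HX.coact_coassoc' tsum_coassoc')
qed

lemma cotensor_unit_linear0:
  assumes "HX.comod V" "linear_map K U V (\<lambda>u. f u)"
  shows "linear_map K U (tensor K (box V) YX) (\<lambda>u. cotensor_unit V (f u))"
proof -
  note [simp] = assms(1)
  have "linear_map K V (tensor K (box V) YX) (\<lambda>v. cotensor_unit V v)"
    unfolding cotensor_unit_def split_coact_def by simp
  from linear_map_compose[OF this assms(2)] show ?thesis .
qed

lemma cotensor_unit_closed0 [simp]:
  assumes "HX.comod V" "v \<in> carrier V"
  shows "cotensor_unit V v \<in> carrier (tensor K (box V) YX)"
  using linear_map_closed[OF cotensor_unit_linear0[OF assms(1) linear_map_id] assms(2)] .

lemma tsum_cotensor_unit [simp]: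
  assumes "HX.comod V" "x \<in> carrier V" "module K M"
    and f: "trilinear_map V XY YX M f"
  shows "tsum (box V) YX M (\<lambda>u n. tsum V XY M (\<lambda>v a. f v a n) u) (cotensor_unit V x) =
    tsum V XX M (\<lambda>v h. tsum XY YX M (\<lambda>a n. f v a n) (Delta C X X Y h)) (coact V x)"
proof -
  note [simp] = assms(1-3)
  note [simp] = trilinear_map_compose[OF f]
  show ?thesis
    unfolding cotensor_unit_def
    by (subst tsum_box_lift[OF _ _ balanced_split_coact]) (simp_all add: split_coact_def)
qed

lemma tsum_cotensor_unit' [simp]:
  assumes "HX.comod V" "x \<in> carrier V" "module K M"
    and f: "\<And>p q. p \<in> carrier P \<Longrightarrow> q \<in> carrier Q \<Longrightarrow> trilinear_map V XY YX M (f p q)"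
  shows "tsum (box V) YX M (\<lambda>u n. tsum P Q M (\<lambda>p q. tsum V XY M (\<lambda>v a. f p q v a n) u) y)
      (cotensor_unit V x) =
    tsum V XX M (\<lambda>v h. tsum P Q M (\<lambda>p q.
      tsum XY YX M (\<lambda>a n. f p q v a n) (Delta C X X Y h)) y) (coact V x)"
  by (subst (1 3) tsum_swap) (use assms(1-3) f trilinear_map_closed[OF f] in simp_all)

lemma tsum_cotensor_unit_dependent:
  assumes "HX.comod V" "x \<in> carrier V" "module K M"
    and cl: "\<And>p q v a n. p \<in> carrier P \<Longrightarrow> q \<in> carrier Q \<Longrightarrow> v \<in> carrier V \<Longrightarrow> a \<in> carrier XY \<Longrightarrow> n \<in> carrier YX \<Longrightarrow>
      f p q v a n \<in> carrier M"
    and "trilinear_map V XY YX M (\<lambda>v a n. tsum P Q M (\<lambda>p q. f p q v a n) (y n))"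
  shows "tsum (box V) YX M (\<lambda>u n. tsum P Q M (\<lambda>p q. tsum V XY M (\<lambda>v a. f p q v a n) u) (y n))
      (cotensor_unit V x) =
    tsum V XX M (\<lambda>v h. tsum XY YX M (\<lambda>a n.
      tsum P Q M (\<lambda>p q. f p q v a n) (y n)) (Delta C X X Y h)) (coact V x)"
  by (rule HOL.trans[OF tsum_swap_inner tsum_cotensor_unit]) (use assms cl in auto)

text \<open>The values lie in the iterated cotensor product: embedded into \<open>V \<otimes> C(X,Y) \<otimes> C(Y,Y) \<otimes> C(Y,X)\<close>, the
  condition reads \<open>v\<^sub>0 \<otimes> v\<^sub>1\<^sub>1 \<otimes> v\<^sub>1\<^sub>2 \<otimes> v\<^sub>2 = v\<^sub>0 \<otimes> v\<^sub>1 \<otimes> v\<^sub>2\<^sub>1 \<otimes> v\<^sub>2\<^sub>2\<close>, which is coassociativity.\<close>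

lemma cotensor_unit_closed [simp]:
  assumes "HX.comod V" "v \<in> carrier V"
  shows "cotensor_unit V v \<in> carrier (cobox (with_coact (box V) (box_coact V)))"
proof -
  note [simp] = assms
  let ?U = "box V" and ?B = YX and ?H = YY
  let ?T = "tensor K ?U (tensor K ?H ?B)"
  have "tsum ?U ?B ?T (\<lambda>u b. tsum ?U ?H ?T (\<lambda>u0 u1. pure K ?U (tensor K ?H ?B) u0 (pure K ?H ?B u1 b))
      (box_coact V u)) (cotensor_unit V v) =
    tsum ?U ?B ?T (\<lambda>u b. tsum ?H ?B ?T (\<lambda>b1 b2. pure K ?U (tensor K ?H ?B) u (pure K ?H ?B b1 b2))
      (Delta C Y X Y b)) (cotensor_unit V v)"
    by (rule box_tensor_eqI[of V "tensor K ?H ?B"])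
      (simp_all add: tsum_cotensor_unit_dependent del: tsum_cotensor_unit')
  then show ?thesis
    unfolding swap.box_iff[OF comod_cotensor[OF assms(1)]] by simp
qed

lemma cotensor_unit_linear [simp]:
  assumes "HX.comod V" "linear_map K U V (\<lambda>u. f u)"
  shows "linear_map K U (cobox (with_coact (box V) (box_coact V))) (\<lambda>u. cotensor_unit V (f u))"
  using cotensor_unit_linear0[OF assms] linear_map_closed[OF assms(2)] assms(1) by (simp add: swap.linear_map_box)

text \<open>Two embeddings are needed, first of the iterated cotensor product into \<open>U \<otimes> C(Y,X)\<close>, then of \<open>U\<close>
  into \<open>V \<otimes> C(X,Y)\<close>; after that the claim is coassociativity again.\<close>

lemma cotensor_unit_colinear:
  assumes "HX.comod V"
  shows "bialgebra_maps.colinear K XX V (cotensor_comodule K C Y X (cotensor_comodule K C X Y V)) (cotensor_unit V)"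
proof -
  note [simp] = assms
  let ?U = "box V" and ?B = YX and ?H = XX
  let ?F = "with_coact ?U (box_coact V)"
  have eq: "cobox_coact ?F (cotensor_unit V v) =
      tsum V ?H (tensor K (cobox ?F) ?H) (\<lambda>u h. pure K (cobox ?F) ?H (cotensor_unit V u) h) (coact V v)"
    if [simp]: "v \<in> carrier V" for v
  proof -
    let ?T = "tensor K ?U (tensor K ?B ?H)"
    have "tsum ?U ?B ?T (\<lambda>u b. tsum ?B ?H ?T (\<lambda>b1 h. pure K ?U (tensor K ?B ?H) u (pure K ?B ?H b1 h)) (Delta C Y X X b))
        (cotensor_unit V v) =
      tsum V ?H ?T (\<lambda>u h. tsum ?U ?B ?T (\<lambda>w b. pure K ?U (tensor K ?B ?H) w (pure K ?B ?H b h)) (cotensor_unit V u)) (coact V v)"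
      by (rule box_tensor_eqI[of V "tensor K ?B ?H"])
        (simp_all add: tsum_cotensor_unit_dependent del: tsum_cotensor_unit')
    then have embedded: "tsum (cobox ?F) ?H ?T (\<lambda>w h. tsum ?U ?B ?T (\<lambda>u b. pure K ?U (tensor K ?B ?H) u (pure K ?B ?H b h)) w)
        (cobox_coact ?F (cotensor_unit V v)) =
      tsum (cobox ?F) ?H ?T (\<lambda>w h. tsum ?U ?B ?T (\<lambda>u b. pure K ?U (tensor K ?B ?H) u (pure K ?B ?H b h)) w)
        (tsum V ?H (tensor K (cobox ?F) ?H) (\<lambda>u h. pure K (cobox ?F) ?H (cotensor_unit V u) h) (coact V v))"
      by simp
    show ?thesis
    proof (rule swap.box_tensor_eqI[of ?F ?H], goal_cases)
      case 5
      show ?case unfolding forget_coact by (rule embedded)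
    qed simp_all
  qed
  show ?thesis unfolding HX.colinear_def by (simp add: eq)
qed

definition cotensor_counit :: "('k, 'a) comod \<Rightarrow> ('k, 'a) univ \<Rightarrow> ('k, 'a) univ" where
  "cotensor_counit V = tsum (box V) YX V (\<lambda>u b. tsum V XY V (\<lambda>v a.
    unit_functional X Y (a \<otimes>\<^bsub>XY\<^esub> Antip C Y X b) \<odot>\<^bsub>V\<^esub> v) u)"

lemma cotensor_counit_unit:
  assumes "HX.comod V" "v \<in> carrier V"
  shows "cotensor_counit V (cotensor_unit V v) = v"
proof -
  note [simp] = assms
  show ?thesis
    unfolding cotensor_counit_def
    by (simp add: tsum_antip(1)[where f="\<lambda>b. unit_functional X Y b \<odot>\<^bsub>V\<^esub> m" for m])
qed

text \<open>For \<open>z = v \<otimes> a \<otimes> b\<close> in \<open>G (F V)\<close> the left side is \<open>\<phi>(a S(b)) v\<^sub>0 \<otimes> \<Delta>(v\<^sub>1)\<close>. Balancing over \<open>C(X,X)\<close> replaces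
  \<open>v\<^sub>1 \<otimes> a\<close> by \<open>\<Delta>(a)\<close>, which gives \<open>\<phi>(a\<^sub>3 S(b)) v \<otimes> a\<^sub>1 \<otimes> a\<^sub>2\<close>. Balancing over \<open>C(Y,Y)\<close> then replaces the
  coaction on \<open>v \<otimes> a\<close> by \<open>\<Delta>(b)\<close>, which gives \<open>\<phi>(b\<^sub>2 S(b\<^sub>3)) v \<otimes> a \<otimes> b\<^sub>1\<close>, and the antipode axiom leaves \<open>z\<close>.\<close>

lemma cotensor_unit_counit:
  assumes "HX.comod V"
    and z: "z \<in> carrier (cobox (with_coact (box V) (box_coact V)))"
  shows "cotensor_unit V (cotensor_counit V z) = z"
proof -
  note [simp] = assms(1) z
  let ?U = "box V" and ?A = XY and ?B = YX and ?\<phi> = "unit_functional X Y"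
  let ?T = "tensor K V (tensor K ?A ?B)"
  let ?p = "\<lambda>v a b. pure K V (tensor K ?A ?B) v (pure K ?A ?B a b)"
  have [simp]: "z \<in> carrier (tensor K ?U ?B)"
    using swap.box_tensor[OF z] by simp
  have [simp]: "cotensor_counit V z \<in> carrier V" unfolding cotensor_counit_def by simp
  have "tsum ?U ?B ?T (\<lambda>u b. tsum V ?A ?T (\<lambda>v a. ?p v a b) u) (cotensor_unit V (cotensor_counit V z)) =
    tsum ?U ?B ?T (\<lambda>u b. tsum V ?A ?T (\<lambda>v a. tsum V XX ?T (\<lambda>v0 h.
      tsum ?A ?B ?T (\<lambda>a' b'. ?\<phi> (a \<otimes>\<^bsub>?A\<^esub> Antip C Y X b) \<odot>\<^bsub>?T\<^esub> ?p v0 a' b') (Delta C X X Y h)) (coact V v)) u) z"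
    by (simp del: box_balanced box_balanced') (simp add: cotensor_counit_def del: box_balanced box_balanced')
  also have "\<dots> = tsum ?U ?B ?T (\<lambda>u b. tsum V ?A ?T (\<lambda>v a. tsum ?A YY ?T (\<lambda>a' c.
      tsum ?B ?A ?T (\<lambda>b' a2. ?\<phi> (a2 \<otimes>\<^bsub>?A\<^esub> Antip C Y X b) \<odot>\<^bsub>?T\<^esub> ?p v a' b') (Delta C Y Y X c)) (Delta C X Y Y a)) u) z"
    by simp
  also have "\<dots> = tsum ?U ?B ?T (\<lambda>u b. tsum ?U YY ?T (\<lambda>u0 c. tsum V ?A ?T (\<lambda>v a'.
      tsum ?B ?A ?T (\<lambda>b' a2. ?\<phi> (a2 \<otimes>\<^bsub>?A\<^esub> Antip C Y X b) \<odot>\<^bsub>?T\<^esub> ?p v a' b') (Delta C Y Y X c)) u0) (box_coact V u)) z"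
    by simp
  also have "\<dots> = tsum ?U ?B ?T (\<lambda>u b. tsum YY ?B ?T (\<lambda>c b2. tsum V ?A ?T (\<lambda>v a'.
      tsum ?B ?A ?T (\<lambda>b' a2. ?\<phi> (a2 \<otimes>\<^bsub>?A\<^esub> Antip C Y X b2) \<odot>\<^bsub>?T\<^esub> ?p v a' b') (Delta C Y Y X c)) u) (Delta C Y X Y b)) z"
    using swap.box_balanced[OF comod_cotensor[OF assms(1)] z, of ?T "\<lambda>u0 c b. tsum V ?A ?T (\<lambda>v a'.
      tsum ?B ?A ?T (\<lambda>b' a2. ?\<phi> (a2 \<otimes>\<^bsub>?A\<^esub> Antip C Y X b) \<odot>\<^bsub>?T\<^esub> ?p v a' b') (Delta C Y Y X c)) u0"]
    by (simp del: tsum_cotensor_coact tsum_cotensor_coact' with_coact_rules)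
  also have "\<dots> = tsum ?U ?B ?T (\<lambda>u b. tsum V ?A ?T (\<lambda>v a'. tsum YY ?B ?T (\<lambda>c b2. 
      tsum ?B ?A ?T (\<lambda>b' a2. ?\<phi> (a2 \<otimes>\<^bsub>?A\<^esub> Antip C Y X b2) \<odot>\<^bsub>?T\<^esub> ?p v a' b') (Delta C Y Y X c)) (Delta C Y X Y b)) u) z"
    by (intro tsum_cong HOL.refl tsum_swap) simp_all
  also have "\<dots> = tsum ?U ?B ?T (\<lambda>u b. tsum V ?A ?T (\<lambda>v a'. tsum ?B XX ?T (\<lambda>b' h.
      tsum ?A ?B ?T (\<lambda>a2 b2. ?\<phi> (a2 \<otimes>\<^bsub>?A\<^esub> Antip C Y X b2) \<odot>\<^bsub>?T\<^esub> ?p v a' b') (Delta C X X Y h)) (Delta C Y X X b)) u) z"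
    by simp
  also have "\<dots> = tsum ?U ?B ?T (\<lambda>u b. tsum V ?A ?T (\<lambda>v a. ?p v a b) u) z"
    by (simp add: tsum_antip(1)[where f="\<lambda>b. ?\<phi> b \<odot>\<^bsub>?T\<^esub> m" for m])
  finally have "tsum ?U ?B ?T (\<lambda>u b. tsum V ?A ?T (\<lambda>v a. ?p v a b) u) (cotensor_unit V (cotensor_counit V z)) =
    tsum ?U ?B ?T (\<lambda>u b. tsum V ?A ?T (\<lambda>v a. ?p v a b) u) z" .
  from box_tensor_eqI[OF assms(1) _ _ _ this] show ?thesis by simp
qed

lemmas with_coact_unit_rules [simp] =
  tsum_cotensor_unit[where V="with_coact M \<alpha>" for M \<alpha>, unfolded forget_coact with_coact_simps]
  tsum_cotensor_unit'[where V="with_coact M \<alpha>" for M \<alpha>, unfolded forget_coact with_coact_simps]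

lemma cotensor_unit_iso:
  assumes "HX.comod V"
  shows "is_iso (Comod_at K C X) V (cotensor_comodule K C Y X (cotensor_comodule K C X Y V)) (\<lambda>v\<in>carrier V. cotensor_unit V v)"
proof -
  note [simp] = assms
  let ?F = "with_coact (box V) (box_coact V)"
  show ?thesis
  proof (rule HX.is_iso_ComodI[where g="cotensor_counit V"])
    show "HX.colinear V (cotensor_comodule K C Y X (cotensor_comodule K C X Y V)) (cotensor_unit V)"
      by (rule cotensor_unit_colinear[OF assms])
    fix w assume "w \<in> carrier (cotensor_comodule K C Y X (cotensor_comodule K C X Y V))"
    then have w: "w \<in> carrier (cobox ?F)" by simp
    show "cotensor_counit V w \<in> carrier V" unfolding cotensor_counit_def by simp
    show "cotensor_unit V (cotensor_counit V w) = w" by (rule cotensor_unit_counit[OF assms w])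
  qed (simp_all add: cotensor_counit_unit)
qed

lemma cotensor_unit_natural:
  assumes "HX.comod V" "HX.comod W"
    and f: "f \<in> carrier (comodule_Hom K XX V W)" and v: "v \<in> carrier V"
  shows "cotensor_unit W (f v) =
    MapM (cotensor_functor K C Y X) (cotensor_comodule K C X Y V) (cotensor_comodule K C X Y W)
      (MapM (cotensor_functor K C X Y) V W f) (cotensor_unit V v)"
proof -
  note cf = HX.arrow_colinear[OF assms(1) f]
  note lf = HX.colinear_linear[OF cf]
  note [simp] = assms(1,2) v HX.arrow_closed[OF f] linear_map_compose[OF lf] HX.tsum_colinear[OF cf]
    box_map_closed[OF assms(1,2) f] box_map_linear[OF assms(1,2) f]
  have "cotensor_unit W (f v) = tsum (box V) YX (tensor K (box W) YX) (\<lambda>u b.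
      pure K (box W) YX (tsum V XY (tensor K W XY) (\<lambda>v a. pure K W XY (f v) a) u) b)
    (cotensor_unit V v)"
    by (rule box_tensor_eqI[of W YX]) simp_all
  then show ?thesis by (simp add: MapM_cotensor swap.MapM_cotensor)
qed

text \<open>Embedded into \<open>V \<otimes> W \<otimes> C(X,Y) \<otimes> C(Y,X)\<close>, the left side is \<open>v\<^sub>0 \<otimes> w\<^sub>0 \<otimes> \<Delta>(v\<^sub>1 w\<^sub>1)\<close> and the right side is
  \<open>v\<^sub>0 \<otimes> w\<^sub>0 \<otimes> \<Delta>(v\<^sub>1) \<Delta>(w\<^sub>1)\<close>.\<close>

lemma cotensor_unit_tensor:
  assumes "HX.comod V" "HX.comod W" and x: "x \<in> carrier (tensor K V W)"
  defines "F \<equiv> cotensor_comodule K C X Y"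
  shows "cotensor_unit (comodule_tensor K XX V W) x =
    MapM (cotensor_functor K C Y X) (comodule_tensor K YY (F V) (F W)) (F (comodule_tensor K XX V W))
      (TensF (cotensor_functor K C X Y) V W)
      (TensF (cotensor_functor K C Y X) (F V) (F W)
        (tsum V W (tensor K (cobox (F V)) (cobox (F W)))
          (\<lambda>v w. pure K (cobox (F V)) (cobox (F W)) (cotensor_unit V v) (cotensor_unit W w)) x))"
    (is "?l = MapM ?G ?P ?Q ?t (TensF ?G (F V) (F W) ?z)")
proof -
  note [simp] = assms(1,2) x
  let ?A = XY and ?B = YX and ?UV = "box V" and ?UW = "box W"
  let ?VW = "with_coact (tensor K V W) (codiagonal K XX V W)"
  let ?m = "tsum ?UV ?UW (tensor K (tensor K V W) ?A) (box_mult V W)"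
  have F [simp]: "F V = with_coact ?UV (box_coact V)" "F W = with_coact ?UW (box_coact W)"
    by (simp_all add: F_def)
  have cF: "HY.comod (F V)" "HY.comod (F W)" "HY.comod ?P" by simp_all
  note [simp] = swap.box_tensor[of _ "F V", simplified] swap.box_tensor[of _ "F W", simplified]
  have z: "?z \<in> carrier (tensor K (cobox (F V)) (cobox (F W)))" by simp
  have "TensF ?G (F V) (F W) ?z \<in> carrier (cobox ?P)"
    using HX.arrow_closed[OF swap.TensF_cotensor_arrow[OF cF(1,2)], of ?z] z by simp
  then have "MapM ?G ?P ?Q ?t (TensF ?G (F V) (F W) ?z) =
    tsum (tensor K ?UV ?UW) ?B (tensor K (box ?VW) ?B) (\<lambda>t b. pure K (box ?VW) ?B (?t t) b) (TensF ?G (F V) (F W) ?z)"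
    using swap.MapM_cotensor[OF cF(3)] by (simp add: F_def)
  also have "\<dots> = tsum (tensor K ?UV ?UW) ?B (tensor K (box ?VW) ?B) (\<lambda>t b. pure K (box ?VW) ?B (?m t) b)
      (TensF ?G (F V) (F W) ?z)"
    by (intro tsum_cong HOL.refl) (simp add: TensF_cotensor)
  also have "\<dots> = tsum (tensor K ?UV ?UW) ?B (tensor K (box ?VW) ?B) (\<lambda>t b. pure K (box ?VW) ?B (?m t) b)
      (tsum (cobox (F V)) (cobox (F W)) (tensor K (tensor K ?UV ?UW) ?B) (swap.box_mult (F V) (F W)) ?z)"
    using z swap.TensF_cotensor[OF cF(1,2)] by (intro tsum_cong HOL.refl) simp
  also have "\<dots> = cotensor_unit ?VW x"
    by (rule box_tensor_eqI[of ?VW ?B]) simp_all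
  finally show ?thesis by simp
qed

text \<open>Both sides are \<open>c \<otimes> 1 \<otimes> 1\<close> after embedding, since \<open>\<Delta>\<close> is unital.\<close>

lemma cotensor_unit_unit:
  assumes c: "c \<in> carrier (unit_space K)"
  defines "I \<equiv> unit_comodule K XX" and "J \<equiv> unit_comodule K YY"
  shows "cotensor_unit I c = MapM (cotensor_functor K C Y X) J (cotensor_comodule K C X Y I)
    (UnitF (cotensor_functor K C X Y)) (UnitF (cotensor_functor K C Y X) c)"
proof -
  note [simp] = assms(1)
  let ?A = XY and ?B = YX
  let ?I = "with_coact (unit_space K) (\<lambda>x. pure K (unit_space K) XX x \<one>\<^bsub>XX\<^esub>)"
  have I [simp]: "I = ?I" by (simp add: I_def)
  have cJ: "HY.comod J" by (simp add: J_def)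
  have unit [simp]: "pure K (unit_space K) ?A c \<one>\<^bsub>?A\<^esub> \<in> carrier (box ?I)" if "c \<in> carrier (unit_space K)" for c
    unfolding box_iff[OF HX.comod_unit] using that by simp
  have unit_linear [simp]: "linear_map K (unit_space K) (box ?I) (\<lambda>c. pure K (unit_space K) ?A c \<one>\<^bsub>?A\<^esub>)"
    using box_tensor[of _ ?I, unfolded forget_coact] by (simp add: linear_map_box)
  note [simp] = box_tensor[of _ ?I, unfolded forget_coact]
  have "UnitF (cotensor_functor K C Y X) c \<in> carrier (cobox J)"
    using HX.arrow_closed[OF swap.UnitF_cotensor_arrow, of c] by (simp add: J_def)
  then have "MapM (cotensor_functor K C Y X) J (cotensor_comodule K C X Y I)
      (UnitF (cotensor_functor K C X Y)) (UnitF (cotensor_functor K C Y X) c) =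
    tsum (unit_space K) ?B (tensor K (box ?I) ?B) (\<lambda>v a. pure K (box ?I) ?B (UnitF (cotensor_functor K C X Y) v) a)
      (UnitF (cotensor_functor K C Y X) c)"
    using swap.MapM_cotensor[OF cJ] by (simp add: J_def)
  also have "\<dots> = tsum (unit_space K) ?B (tensor K (box ?I) ?B) (\<lambda>v a. pure K (box ?I) ?B (pure K (unit_space K) ?A v \<one>\<^bsub>?A\<^esub>) a)
      (pure K (unit_space K) ?B c \<one>\<^bsub>?B\<^esub>)"
    by (intro tsum_cong HOL.refl) (simp_all add: UnitF_cotensor swap.UnitF_cotensor)
  also have "\<dots> = cotensor_unit ?I c"
    by (rule box_tensor_eqI[of ?I ?B]) simp_all
  finally show ?thesis by simp
qed

lemma monoidal_nat_iso_cotensor: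
  "monoidal_nat_iso (Comod_at K C X) (Comod_at K C X) (identity_functor (Comod_at K C X))
    (compose_functor (Comod_at K C X) (Comod_at K C Y) (Comod_at K C X) (cotensor_functor K C Y X) (cotensor_functor K C X Y))
    (\<lambda>V. \<lambda>v\<in>carrier V. cotensor_unit V v)"
  unfolding monoidal_nat_iso_def HX.Comod_simps HY.Comod_simps mem_Collect_eq identity_functor_def compose_functor_def
    monoidal_functor_data.simps Ball_def
proof (intro conjI allI impI, goal_cases)
  case (1 V)
  then show ?case using cotensor_unit_iso by simp
next
  case (2 V W f)
  then show ?case
    using cotensor_unit_natural[of V W f] HX.arrow_closed[of f V W] by (intro compose_eqI) simp
next
  case VW: (3 V W)
  note [simp] = VW
  let ?F = "\<lambda>V. cobox (cotensor_comodule K C X Y V)"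
  have "TensM (Comod_at K C X) V (with_coact (?F V) (cobox_coact (cotensor_comodule K C X Y V)))
      W (with_coact (?F W) (cobox_coact (cotensor_comodule K C X Y W)))
       (\<lambda>v\<in>carrier V. cotensor_unit V v) (\<lambda>v\<in>carrier W. cotensor_unit W v) x =
      tsum V W (tensor K (?F V) (?F W)) (\<lambda>v w. pure K (?F V) (?F W) (cotensor_unit V v) (cotensor_unit W w)) x"
    if "x \<in> carrier (tensor K V W)" for x
    using that by (simp add: HX.TensM_Comod)
  then show ?case
    using cotensor_unit_tensor[OF VW] by (intro compose_eqI) (simp add: compose_def)
next
  case 4
  then show ?case using cotensor_unit_unit by (intro compose_eqI) simp
qed

end

section \<open>Monoidal structure maps of quasi-inverse functors are invertible\<close>

context linear_category
begin

lemma Comp_closed [simp]: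
  "X \<in> Ob C \<Longrightarrow> Y \<in> Ob C \<Longrightarrow> Z \<in> Ob C \<Longrightarrow> f \<in> arrows C X Y \<Longrightarrow> g \<in> arrows C Y Z \<Longrightarrow> Comp C X Y Z g f \<in> arrows C X Z"
  using Comp_linear_left[of X Y Z f] by (auto simp: linear_map_def)

lemma Comp_assoc':
  "W \<in> Ob C \<Longrightarrow> X \<in> Ob C \<Longrightarrow> Y \<in> Ob C \<Longrightarrow> Z \<in> Ob C \<Longrightarrow>
      f \<in> arrows C W X \<Longrightarrow> g \<in> arrows C X Y \<Longrightarrow> h \<in> arrows C Y Z \<Longrightarrow>
      Comp C W X Z (Comp C X Y Z h g) f = Comp C W Y Z h (Comp C W X Y g f)"
  using Comp_assoc by simp

lemma Comp_cancel:
  assumes "W \<in> Ob C" "X \<in> Ob C" "Y \<in> Ob C" "f \<in> arrows C X Y" "g \<in> arrows C Y X" "Comp C X Y X g f = Ident C X"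
    and "h \<in> arrows C W X"
  shows "Comp C W Y X g (Comp C W X Y f h) = h"
  using Comp_assoc[of W X Y X h f g] Ident_Comp[of W X h] assms by simp

end

locale quasi_inverse_tensor_functors =
  F: tensor_functor K C D F + G: tensor_functor K D C G
  for K :: "('k, 'r) ring_scheme"
    and C :: "('k, 'o, 'm, 's) monoidal_category_data_scheme"
    and D :: "('k, 'p, 'n, 't) monoidal_category_data_scheme"
    and F :: "('o, 'm, 'p, 'n) monoidal_functor_data"
    and G :: "('p, 'n, 'o, 'm) monoidal_functor_data" +
  fixes \<eta> :: "'o \<Rightarrow> 'm" and \<theta> :: "'p \<Rightarrow> 'n"
  assumes unit_iso: "monoidal_nat_iso C C (identity_functor C) (compose_functor C D C G F) \<eta>"
    and counit_iso: "monoidal_nat_iso D D (identity_functor D) (compose_functor D C D F G) \<theta>"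
begin

lemma swap: "quasi_inverse_tensor_functors K D C G F \<theta> \<eta>"
  by (intro quasi_inverse_tensor_functors.intro quasi_inverse_tensor_functors_axioms.intro
      F.tensor_functor_axioms G.tensor_functor_axioms unit_iso counit_iso)

lemmas [simp] = F.MapO G.MapO F.source.TensO F.target.TensO F.source.UnitO F.target.UnitO F.source.Ident F.target.Ident
  F.UnitF G.UnitF F.TensF G.TensF

lemma MapM_closed [simp]:
  "X \<in> Ob C \<Longrightarrow> Y \<in> Ob C \<Longrightarrow> f \<in> arrows C X Y \<Longrightarrow> MapM F X Y f \<in> arrows D (MapO F X) (MapO F Y)"
  "V \<in> Ob D \<Longrightarrow> W \<in> Ob D \<Longrightarrow> g \<in> arrows D V W \<Longrightarrow> MapM G V W g \<in> arrows C (MapO G V) (MapO G W)"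
  using F.MapM_linear[of X Y] G.MapM_linear[of V W] by (auto simp: linear_map_def)

lemma TensM_closed [simp]:
  "X \<in> Ob C \<Longrightarrow> X' \<in> Ob C \<Longrightarrow> Y \<in> Ob C \<Longrightarrow> Y' \<in> Ob C \<Longrightarrow> f \<in> arrows C X X' \<Longrightarrow> g \<in> arrows C Y Y' \<Longrightarrow>
    TensM C X X' Y Y' f g \<in> arrows C (TensO C X Y) (TensO C X' Y')"
  "V \<in> Ob D \<Longrightarrow> V' \<in> Ob D \<Longrightarrow> W \<in> Ob D \<Longrightarrow> W' \<in> Ob D \<Longrightarrow> h \<in> arrows D V V' \<Longrightarrow> k \<in> arrows D W W' \<Longrightarrow>
    TensM D V V' W W' h k \<in> arrows D (TensO D V W) (TensO D V' W')"
  using F.source.TensM_linear_left[of X X' Y Y' g] F.target.TensM_linear_left[of V V' W W' k] by (auto simp: linear_map_def)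

lemmas unit_iso' = unit_iso[unfolded monoidal_nat_iso_def identity_functor_def compose_functor_def monoidal_functor_data.simps]

lemma unit_arrow [simp]: "X \<in> Ob C \<Longrightarrow> \<eta> X \<in> arrows C X (MapO G (MapO F X))"
  and unit_inverse: "X \<in> Ob C \<Longrightarrow> \<exists>h\<in>arrows C (MapO G (MapO F X)) X.
    Comp C X (MapO G (MapO F X)) X h (\<eta> X) = Ident C X \<and>
    Comp C (MapO G (MapO F X)) X (MapO G (MapO F X)) (\<eta> X) h = Ident C (MapO G (MapO F X))"
  and unit_natural: "X \<in> Ob C \<Longrightarrow> Y \<in> Ob C \<Longrightarrow> f \<in> arrows C X Y \<Longrightarrow>
    Comp C X Y (MapO G (MapO F Y)) (\<eta> Y) f =
    Comp C X (MapO G (MapO F X)) (MapO G (MapO F Y)) (MapM G (MapO F X) (MapO F Y) (MapM F X Y f)) (\<eta> X)"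
  using unit_iso' unfolding is_iso_def by blast+

lemma unit_tensor:
  assumes "X \<in> Ob C" "Y \<in> Ob C"
  defines "FX \<equiv> MapO F X" and "FY \<equiv> MapO F Y" and "FXY \<equiv> MapO F (TensO C X Y)"
  shows "\<eta> (TensO C X Y) = Comp C (TensO C X Y) (MapO G (TensO D FX FY)) (MapO G FXY)
    (MapM G (TensO D FX FY) FXY (TensF F X Y))
    (Comp C (TensO C X Y) (TensO C (MapO G FX) (MapO G FY)) (MapO G (TensO D FX FY))
      (TensF G FX FY) (TensM C X (MapO G FX) Y (MapO G FY) (\<eta> X) (\<eta> Y)))"
proof -
  have "Comp C (TensO C X Y) (TensO C X Y) (MapO G FXY) (\<eta> (TensO C X Y)) (Ident C (TensO C X Y)) =
    Comp C (TensO C X Y) (TensO C (MapO G FX) (MapO G FY)) (MapO G FXY)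
      (Comp C (TensO C (MapO G FX) (MapO G FY)) (MapO G (TensO D FX FY)) (MapO G FXY)
        (MapM G (TensO D FX FY) FXY (TensF F X Y)) (TensF G FX FY))
      (TensM C X (MapO G FX) Y (MapO G FY) (\<eta> X) (\<eta> Y))"
    unfolding FX_def FY_def FXY_def using unit_iso' assms(1,2) by blast
  then show ?thesis
    using assms by (simp add: F.source.Comp_Ident F.source.Comp_assoc')
qed

lemma unit_unit:
  "\<eta> (UnitO C) = Comp C (UnitO C) (MapO G (UnitO D)) (MapO G (MapO F (UnitO C)))
    (MapM G (UnitO D) (MapO F (UnitO C)) (UnitF F)) (UnitF G)"
proof -
  have "Comp C (UnitO C) (UnitO C) (MapO G (MapO F (UnitO C))) (\<eta> (UnitO C)) (Ident C (UnitO C)) =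
    Comp C (UnitO C) (MapO G (UnitO D)) (MapO G (MapO F (UnitO C)))
      (MapM G (UnitO D) (MapO F (UnitO C)) (UnitF F)) (UnitF G)"
    using unit_iso' by blast
  then show ?thesis by (simp add: F.source.Comp_Ident)
qed

lemma MapM_faithful:
  assumes "X \<in> Ob C" "Y \<in> Ob C" "f \<in> arrows C X Y" "g \<in> arrows C X Y" "MapM F X Y f = MapM F X Y g"
  shows "f = g"
proof -
  note [simp] = assms(1-4)
  obtain h where h: "h \<in> arrows C (MapO G (MapO F Y)) Y" "Comp C Y (MapO G (MapO F Y)) Y h (\<eta> Y) = Ident C Y"
    using unit_inverse[OF assms(2)] by blast
  have "f = Comp C X (MapO G (MapO F Y)) Y h (Comp C X Y (MapO G (MapO F Y)) (\<eta> Y) f)"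
    using h by (simp add: F.source.Comp_cancel)
  also have "\<dots> = Comp C X (MapO G (MapO F Y)) Y h (Comp C X Y (MapO G (MapO F Y)) (\<eta> Y) g)"
    using assms(5) by (simp add: unit_natural)
  also have "\<dots> = g"
    using h by (simp add: F.source.Comp_cancel)
  finally show ?thesis .
qed

text \<open>By \<open>unit_tensor\<close>, the composite \<open>G (TensF F X Y) \<circ> TensF G (F X) (F Y)\<close> becomes the isomorphism
  \<open>\<eta> (X \<otimes> Y)\<close> after composition with the isomorphism \<open>\<eta> X \<otimes> \<eta> Y\<close>. So it is an isomorphism itself,
  its first factor has a section and its second factor a retraction.\<close>

lemma TensF_image_split:
  assumes "X \<in> Ob C" "Y \<in> Ob C"
  defines "FX \<equiv> MapO F X" and "FY \<equiv> MapO F Y" and "FXY \<equiv> MapO F (TensO C X Y)"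
  shows "\<exists>r\<in>arrows C (MapO G (TensO D FX FY)) (TensO C (MapO G FX) (MapO G FY)).
      Comp C (TensO C (MapO G FX) (MapO G FY)) (MapO G (TensO D FX FY)) (TensO C (MapO G FX) (MapO G FY)) r (TensF G FX FY) =
        Ident C (TensO C (MapO G FX) (MapO G FY))"
    and "\<exists>s\<in>arrows C (MapO G FXY) (MapO G (TensO D FX FY)).
      Comp C (MapO G FXY) (MapO G (TensO D FX FY)) (MapO G FXY) (MapM G (TensO D FX FY) FXY (TensF F X Y)) s = Ident C (MapO G FXY)"
proof -
  note [simp] = assms(1,2)
  have [simp]: "FX \<in> Ob D" "FY \<in> Ob D" "FXY \<in> Ob D" "\<eta> X \<in> arrows C X (MapO G FX)" "\<eta> Y \<in> arrows C Y (MapO G FY)"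
    "\<eta> (TensO C X Y) \<in> arrows C (TensO C X Y) (MapO G FXY)" "TensF F X Y \<in> arrows D (TensO D FX FY) FXY"
    by (simp_all add: FX_def FY_def FXY_def)
  let ?XY = "TensO C X Y" and ?P = "TensO C (MapO G FX) (MapO G FY)" and ?Q = "MapO G (TensO D FX FY)" and ?R = "MapO G FXY"
  let ?t = "MapM G (TensO D FX FY) FXY (TensF F X Y)" and ?m = "TensM C X (MapO G FX) Y (MapO G FY) (\<eta> X) (\<eta> Y)"
  obtain p where p [simp]: "p \<in> arrows C (MapO G FX) X" and pX: "Comp C (MapO G FX) X (MapO G FX) (\<eta> X) p = Ident C (MapO G FX)"
    using unit_inverse[of X] by (auto simp: FX_def)
  obtain q where q [simp]: "q \<in> arrows C (MapO G FY) Y" and qY: "Comp C (MapO G FY) Y (MapO G FY) (\<eta> Y) q = Ident C (MapO G FY)"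
    using unit_inverse[of Y] by (auto simp: FY_def)
  obtain e where e [simp]: "e \<in> arrows C ?R ?XY" and e1: "Comp C ?XY ?R ?XY e (\<eta> ?XY) = Ident C ?XY"
    and e2: "Comp C ?R ?XY ?R (\<eta> ?XY) e = Ident C ?R"
    using unit_inverse[of ?XY] by (auto simp: FXY_def)
  let ?n = "TensM C (MapO G FX) X (MapO G FY) Y p q"
  have mn: "Comp C ?P ?XY ?P ?m ?n = Ident C ?P"
    by (subst F.source.TensM_Comp[symmetric]) (simp_all add: pX qY F.source.TensM_Ident)
  have eta: "\<eta> ?XY = Comp C ?XY ?Q ?R ?t (Comp C ?XY ?P ?Q (TensF G FX FY) ?m)"
    using unit_tensor[OF assms(1,2)] by (simp add: FX_def FY_def FXY_def)
  have tTens: "Comp C ?P ?Q ?R ?t (TensF G FX FY) = Comp C ?P ?XY ?R (\<eta> ?XY) ?n"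
    unfolding eta by (simp add: F.source.Comp_assoc' mn F.source.Comp_Ident)
  show "\<exists>r\<in>arrows C ?Q ?P. Comp C ?P ?Q ?P r (TensF G FX FY) = Ident C ?P"
  proof (rule bexI)
    show "Comp C ?P ?Q ?P (Comp C ?Q ?XY ?P ?m (Comp C ?Q ?R ?XY e ?t)) (TensF G FX FY) = Ident C ?P"
      by (simp add: F.source.Comp_assoc' tTens F.source.Comp_cancel[OF _ _ _ _ _ e1] mn)
  qed simp
  show "\<exists>s\<in>arrows C ?R ?Q. Comp C ?R ?Q ?R ?t s = Ident C ?R"
  proof (rule bexI)
    show "Comp C ?R ?Q ?R ?t (Comp C ?R ?XY ?Q (Comp C ?XY ?P ?Q (TensF G FX FY) ?m) e) = Ident C ?R"
      by (simp add: F.source.Comp_assoc[symmetric] F.source.Comp_assoc'[symmetric] eta[symmetric] e2 del: F.source.Comp_assoc')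
  qed simp
qed

lemma UnitF_image_split:
  shows "\<exists>r\<in>arrows C (MapO G (UnitO D)) (UnitO C).
      Comp C (UnitO C) (MapO G (UnitO D)) (UnitO C) r (UnitF G) = Ident C (UnitO C)"
    and "\<exists>s\<in>arrows C (MapO G (MapO F (UnitO C))) (MapO G (UnitO D)).
      Comp C (MapO G (MapO F (UnitO C))) (MapO G (UnitO D)) (MapO G (MapO F (UnitO C)))
        (MapM G (UnitO D) (MapO F (UnitO C)) (UnitF F)) s = Ident C (MapO G (MapO F (UnitO C)))"
proof -
  let ?I = "UnitO C" and ?Q = "MapO G (UnitO D)" and ?R = "MapO G (MapO F (UnitO C))"
  let ?u = "MapM G (UnitO D) (MapO F (UnitO C)) (UnitF F)"
  obtain e where e [simp]: "e \<in> arrows C ?R ?I" and e1: "Comp C ?I ?R ?I e (\<eta> ?I) = Ident C ?I"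
    and e2: "Comp C ?R ?I ?R (\<eta> ?I) e = Ident C ?R"
    using unit_inverse[of ?I] by auto
  show "\<exists>r\<in>arrows C ?Q ?I. Comp C ?I ?Q ?I r (UnitF G) = Ident C ?I"
  proof (rule bexI)
    show "Comp C ?I ?Q ?I (Comp C ?Q ?R ?I e ?u) (UnitF G) = Ident C ?I"
      using e1 by (simp add: F.source.Comp_assoc' unit_unit)
  qed simp
  show "\<exists>s\<in>arrows C ?R ?Q. Comp C ?R ?Q ?R ?u s = Ident C ?R"
  proof (rule bexI)
    show "Comp C ?R ?Q ?R ?u (Comp C ?R ?I ?Q (UnitF G) e) = Ident C ?R"
      using e2 by (simp add: F.source.Comp_assoc unit_unit)
  qed simp
qed

text \<open>The isomorphisms \<open>\<theta>\<close> and naturality carry the retraction from objects in the image of \<open>F\<close> to all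
  objects.\<close>

lemma TensF_split_mono:
  assumes "V \<in> Ob D" "W \<in> Ob D"
  shows "\<exists>r\<in>arrows C (MapO G (TensO D V W)) (TensO C (MapO G V) (MapO G W)).
      Comp C (TensO C (MapO G V) (MapO G W)) (MapO G (TensO D V W)) (TensO C (MapO G V) (MapO G W)) r (TensF G V W) =
        Ident C (TensO C (MapO G V) (MapO G W))"
proof -
  interpret swap: quasi_inverse_tensor_functors K D C G F \<theta> \<eta> by (rule swap)
  note [simp] = assms
  let ?V = "MapO F (MapO G V)" and ?W = "MapO F (MapO G W)"
  obtain p where p [simp]: "p \<in> arrows D ?V V" and pV: "Comp D V ?V V p (\<theta> V) = Ident D V"
    using swap.unit_inverse[of V] by auto
  obtain q where q [simp]: "q \<in> arrows D ?W W" and qW: "Comp D W ?W W q (\<theta> W) = Ident D W"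
    using swap.unit_inverse[of W] by auto
  let ?P = "TensO C (MapO G V) (MapO G W)" and ?Q = "MapO G (TensO D V W)"
  let ?P' = "TensO C (MapO G ?V) (MapO G ?W)" and ?Q' = "MapO G (TensO D ?V ?W)"
  let ?m = "TensM C (MapO G V) (MapO G ?V) (MapO G W) (MapO G ?W) (MapM G V ?V (\<theta> V)) (MapM G W ?W (\<theta> W))"
  let ?n = "TensM C (MapO G ?V) (MapO G V) (MapO G ?W) (MapO G W) (MapM G ?V V p) (MapM G ?W W q)"
  let ?M = "MapM G (TensO D V W) (TensO D ?V ?W) (TensM D V ?V W ?W (\<theta> V) (\<theta> W))"
  obtain r where r [simp]: "r \<in> arrows C ?Q' ?P'" and r1: "Comp C ?P' ?Q' ?P' r (TensF G ?V ?W) = Ident C ?P'"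
    using TensF_image_split(1)[of "MapO G V" "MapO G W"] by auto
  have nm: "Comp C ?P ?P' ?P ?n ?m = Ident C ?P"
    by (subst F.source.TensM_Comp[symmetric])
      (simp_all add: G.MapM_Comp[symmetric] pV qW G.MapM_Ident F.source.TensM_Ident)
  have nat: "Comp C ?P ?Q ?Q' ?M (TensF G V W) = Comp C ?P ?P' ?Q' (TensF G ?V ?W) ?m"
    by (rule G.TensF_natural[symmetric]) simp_all
  show ?thesis
  proof (rule bexI)
    show "Comp C ?P ?Q ?P (Comp C ?Q ?P' ?P ?n (Comp C ?Q ?Q' ?P' r ?M)) (TensF G V W) = Ident C ?P"
      by (simp add: F.source.Comp_assoc' nat F.source.Comp_cancel[OF _ _ _ _ _ r1] nm)
  qed simp
qed

text \<open>A retraction \<open>r\<close> of \<open>f\<close> is mapped to a retraction of \<open>F f\<close>. As \<open>F f\<close> also has a section, the two agree,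
  so that \<open>F (f r)\<close> is an identity, and \<open>F\<close> is faithful.\<close>

lemma is_iso_of_split:
  assumes "X \<in> Ob C" "Y \<in> Ob C" "f \<in> arrows C X Y"
    and "\<exists>r\<in>arrows C Y X. Comp C X Y X r f = Ident C X"
    and "\<exists>s\<in>arrows D (MapO F Y) (MapO F X). Comp D (MapO F Y) (MapO F X) (MapO F Y) (MapM F X Y f) s = Ident D (MapO F Y)"
  shows "is_iso C X Y f"
proof -
  note [simp] = assms(1-3)
  obtain r where r [simp]: "r \<in> arrows C Y X" and rf: "Comp C X Y X r f = Ident C X" using assms(4) by blast
  obtain s where s [simp]: "s \<in> arrows D (MapO F Y) (MapO F X)"
    and fs: "Comp D (MapO F Y) (MapO F X) (MapO F Y) (MapM F X Y f) s = Ident D (MapO F Y)" using assms(5) by blast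
  have Frf: "Comp D (MapO F X) (MapO F Y) (MapO F X) (MapM F Y X r) (MapM F X Y f) = Ident D (MapO F X)"
    by (simp add: F.MapM_Comp[symmetric] rf F.MapM_Ident)
  have "MapM F Y X r = Comp D (MapO F Y) (MapO F Y) (MapO F X) (MapM F Y X r) (Comp D (MapO F Y) (MapO F X) (MapO F Y) (MapM F X Y f) s)"
    by (simp add: fs F.target.Comp_Ident)
  also have "\<dots> = s" by (simp add: F.target.Comp_cancel[OF _ _ _ _ _ Frf])
  finally have "MapM F Y Y (Comp C Y X Y f r) = MapM F Y Y (Ident C Y)"
    by (simp add: F.MapM_Comp fs F.MapM_Ident)
  then have "Comp C Y X Y f r = Ident C Y" by (rule MapM_faithful[rotated 4]) simp_all
  then show ?thesis using rf unfolding is_iso_def by auto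
qed

text \<open>Both kinds of structure map of \<open>F\<close> have a retraction by the splittings for the swapped
  pair, and their images under \<open>G\<close> have a section by the splittings for the pair itself.\<close>

lemma structure_maps_iso:
  shows "is_iso D (UnitO D) (MapO F (UnitO C)) (UnitF F)"
    and "X \<in> Ob C \<Longrightarrow> Y \<in> Ob C \<Longrightarrow> is_iso D (TensO D (MapO F X) (MapO F Y)) (MapO F (TensO C X Y)) (TensF F X Y)"
proof -
  interpret swap: quasi_inverse_tensor_functors K D C G F \<theta> \<eta> by (rule swap)
  show "is_iso D (UnitO D) (MapO F (UnitO C)) (UnitF F)"
    by (rule swap.is_iso_of_split[OF _ _ _ swap.UnitF_image_split(1) UnitF_image_split(2)]) simp_all
  assume XY: "X \<in> Ob C" "Y \<in> Ob C"
  show "is_iso D (TensO D (MapO F X) (MapO F Y)) (MapO F (TensO C X Y)) (TensF F X Y)"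
    by (rule swap.is_iso_of_split[OF _ _ _ swap.TensF_split_mono[OF XY] TensF_image_split(2)[OF XY]]) (use XY in simp_all)
qed

end

section \<open>The cotensor product functors are inverse equivalences\<close>

context cogroupoid_pair
begin

lemma quasi_inverse_cotensor:
  "quasi_inverse_tensor_functors K (Comod_at K C X) (Comod_at K C Y) (cotensor_functor K C X Y) (cotensor_functor K C Y X)
    (\<lambda>V. \<lambda>v\<in>carrier V. cotensor_unit V v) (\<lambda>V. \<lambda>v\<in>carrier V. swap.cotensor_unit V v)"
  by (intro quasi_inverse_tensor_functors.intro quasi_inverse_tensor_functors_axioms.intro
      tensor_functor_cotensor swap.tensor_functor_cotensor monoidal_nat_iso_cotensor swap.monoidal_nat_iso_cotensor)

lemma linear_monoidal_functor_cotensor: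
  "linear_monoidal_functor K (Comod_at K C X) (Comod_at K C Y) (cotensor_functor K C X Y)"
proof -
  interpret quasi_inverse_tensor_functors K "Comod_at K C X" "Comod_at K C Y" "cotensor_functor K C X Y" "cotensor_functor K C Y X"
    "\<lambda>V. \<lambda>v\<in>carrier V. cotensor_unit V v" "\<lambda>V. \<lambda>v\<in>carrier V. swap.cotensor_unit V v"
    by (rule quasi_inverse_cotensor)
  have Ob: "V \<in> Ob (Comod_at K C X) \<Longrightarrow> HX.comod V" for V by (simp add: Comod_def)
  show ?thesis
    by (intro linear_monoidal_functor.intro linear_monoidal_functor_axioms.intro F.source.linear_monoidal_category_axioms
        F.target.linear_monoidal_category_axioms F.MapO F.MapM_linear F.MapM_Ident F.MapM_Comp structure_maps_iso
        F.TensF_natural TensF_cotensor_assoc TensF_cotensor_units Ob)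
qed

end

theorem theorem2p12:
  fixes K :: "('k, 'r) ring_scheme" and C :: "('k, 'o, 'a) cogroupoid_data" and X Y :: 'o
  assumes "connected_cogroupoid K C"
    and "X \<in> Obs C" and "Y \<in> Obs C"
  shows "linear_monoidal_equivalence K (Comod_at K C X) (Comod_at K C Y) (cotensor_functor K C X Y) \<and>
    linear_monoidal_equivalence K (Comod_at K C Y) (Comod_at K C X) (cotensor_functor K C Y X) \<and>
    inverse_monoidal_functors K (Comod_at K C X) (Comod_at K C Y)
      (cotensor_functor K C X Y) (cotensor_functor K C Y X)"
proof -
  interpret nonzero_cogroupoid K C using assms(1) by (rule nonzero_cogroupoid.intro)
  interpret cogroupoid_pair K C X Y using assms(2,3) by unfold_locales
  show ?thesis
    unfolding linear_monoidal_equivalence_def inverse_monoidal_functors_def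
    using linear_monoidal_functor_cotensor swap.linear_monoidal_functor_cotensor
      monoidal_nat_iso_cotensor swap.monoidal_nat_iso_cotensor by blast
qed

end
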